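(* Let $X_1,\dots,X_n,Y$ be Banach spaces over the same field $\mathbb K$. Then the map $$\Phi:(X_1\otimes\dots\otimes X_n\otimes Y,\gamma)^*\to\Gamma(X_1,\dots,X_n;Y^* ),\qquad \Phi(\varphi)=T_\varphi,\quad T_\varphi(x^1,\dots,x^n)(y)=\varphi(x^1\otimes\dots\otimes x^n\otimes y),$$ is an isometric linear isomorphism (onto), where $\Gamma(X_1,\dots,X_n;Y^* )$ carries the norm $\Gamma(\cdot)$.
   Context: $\mathbb K$ is $\mathbb R$ or $\mathbb C$; $n$ is a positive integer. $\mathcal L(X_1,\dots,X_n)$ is the space of bounded multilinear forms. $\pi$ is the projective norm on $X_1\otimes\dots\otimes X_n$, and $\Sigma_{X_1\dots X_n}=\{x^1\otimes\dots\otimes x^n:x^i\in X_i\}$. For $\varphi\in\mathcal L(X_1,\dots,X_n)$, $f_\varphi(x^1\otimes\dots\otimes x^n)=\varphi(x^1,\dots,x^n)$ on $\Sigma_{X_1\dots X_n}$. For finite sequences $(p_i)_{i=1}^m,(q_i)_{i=1}^m,(a_j)_{j=1}^l,(b_j)_{j=1}^l$ in $\Sigma_{X_1\dots X_n}$ write $(p_i,q_i)\le_\pi(a_j,b_j)$ if $\sum_{i=1}^m|f_\varphi(p_i)-f_\varphi(q_i)|^2\le\sum_{j=1}^l|f_\varphi(a_j)-f_\varphi(b_j)|^2$ for all $\varphi\in\mathcal L(X_1,\dots,X_n)$ (by adding zeros one may always take $m=l$). $X_1\otimes\dots\otimes X_n\otimes Y$ is identified with $(X_1\otimes\dots\otimes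 X_n)\otimes Y$. The norm $\gamma$ on it is $$\gamma(u)=\inf\Big(\sum_{i=1}^m\pi(a_i-b_i)^2\Big)^{1/2}\Big(\sum_{i=1}^m\|y_i\|^2\Big)^{1/2},$$ the infimum over all representations $u=\sum_{i=1}^m(p_i-q_i)\otimes y_i$ with $p_i,q_i\in\Sigma_{X_1\dots X_n}$, $y_i\in Y$, and all $a_i,b_i\in\Sigma_{X_1\dots X_n}$ with $(p_i,q_i)\le_\pi(a_i,b_i)$. A multilinear operator $T:X_1\times\dots\times X_n\to V$ ($V$ a Banach space) factors through a Hilbert space if there exist a Hilbert space $H$, a subset $M\subset H$, a bounded multilinear operator $A:X_1\times\dots\times X_n\to H$ with $A(X_1\times\dots\times X_n)\subset M$, and a Lipschitz function $B:M\to V$ such that $T=B\circ A$. Then $\Gamma(T)=\inf\|A\|\,\mathrm{Lip}(B)$, the infimum over all such factorizations, where $\|A\|=\sup\{\|A(x^1,\dots,x^n)\|:\|x^i\|\le1\}$ and $\mathrm{Lip}(B)$ is the least Lipschitz constant. $\Gamma(X_1,\dots,X_n;V)$ is the collection of all such $T$, normed by $\Gamma(\cdot)$. *)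

theory Defs
  imports Complex_Main "HOL-Algebra.Module"
begin

section \<open>Normed spaces over the real or complex field\<close>

text \<open>
  The field is a set \<open>K\<close> of complex numbers, either \<open>\<real>\<close> or \<open>UNIV\<close>, so that the real and the complex
  case are treated together; for \<open>K = \<real>\<close> all scalars, values of forms and inner products are real.
  Vector spaces are HOL-Algebra modules over \<open>K\<close> with an explicit carrier. This way the spaces
  \<open>X 1, \<dots>, X n\<close> form an arbitrary family over one type (any finite family of spaces can be copied
  into the disjoint sum of the underlying types). The ring multiplication and the unit which the
  record type \<^typ>\<open>('a, 'b) module\<close> inherits play no role for vectors.
\<close>

record ('a, 'b) normed_module = "('a, 'b) module" +
  vnorm :: "'b \<Rightarrow> real"

type_synonym 'a nspace = "(complex, 'a) normed_module"

definition scalar_space :: "complex set \<Rightarrow> complex nspace" where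
  "scalar_space K = \<lparr>carrier = K, mult = (*), one = 1, zero = 0, add = (+), smult = (*), vnorm = cmod\<rparr>"

definition add_norm :: "('c, 'a) module \<Rightarrow> ('a \<Rightarrow> real) \<Rightarrow> ('c, 'a) normed_module" where
  "add_norm M N = \<lparr>carrier = carrier M, mult = mult M, one = one M, zero = zero M, add = add M,
     smult = smult M, vnorm = N\<rparr>"

locale normed_space = module "scalar_space K" V
  for K :: "complex set" and V :: "'a nspace" (structure) +
  assumes norm_nonneg: "x \<in> carrier V \<Longrightarrow> 0 \<le> vnorm V x"
    and norm_eq_zero: "x \<in> carrier V \<Longrightarrow> vnorm V x = 0 \<longleftrightarrow> x = \<zero>\<^bsub>V\<^esub>"
    and norm_triangle: "x \<in> carrier V \<Longrightarrow> y \<in> carrier V \<Longrightarrow> vnorm V (x \<oplus>\<^bsub>V\<^esub> y) \<le> vnorm V x + vnorm V y"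
    and norm_smult: "c \<in> K \<Longrightarrow> x \<in> carrier V \<Longrightarrow> vnorm V (c \<odot>\<^bsub>V\<^esub> x) = cmod c * vnorm V x"

locale banach_space = normed_space +
  assumes complete:
    "(\<And>k. s k \<in> carrier V) \<Longrightarrow>
     (\<And>e. 0 < e \<Longrightarrow> \<exists>N. \<forall>j\<ge>N. \<forall>k\<ge>N. vnorm V (s j \<ominus>\<^bsub>V\<^esub> s k) < e) \<Longrightarrow>
     \<exists>l\<in>carrier V. (\<lambda>k::nat. vnorm V (s k \<ominus>\<^bsub>V\<^esub> l)) \<longlonglongrightarrow> 0"

locale inner_product = module "scalar_space K" V
  for K :: "complex set" and V :: "'a nspace" (structure) and ip :: "'a \<Rightarrow> 'a \<Rightarrow> complex" +
  assumes ip_closed: "x \<in> carrier V \<Longrightarrow> y \<in> carrier V \<Longrightarrow> ip x y \<in> K"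
    and ip_add: "x \<in> carrier V \<Longrightarrow> y \<in> carrier V \<Longrightarrow> z \<in> carrier V \<Longrightarrow> ip (x \<oplus>\<^bsub>V\<^esub> y) z = ip x z + ip y z"
    and ip_smult: "c \<in> K \<Longrightarrow> x \<in> carrier V \<Longrightarrow> y \<in> carrier V \<Longrightarrow> ip (c \<odot>\<^bsub>V\<^esub> x) y = c * ip x y"
    and ip_commute: "x \<in> carrier V \<Longrightarrow> y \<in> carrier V \<Longrightarrow> ip y x = cnj (ip x y)"
    and ip_nonneg: "x \<in> carrier V \<Longrightarrow> 0 \<le> Re (ip x x)"
    and ip_eq_zero: "x \<in> carrier V \<Longrightarrow> ip x x = 0 \<Longrightarrow> x = \<zero>\<^bsub>V\<^esub>"

definition hilbert_space :: "complex set \<Rightarrow> 'a nspace \<Rightarrow> bool" where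
  "hilbert_space K H \<longleftrightarrow> banach_space K H \<and>
     (\<exists>ip. inner_product K H ip \<and> (\<forall>x\<in>carrier H. vnorm H x = sqrt (Re (ip x x))))"

section \<open>Linear and multilinear maps\<close>

text \<open>Functions are extensional, i.e. \<open>undefined\<close> outside their domain, so that equality of functions
  is equality on the domain.\<close>

definition linear_on :: "complex set \<Rightarrow> (complex, 'a, 'm) module_scheme \<Rightarrow> (complex, 'b, 'k) module_scheme \<Rightarrow>
    ('a \<Rightarrow> 'b) \<Rightarrow> bool" where
  "linear_on K E F f \<longleftrightarrow> f \<in> carrier E \<rightarrow> carrier F \<and>
     (\<forall>x\<in>carrier E. \<forall>y\<in>carrier E. f (x \<oplus>\<^bsub>E\<^esub> y) = f x \<oplus>\<^bsub>F\<^esub> f y) \<and>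
     (\<forall>c\<in>K. \<forall>x\<in>carrier E. f (c \<odot>\<^bsub>E\<^esub> x) = c \<odot>\<^bsub>F\<^esub> f x)"

definition dual_space :: "complex set \<Rightarrow> 'a nspace \<Rightarrow> ('a \<Rightarrow> complex) nspace" where
  "dual_space K E = \<lparr>
     carrier = {f \<in> extensional (carrier E). linear_on K E (scalar_space K) f \<and>
                  (\<exists>C. \<forall>x\<in>carrier E. cmod (f x) \<le> C * vnorm E x)},
     mult = undefined, one = undefined,
     zero = (\<lambda>x\<in>carrier E. 0),
     add = (\<lambda>f g. \<lambda>x\<in>carrier E. f x + g x),
     smult = (\<lambda>c f. \<lambda>x\<in>carrier E. c * f x),
     vnorm = (\<lambda>f. SUP x\<in>{x \<in> carrier E. vnorm E x \<le> 1}. cmod (f x))\<rparr>"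

definition tuples :: "nat \<Rightarrow> (nat \<Rightarrow> 'a nspace) \<Rightarrow> (nat \<Rightarrow> 'a) set" where
  "tuples n X = (\<Pi>\<^sub>E i\<in>{1..n}. carrier (X i))"

definition multilinear :: "complex set \<Rightarrow> nat \<Rightarrow> (nat \<Rightarrow> 'a nspace) \<Rightarrow> 'v nspace \<Rightarrow>
    ((nat \<Rightarrow> 'a) \<Rightarrow> 'v) \<Rightarrow> bool" where
  "multilinear K n X V T \<longleftrightarrow> T \<in> tuples n X \<rightarrow>\<^sub>E carrier V \<and>
     (\<forall>x\<in>tuples n X. \<forall>i\<in>{1..n}.
        (\<forall>a\<in>carrier (X i). \<forall>b\<in>carrier (X i).
           T (x(i := a \<oplus>\<^bsub>X i\<^esub> b)) = T (x(i := a)) \<oplus>\<^bsub>V\<^esub> T (x(i := b))) \<and>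
        (\<forall>c\<in>K. \<forall>a\<in>carrier (X i). T (x(i := c \<odot>\<^bsub>X i\<^esub> a)) = c \<odot>\<^bsub>V\<^esub> T (x(i := a))))"

definition bounded_multilinear :: "complex set \<Rightarrow> nat \<Rightarrow> (nat \<Rightarrow> 'a nspace) \<Rightarrow> 'v nspace \<Rightarrow>
    ((nat \<Rightarrow> 'a) \<Rightarrow> 'v) \<Rightarrow> bool" where
  "bounded_multilinear K n X V T \<longleftrightarrow> multilinear K n X V T \<and>
     (\<exists>C. \<forall>x\<in>tuples n X. vnorm V (T x) \<le> C * (\<Prod>i=1..n. vnorm (X i) (x i)))"

definition multilinear_norm :: "nat \<Rightarrow> (nat \<Rightarrow> 'a nspace) \<Rightarrow> 'v nspace \<Rightarrow> ((nat \<Rightarrow> 'a) \<Rightarrow> 'v) \<Rightarrow> real" where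
  "multilinear_norm n X V T =
     (SUP x\<in>{x \<in> tuples n X. \<forall>i\<in>{1..n}. vnorm (X i) (x i) \<le> 1}. vnorm V (T x))"

definition bilinear_form :: "complex set \<Rightarrow> (complex, 'e, 'm) module_scheme \<Rightarrow> (complex, 'y, 'k) module_scheme \<Rightarrow>
    ('e \<times> 'y \<Rightarrow> complex) \<Rightarrow> bool" where
  "bilinear_form K E Y \<beta> \<longleftrightarrow> \<beta> \<in> extensional (carrier E \<times> carrier Y) \<and>
     (\<forall>y\<in>carrier Y. linear_on K E (scalar_space K) (\<lambda>u. \<beta> (u, y))) \<and>
     (\<forall>u\<in>carrier E. linear_on K Y (scalar_space K) (\<lambda>y. \<beta> (u, y)))"

section \<open>Tensor products\<close>

text \<open>
  The algebraic tensor product is realized in the usual concrete way (as in Ryan's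
  \<^emph>\<open>Introduction to Tensor Products of Banach Spaces\<close>): \<open>x\<^sup>1 \<otimes> \<dots> \<otimes> x\<^sup>n\<close> is the functional \<open>\<phi> \<mapsto> \<phi>(x\<^sup>1,\<dots>,x\<^sup>n)\<close>
  on the space of all (not only the bounded) multilinear forms, and the tensor product is the linear
  span of these functionals. \<open>evaluation_span K F P\<close> is the span of the evaluations at the points of
  \<open>P\<close>, as functionals on a set \<open>F\<close> of functions \<open>P \<rightarrow> K\<close>.
\<close>

definition point_evaluation :: "('p \<Rightarrow> complex) set \<Rightarrow> 'p \<Rightarrow> ('p \<Rightarrow> complex) \<Rightarrow> complex" where
  "point_evaluation F x = (\<lambda>\<phi>\<in>F. \<phi> x)"

definition evaluation_span :: "complex set \<Rightarrow> ('p \<Rightarrow> complex) set \<Rightarrow> 'p set \<Rightarrow>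
    (complex, ('p \<Rightarrow> complex) \<Rightarrow> complex) module" where
  "evaluation_span K F P = \<lparr>
     carrier = {u. \<exists>(m::nat) c x. (\<forall>j<m. c j \<in> K \<and> x j \<in> P) \<and>
                  u = (\<lambda>\<phi>\<in>F. \<Sum>j<m. c j * point_evaluation F (x j) \<phi>)},
     mult = undefined, one = undefined,
     zero = (\<lambda>\<phi>\<in>F. 0),
     add = (\<lambda>u v. \<lambda>\<phi>\<in>F. u \<phi> + v \<phi>),
     smult = (\<lambda>c u. \<lambda>\<phi>\<in>F. c * u \<phi>)\<rparr>"

type_synonym 'a tensor = "((nat \<Rightarrow> 'a) \<Rightarrow> complex) \<Rightarrow> complex"
type_synonym ('a, 'y) tensor2 = "('a tensor \<times> 'y \<Rightarrow> complex) \<Rightarrow> complex"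

definition elementary_tensor :: "complex set \<Rightarrow> nat \<Rightarrow> (nat \<Rightarrow> 'a nspace) \<Rightarrow> (nat \<Rightarrow> 'a) \<Rightarrow> 'a tensor" where
  "elementary_tensor K n X = point_evaluation {\<phi>. multilinear K n X (scalar_space K) \<phi>}"

definition tensor_product :: "complex set \<Rightarrow> nat \<Rightarrow> (nat \<Rightarrow> 'a nspace) \<Rightarrow> (complex, 'a tensor) module" where
  "tensor_product K n X = evaluation_span K {\<phi>. multilinear K n X (scalar_space K) \<phi>} (tuples n X)"

text \<open>\<open>X 1 \<otimes> \<dots> \<otimes> X n \<otimes> Y\<close>, identified with \<open>(X 1 \<otimes> \<dots> \<otimes> X n) \<otimes> Y\<close>.\<close>

definition elementary_tensor2 :: "complex set \<Rightarrow> nat \<Rightarrow> (nat \<Rightarrow> 'a nspace) \<Rightarrow> 'y nspace \<Rightarrow>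
    'a tensor \<Rightarrow> 'y \<Rightarrow> ('a, 'y) tensor2" where
  "elementary_tensor2 K n X Y u y =
     point_evaluation {\<beta>. bilinear_form K (tensor_product K n X) Y \<beta>} (u, y)"

definition tensor_product2 :: "complex set \<Rightarrow> nat \<Rightarrow> (nat \<Rightarrow> 'a nspace) \<Rightarrow> 'y nspace \<Rightarrow>
    (complex, ('a, 'y) tensor2) module" where
  "tensor_product2 K n X Y =
     evaluation_span K {\<beta>. bilinear_form K (tensor_product K n X) Y \<beta>}
       (carrier (tensor_product K n X) \<times> carrier Y)"

definition segre :: "complex set \<Rightarrow> nat \<Rightarrow> (nat \<Rightarrow> 'a nspace) \<Rightarrow> 'a tensor set" where
  "segre K n X = elementary_tensor K n X ` tuples n X"

definition projective_norm :: "complex set \<Rightarrow> nat \<Rightarrow> (nat \<Rightarrow> 'a nspace) \<Rightarrow> 'a tensor \<Rightarrow> real" where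
  "projective_norm K n X u = Inf {(\<Sum>j<m. \<Prod>i=1..n. vnorm (X i) (x j i)) | (m::nat) x.
     (\<forall>j<m. x j \<in> tuples n X) \<and>
     u = (\<Oplus>\<^bsub>tensor_product K n X\<^esub>j\<in>{..<m}. elementary_tensor K n X (x j))}"

text \<open>The function \<open>f\<^sub>\<phi>\<close> on the Segre cone; see \<open>segre_form_elementary_tensor\<close> below.\<close>

definition segre_form :: "((nat \<Rightarrow> 'a) \<Rightarrow> complex) \<Rightarrow> 'a tensor \<Rightarrow> complex" where
  "segre_form \<phi> p = p \<phi>"

definition segre_dominated :: "complex set \<Rightarrow> nat \<Rightarrow> (nat \<Rightarrow> 'a nspace) \<Rightarrow>
    nat \<Rightarrow> (nat \<Rightarrow> 'a tensor) \<Rightarrow> (nat \<Rightarrow> 'a tensor) \<Rightarrow>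
    nat \<Rightarrow> (nat \<Rightarrow> 'a tensor) \<Rightarrow> (nat \<Rightarrow> 'a tensor) \<Rightarrow> bool" where
  "segre_dominated K n X m p q l a b \<longleftrightarrow>
     (\<forall>\<phi>. bounded_multilinear K n X (scalar_space K) \<phi> \<longrightarrow>
        (\<Sum>i<m. (cmod (segre_form \<phi> (p i) - segre_form \<phi> (q i)))\<^sup>2)
          \<le> (\<Sum>j<l. (cmod (segre_form \<phi> (a j) - segre_form \<phi> (b j)))\<^sup>2))"

definition gamma_norm :: "complex set \<Rightarrow> nat \<Rightarrow> (nat \<Rightarrow> 'a nspace) \<Rightarrow> 'y nspace \<Rightarrow> ('a, 'y) tensor2 \<Rightarrow> real" where
  "gamma_norm K n X Y u = Inf {sqrt (\<Sum>i<m. (projective_norm K n X (a i \<ominus>\<^bsub>tensor_product K n X\<^esub> b i))\<^sup>2)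
       * sqrt (\<Sum>i<m. (vnorm Y (y i))\<^sup>2) | (m::nat) p q a b y.
     (\<forall>i<m. p i \<in> segre K n X \<and> q i \<in> segre K n X \<and> a i \<in> segre K n X \<and> b i \<in> segre K n X \<and> y i \<in> carrier Y) \<and>
     u = (\<Oplus>\<^bsub>tensor_product2 K n X Y\<^esub>i\<in>{..<m}.
            elementary_tensor2 K n X Y (p i \<ominus>\<^bsub>tensor_product K n X\<^esub> q i) (y i)) \<and>
     segre_dominated K n X m p q m a b}"

definition gamma_tensor_space :: "complex set \<Rightarrow> nat \<Rightarrow> (nat \<Rightarrow> 'a nspace) \<Rightarrow> 'y nspace \<Rightarrow>
    ('a, 'y) tensor2 nspace" where
  "gamma_tensor_space K n X Y = add_norm (tensor_product2 K n X Y) (gamma_norm K n X Y)"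

section \<open>Factorization through a Hilbert space\<close>

definition lipschitz_const :: "'h nspace \<Rightarrow> 'v nspace \<Rightarrow> 'h set \<Rightarrow> ('h \<Rightarrow> 'v) \<Rightarrow> real \<Rightarrow> bool" where
  "lipschitz_const H V M B L \<longleftrightarrow> 0 \<le> L \<and>
     (\<forall>g\<in>M. \<forall>h\<in>M. vnorm V (B g \<ominus>\<^bsub>V\<^esub> B h) \<le> L * vnorm H (g \<ominus>\<^bsub>H\<^esub> h))"

definition Lip :: "'h nspace \<Rightarrow> 'v nspace \<Rightarrow> 'h set \<Rightarrow> ('h \<Rightarrow> 'v) \<Rightarrow> real" where
  "Lip H V M B = Inf {L. lipschitz_const H V M B L}"

definition hilbert_factorization :: "complex set \<Rightarrow> nat \<Rightarrow> (nat \<Rightarrow> 'a nspace) \<Rightarrow> 'v nspace \<Rightarrow>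
    ((nat \<Rightarrow> 'a) \<Rightarrow> 'v) \<Rightarrow> 'h nspace \<Rightarrow> 'h set \<Rightarrow> ((nat \<Rightarrow> 'a) \<Rightarrow> 'h) \<Rightarrow> ('h \<Rightarrow> 'v) \<Rightarrow> bool" where
  "hilbert_factorization K n X V T H M A B \<longleftrightarrow>
     hilbert_space K H \<and> M \<subseteq> carrier H \<and>
     bounded_multilinear K n X H A \<and> A ` tuples n X \<subseteq> M \<and>
     B \<in> M \<rightarrow> carrier V \<and> (\<exists>L. lipschitz_const H V M B L) \<and>
     (\<forall>x\<in>tuples n X. T x = B (A x))"

text \<open>
  One cannot quantify over all types of a Hilbert space inside a definition. In \<open>gamma_factorizable\<close> and
  \<open>gamma_functional\<close> the carrier of the Hilbert space is a set of functions on tuples. This is no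
  restriction: by \<open>hilbert_factorization_universe\<close> below, every factorization through a Hilbert space
  over any type gives one of this kind with the same \<open>\<parallel>A\<parallel>\<close> and no larger \<open>Lip B\<close>.
\<close>

type_synonym 'a hilbert_universe = "(nat \<Rightarrow> 'a) \<Rightarrow> complex"

definition gamma_factorizable :: "complex set \<Rightarrow> nat \<Rightarrow> (nat \<Rightarrow> 'a nspace) \<Rightarrow> 'v nspace \<Rightarrow>
    ((nat \<Rightarrow> 'a) \<Rightarrow> 'v) \<Rightarrow> bool" where
  "gamma_factorizable K n X V T \<longleftrightarrow> multilinear K n X V T \<and>
     (\<exists>(H :: 'a hilbert_universe nspace) M A B. hilbert_factorization K n X V T H M A B)"

definition gamma_functional :: "complex set \<Rightarrow> nat \<Rightarrow> (nat \<Rightarrow> 'a nspace) \<Rightarrow> 'v nspace \<Rightarrow>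
    ((nat \<Rightarrow> 'a) \<Rightarrow> 'v) \<Rightarrow> real" where
  "gamma_functional K n X V T = Inf {multilinear_norm n X H A * Lip H V M B |
     (H :: 'a hilbert_universe nspace) M A B. hilbert_factorization K n X V T H M A B}"

definition gamma_operators :: "complex set \<Rightarrow> nat \<Rightarrow> (nat \<Rightarrow> 'a nspace) \<Rightarrow> 'v nspace \<Rightarrow>
    ((nat \<Rightarrow> 'a) \<Rightarrow> 'v) nspace" where
  "gamma_operators K n X V = \<lparr>
     carrier = {T. gamma_factorizable K n X V T},
     mult = undefined, one = undefined,
     zero = (\<lambda>x\<in>tuples n X. \<zero>\<^bsub>V\<^esub>),
     add = (\<lambda>S T. \<lambda>x\<in>tuples n X. S x \<oplus>\<^bsub>V\<^esub> T x),
     smult = (\<lambda>c T. \<lambda>x\<in>tuples n X. c \<odot>\<^bsub>V\<^esub> T x),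
     vnorm = gamma_functional K n X V\<rparr>"

section \<open>The duality map\<close>

definition duality_map :: "complex set \<Rightarrow> nat \<Rightarrow> (nat \<Rightarrow> 'a nspace) \<Rightarrow> 'y nspace \<Rightarrow>
    (('a, 'y) tensor2 \<Rightarrow> complex) \<Rightarrow> (nat \<Rightarrow> 'a) \<Rightarrow> 'y \<Rightarrow> complex" where
  "duality_map K n X Y \<phi> =
     (\<lambda>x\<in>tuples n X. \<lambda>y\<in>carrier Y. \<phi> (elementary_tensor2 K n X Y (elementary_tensor K n X x) y))"

definition isometric_isomorphism :: "complex set \<Rightarrow> 'a nspace \<Rightarrow> 'b nspace \<Rightarrow> ('a \<Rightarrow> 'b) \<Rightarrow> bool" where
  "isometric_isomorphism K E F f \<longleftrightarrow> linear_on K E F f \<and> bij_betw f (carrier E) (carrier F) \<and>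
     (\<forall>x\<in>carrier E. vnorm F (f x) = vnorm E x)"

section \<open>Consistency of the encodings\<close>

lemma segre_form_elementary_tensor:
  assumes "bounded_multilinear K n X (scalar_space K) \<phi>"
  shows "segre_form \<phi> (elementary_tensor K n X x) = \<phi> x"
  using assms
  by (simp add: segre_form_def elementary_tensor_def point_evaluation_def bounded_multilinear_def)

lemma cring_scalar_space:
  assumes "K = \<real> \<or> K = UNIV"
  shows "cring (scalar_space K)"
proof -
  have c: "x + y \<in> K" "x * y \<in> K" if "x \<in> K" "y \<in> K" for x y
    using assms that by auto
  have z: "0 \<in> K" "1 \<in> K" using assms by auto
  have neg: "\<exists>y\<in>K. y + x = 0" if "x \<in> K" for x
    by (rule bexI[of _ "- x"]) (use assms that in auto)
  have "abelian_group (scalar_space K)"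
    by (rule abelian_groupI) (simp_all add: scalar_space_def c z neg)
  moreover have "comm_monoid (scalar_space K)"
    by (rule comm_monoidI) (simp_all add: scalar_space_def c z)
  ultimately show ?thesis
    by (rule cringI) (simp add: scalar_space_def distrib_right)
qed

lemma module_evaluation_span:
  assumes K: "K = \<real> \<or> K = UNIV"
  shows "module (scalar_space K) (evaluation_span K F P)"
proof -
  let ?E = "evaluation_span K F P"
  have K': "a * b \<in> K" "0 \<in> K" "1 \<in> K" "- 1 \<in> K" if "a \<in> K" "b \<in> K" for a b
    using K that by auto
  have m1: "- 1 \<in> K" using K by auto
  have ext: "restrict u F = u" if "u \<in> carrier ?E" for u
    using that by (auto simp: evaluation_span_def)
  have zero: "\<zero>\<^bsub>?E\<^esub> \<in> carrier ?E"
    by (auto simp: evaluation_span_def intro!: exI[of _ "0::nat"])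
  have add: "u \<oplus>\<^bsub>?E\<^esub> v \<in> carrier ?E" if uv: "u \<in> carrier ?E" "v \<in> carrier ?E" for u v
  proof -
    obtain m :: nat and c x where u: "\<forall>j<m. c j \<in> K \<and> x j \<in> P"
        "u = (\<lambda>\<phi>\<in>F. \<Sum>j<m. c j * point_evaluation F (x j) \<phi>)"
      using uv(1) by (simp add: evaluation_span_def) blast
    obtain l :: nat and d y where v: "\<forall>j<l. d j \<in> K \<and> y j \<in> P"
        "v = (\<lambda>\<phi>\<in>F. \<Sum>j<l. d j * point_evaluation F (y j) \<phi>)"
      using uv(2) by (simp add: evaluation_span_def) blast
    let ?c = "\<lambda>j. if j < m then c j else d (j - m)" and ?x = "\<lambda>j. if j < m then x j else y (j - m)"
    have split: "(\<Sum>j<m + l. f j) = (\<Sum>j<m. f j) + (\<Sum>j<l. f (m + j))" for f :: "nat \<Rightarrow> complex"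
      by (induction l) (auto simp: algebra_simps)
    have "\<forall>j<m + l. ?c j \<in> K \<and> ?x j \<in> P" using u(1) v(1) by auto
    moreover have "u \<oplus>\<^bsub>?E\<^esub> v = (\<lambda>\<phi>\<in>F. \<Sum>j<m + l. ?c j * point_evaluation F (?x j) \<phi>)"
      by (auto simp: evaluation_span_def u(2) v(2) split restrict_def)
    ultimately show ?thesis unfolding evaluation_span_def
      by (simp only: partial_object.simps mem_Collect_eq)
        (rule exI[of _ "m + l"], rule exI[of _ ?c], rule exI[of _ ?x], simp)
  qed
  have smult: "c \<odot>\<^bsub>?E\<^esub> u \<in> carrier ?E" if cu: "c \<in> K" "u \<in> carrier ?E" for c u
  proof -
    obtain m :: nat and d x where u: "\<forall>j<m. d j \<in> K \<and> x j \<in> P"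
        "u = (\<lambda>\<phi>\<in>F. \<Sum>j<m. d j * point_evaluation F (x j) \<phi>)"
      using cu(2) by (simp add: evaluation_span_def) blast
    have "\<forall>j<m. c * d j \<in> K \<and> x j \<in> P" using u(1) cu(1) K'(1) by auto
    moreover have "c \<odot>\<^bsub>?E\<^esub> u = (\<lambda>\<phi>\<in>F. \<Sum>j<m. (c * d j) * point_evaluation F (x j) \<phi>)"
      by (auto simp: evaluation_span_def u(2) sum_distrib_left restrict_def mult.assoc)
    ultimately show ?thesis unfolding evaluation_span_def
      by (simp only: partial_object.simps mem_Collect_eq)
        (rule exI[of _ m], rule exI[of _ "\<lambda>j. c * d j"], rule exI[of _ x], simp)
  qed
  have ops: "u \<oplus>\<^bsub>?E\<^esub> v = (\<lambda>\<phi>\<in>F. u \<phi> + v \<phi>)" "c \<odot>\<^bsub>?E\<^esub> u = (\<lambda>\<phi>\<in>F. c * u \<phi>)" "\<zero>\<^bsub>?E\<^esub> = (\<lambda>\<phi>\<in>F. 0)" for u v c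
    by (simp_all add: evaluation_span_def)
  have inv: "\<exists>v\<in>carrier ?E. v \<oplus>\<^bsub>?E\<^esub> u = \<zero>\<^bsub>?E\<^esub>" if "u \<in> carrier ?E" for u
    by (rule bexI[OF _ smult[OF m1 that]]) (auto simp: ops restrict_def)
  have "abelian_group ?E"
  proof (rule abelian_groupI)
    fix u assume "u \<in> carrier ?E"
    thus "\<zero>\<^bsub>?E\<^esub> \<oplus>\<^bsub>?E\<^esub> u = u" using ext[of u] by (simp add: ops cong: restrict_cong)
  qed (use add zero inv in \<open>auto simp: ops algebra_simps restrict_def\<close>)
  moreover have "\<one>\<^bsub>scalar_space K\<^esub> \<odot>\<^bsub>?E\<^esub> u = u" if "u \<in> carrier ?E" for u
    using ext[OF that] by (simp add: ops scalar_space_def)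
  ultimately show ?thesis
    by (intro moduleI cring_scalar_space K)
      (auto simp: scalar_space_def smult, auto simp: ops algebra_simps restrict_def)
qed

lemma (in inner_product) cauchy_schwarz:
  assumes K: "K = \<real> \<or> K = UNIV" and x: "x \<in> carrier V" and y: "y \<in> carrier V"
  shows "(cmod (ip x y))\<^sup>2 \<le> Re (ip x x) * Re (ip y y)"
proof -
  have real: "ip z z = of_real (Re (ip z z))" if "z \<in> carrier V" for z
    using arg_cong[OF ip_commute[OF that that], of Im] by (simp add: complex_eq_iff)
  have kc: "c \<in> K \<Longrightarrow> cnj c \<in> K" "c \<in> K \<Longrightarrow> - c \<in> K" "of_real r \<in> K" "c \<in> K \<Longrightarrow> d \<in> K \<Longrightarrow> c * d \<in> K"
    for c d r using K by (auto simp: Reals_cnj_iff)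
  have sc: "c \<odot>\<^bsub>V\<^esub> z \<in> carrier V" if "c \<in> K" "z \<in> carrier V" for c z
    using smult_closed that by (simp add: scalar_space_def)
  define a where "a = Re (ip x x)"
  define b where "b = Re (ip y y)"
  define p where "p = ip x y"
  have pK: "p \<in> K" using ip_closed x y p_def by simp
  have xx: "ip x x = of_real a" and yy: "ip y y = of_real b" and xy: "ip x y = p"
    using real x y by (simp_all add: a_def b_def p_def)
  have yx: "ip y x = cnj p" unfolding p_def by (rule ip_commute[OF x y])
  have add2: "ip w (u \<oplus>\<^bsub>V\<^esub> v) = ip w u + ip w v" if "u \<in> carrier V" "v \<in> carrier V" "w \<in> carrier V" for u v w
  proof -
    have "ip w (u \<oplus>\<^bsub>V\<^esub> v) = cnj (ip (u \<oplus>\<^bsub>V\<^esub> v) w)" by (rule ip_commute) (use that in auto)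
    also have "\<dots> = cnj (ip u w) + cnj (ip v w)" using that by (simp add: ip_add)
    finally show ?thesis using ip_commute[of u w] ip_commute[of v w] that by metis
  qed
  have smult2: "ip w (c \<odot>\<^bsub>V\<^esub> u) = cnj c * ip w u" if "c \<in> K" "u \<in> carrier V" "w \<in> carrier V" for c u w
  proof -
    have "ip w (c \<odot>\<^bsub>V\<^esub> u) = cnj (ip (c \<odot>\<^bsub>V\<^esub> u) w)" by (rule ip_commute) (use that sc in auto)
    also have "\<dots> = cnj c * cnj (ip u w)" using that by (simp add: ip_smult)
    finally show ?thesis using ip_commute[of u w] that by metis
  qed
  have expand: "ip (c \<odot>\<^bsub>V\<^esub> x \<oplus>\<^bsub>V\<^esub> d \<odot>\<^bsub>V\<^esub> y) (c \<odot>\<^bsub>V\<^esub> x \<oplus>\<^bsub>V\<^esub> d \<odot>\<^bsub>V\<^esub> y) =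
      c * cnj c * of_real a + c * cnj d * p + d * cnj c * cnj p + d * cnj d * of_real b"
    if "c \<in> K" "d \<in> K" for c d
    using that x y sc by (simp add: ip_add add2 ip_smult smult2 yx xx yy xy algebra_simps)
  have pos: "0 \<le> Re (c * cnj c * of_real a + c * cnj d * p + d * cnj c * cnj p + d * cnj d * of_real b)"
    if "c \<in> K" "d \<in> K" for c d
    using ip_nonneg[of "c \<odot>\<^bsub>V\<^esub> x \<oplus>\<^bsub>V\<^esub> d \<odot>\<^bsub>V\<^esub> y"] expand[OF that] sc that x y by simp
  have a0: "0 \<le> a" and b0: "0 \<le> b" using ip_nonneg x y by (auto simp: a_def b_def)
  have quad: "0 \<le> t\<^sup>2 * a - 2 * t * (cmod p)\<^sup>2 + (cmod p)\<^sup>2 * b" for t :: real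
  proof -
    have "0 \<le> Re (of_real t * cnj (of_real t) * of_real a + of_real t * cnj (- p) * p
        + (- p) * cnj (of_real t) * cnj p + (- p) * cnj (- p) * of_real b)"
      by (rule pos) (use pK kc in auto)
    also have "\<dots> = t\<^sup>2 * a - 2 * t * (cmod p)\<^sup>2 + (cmod p)\<^sup>2 * b"
      unfolding cmod_power2 by (simp add: power2_eq_square algebra_simps)
    finally show ?thesis .
  qed
  show ?thesis
  proof (cases "p = 0")
    case True thus ?thesis using a0 b0 by (simp add: p_def a_def b_def)
  next
    case False
    hence pp: "(cmod p)\<^sup>2 > 0" by simp
    have "(cmod p)\<^sup>2 \<le> a * b"
    proof (cases "b = 0")
      case True
      show ?thesis
      proof (cases "a = 0")
        case True
        show ?thesis using quad[of 1] \<open>b = 0\<close> True pp by simp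
      next
        case False
        with a0 have a: "a > 0" by simp
        define q where "q = (cmod p)\<^sup>2"
        have "0 \<le> (q/a)\<^sup>2 * a - 2 * (q/a) * q" using quad[of "q/a"] True by (simp add: q_def)
        also have "\<dots> = - (q\<^sup>2 / a)" using a by (simp add: power2_eq_square field_simps)
        finally have "q\<^sup>2 \<le> 0" using a by (simp add: divide_le_0_iff zero_le_divide_iff)
        thus ?thesis using pp unfolding q_def by simp
      qed
    next
      case False
      with b0 have b: "b > 0" by simp
      define q where "q = (cmod p)\<^sup>2"
      have "0 \<le> b\<^sup>2 * a - 2 * b * q + q * b" using quad[of b] by (simp add: q_def)
      also have "\<dots> = b * (a * b - q)" by (simp add: power2_eq_square algebra_simps)
      finally have "0 \<le> a * b - q" using b by (simp add: zero_le_mult_iff)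
      thus ?thesis by (simp add: q_def)
    qed
    thus ?thesis by (simp add: p_def a_def b_def)
  qed
qed

text \<open>A closed subspace of a Hilbert space is a Hilbert space, also when transported along an injection
  into another type.\<close>

lemma hilbert_space_transport:
  fixes H :: "'h nspace" and J :: "'h \<Rightarrow> 'g"
  assumes K: "K = \<real> \<or> K = UNIV" and H: "hilbert_space K H"
    and S: "S \<subseteq> carrier H" "\<zero>\<^bsub>H\<^esub> \<in> S" "\<And>g h. g \<in> S \<Longrightarrow> h \<in> S \<Longrightarrow> g \<oplus>\<^bsub>H\<^esub> h \<in> S"
      "\<And>c h. c \<in> K \<Longrightarrow> h \<in> S \<Longrightarrow> c \<odot>\<^bsub>H\<^esub> h \<in> S"
    and closed: "\<And>s l. (\<And>k::nat. s k \<in> S) \<Longrightarrow> l \<in> carrier H \<Longrightarrow> (\<lambda>k. vnorm H (s k \<ominus>\<^bsub>H\<^esub> l)) \<longlonglongrightarrow> 0 \<Longrightarrow> l \<in> S"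
    and J: "inj_on J S"
  obtains H' :: "'g nspace" where "hilbert_space K H'" "carrier H' = J ` S"
    "\<And>h. h \<in> S \<Longrightarrow> vnorm H' (J h) = vnorm H h"
    "\<And>g h. g \<in> S \<Longrightarrow> h \<in> S \<Longrightarrow> J g \<oplus>\<^bsub>H'\<^esub> J h = J (g \<oplus>\<^bsub>H\<^esub> h)"
    "\<And>g h. g \<in> S \<Longrightarrow> h \<in> S \<Longrightarrow> J g \<ominus>\<^bsub>H'\<^esub> J h = J (g \<ominus>\<^bsub>H\<^esub> h)"
    "\<And>c h. c \<in> K \<Longrightarrow> h \<in> S \<Longrightarrow> c \<odot>\<^bsub>H'\<^esub> J h = J (c \<odot>\<^bsub>H\<^esub> h)"
proof -
  interpret H: banach_space K H using H by (simp add: hilbert_space_def)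
  obtain ip where ip: "inner_product K H ip" and nip: "\<And>x. x \<in> carrier H \<Longrightarrow> vnorm H x = sqrt (Re (ip x x))"
    using H by (auto simp: hilbert_space_def)
  interpret ip: inner_product K H ip by (rule ip)
  define I where "I = inv_into S J"
  have IJ [simp]: "I (J h) = h" if "h \<in> S" for h using J that by (simp add: I_def)
  define H' :: "'g nspace" where "H' = \<lparr>carrier = J ` S, mult = undefined, one = undefined, zero = J \<zero>\<^bsub>H\<^esub>,
     add = (\<lambda>f g. J (I f \<oplus>\<^bsub>H\<^esub> I g)), smult = (\<lambda>c f. J (c \<odot>\<^bsub>H\<^esub> I f)), vnorm = (\<lambda>f. vnorm H (I f))\<rparr>"
  have SH: "h \<in> S \<Longrightarrow> h \<in> carrier H" for h using S(1) by auto
  have sc: "carrier (scalar_space K) = K" "\<one>\<^bsub>scalar_space K\<^esub> = 1" "mult (scalar_space K) = (*)"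
      "add (scalar_space K) = (+)" "\<zero>\<^bsub>scalar_space K\<^esub> = 0"
    by (simp_all add: scalar_space_def)
  have m1: "- 1 \<in> K" and k1: "1 \<in> K" using K by auto
  have neg: "\<ominus>\<^bsub>H\<^esub> h = (- 1) \<odot>\<^bsub>H\<^esub> h" if "h \<in> carrier H" for h
  proof -
    have "(- 1) \<odot>\<^bsub>H\<^esub> h \<oplus>\<^bsub>H\<^esub> 1 \<odot>\<^bsub>H\<^esub> h = (- 1 + 1) \<odot>\<^bsub>H\<^esub> h"
      using H.smult_l_distr[of "- 1" 1 h] that m1 k1 by (simp add: sc)
    also have "\<dots> = \<zero>\<^bsub>H\<^esub>" using H.smult_l_null[OF that] by (simp add: sc)
    finally have "(- 1) \<odot>\<^bsub>H\<^esub> h \<oplus>\<^bsub>H\<^esub> h = \<zero>\<^bsub>H\<^esub>" using H.smult_one[OF that] by (simp add: sc)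
    thus ?thesis using H.minus_equality[of "(- 1) \<odot>\<^bsub>H\<^esub> h" h] that H.smult_closed[of "- 1" h] m1 by (simp add: sc)
  qed
  have Sneg: "\<ominus>\<^bsub>H\<^esub> h \<in> S" if "h \<in> S" for h using neg[OF SH[OF that]] S(4)[OF m1 that] by simp
  have Sminus: "g \<ominus>\<^bsub>H\<^esub> h \<in> S" if "g \<in> S" "h \<in> S" for g h using that S(3) Sneg by (simp add: a_minus_def)
  have car: "carrier H' = J ` S" by (simp add: H'_def)
  have addJ: "J g \<oplus>\<^bsub>H'\<^esub> J h = J (g \<oplus>\<^bsub>H\<^esub> h)" if "g \<in> S" "h \<in> S" for g h using that by (simp add: H'_def)
  have smJ: "c \<odot>\<^bsub>H'\<^esub> J h = J (c \<odot>\<^bsub>H\<^esub> h)" if "h \<in> S" for c h using that by (simp add: H'_def)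
  have zJ: "\<zero>\<^bsub>H'\<^esub> = J \<zero>\<^bsub>H\<^esub>" by (simp add: H'_def)
  have nJ: "vnorm H' (J h) = vnorm H h" if "h \<in> S" for h using that by (simp add: H'_def)
  have ag: "abelian_group H'"
  proof (rule abelian_groupI)
    fix u assume "u \<in> carrier H'"
    then obtain h where h: "h \<in> S" "u = J h" by (auto simp: car)
    show "\<exists>v\<in>carrier H'. v \<oplus>\<^bsub>H'\<^esub> u = \<zero>\<^bsub>H'\<^esub>"
      by (rule bexI[of _ "J (\<ominus>\<^bsub>H\<^esub> h)"]) (use h Sneg SH H.l_neg in \<open>auto simp: addJ zJ car\<close>)
  qed (auto simp: car addJ zJ S SH H.a_ac)
  interpret A: abelian_group H' by (rule ag)
  have md: "module (scalar_space K) H'"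
  proof (rule moduleI[OF cring_scalar_space[OF K] ag])
    fix a b u assume a: "a \<in> carrier (scalar_space K)" "b \<in> carrier (scalar_space K)" "u \<in> carrier H'"
    then obtain h where h: "h \<in> S" "u = J h" by (auto simp: car)
    show "(a \<oplus>\<^bsub>scalar_space K\<^esub> b) \<odot>\<^bsub>H'\<^esub> u = a \<odot>\<^bsub>H'\<^esub> u \<oplus>\<^bsub>H'\<^esub> b \<odot>\<^bsub>H'\<^esub> u"
      using a h H.smult_l_distr[of a b h] by (simp add: smJ addJ S SH sc(1))
    show "(a \<otimes>\<^bsub>scalar_space K\<^esub> b) \<odot>\<^bsub>H'\<^esub> u = a \<odot>\<^bsub>H'\<^esub> (b \<odot>\<^bsub>H'\<^esub> u)"
      using a h H.smult_assoc1[of a b h] by (simp add: smJ S SH sc(1))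
  next
    fix a u v assume a: "a \<in> carrier (scalar_space K)" "u \<in> carrier H'" "v \<in> carrier H'"
    then obtain h g where h: "h \<in> S" "u = J h" "g \<in> S" "v = J g" by (auto simp: car)
    show "a \<odot>\<^bsub>H'\<^esub> (u \<oplus>\<^bsub>H'\<^esub> v) = a \<odot>\<^bsub>H'\<^esub> u \<oplus>\<^bsub>H'\<^esub> a \<odot>\<^bsub>H'\<^esub> v"
      using a h H.smult_r_distr[of a h g] by (simp add: smJ addJ S SH sc(1))
  next
    fix a u assume a: "a \<in> carrier (scalar_space K)" "u \<in> carrier H'"
    then obtain h where h: "h \<in> S" "u = J h" by (auto simp: car)
    show "a \<odot>\<^bsub>H'\<^esub> u \<in> carrier H'" using a h by (simp add: smJ S car sc)
  next
    fix u assume a: "u \<in> carrier H'"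
    then obtain h where h: "h \<in> S" "u = J h" by (auto simp: car)
    show "\<one>\<^bsub>scalar_space K\<^esub> \<odot>\<^bsub>H'\<^esub> u = u" using h SH by (simp add: smJ)
  qed
  have minJ: "J g \<ominus>\<^bsub>H'\<^esub> J h = J (g \<ominus>\<^bsub>H\<^esub> h)" if gh: "g \<in> S" "h \<in> S" for g h
  proof -
    have "\<ominus>\<^bsub>H'\<^esub> J h = J (\<ominus>\<^bsub>H\<^esub> h)"
      by (rule A.minus_equality) (use gh Sneg SH H.l_neg in \<open>auto simp: car addJ zJ\<close>)
    thus ?thesis using gh Sneg by (simp add: a_minus_def addJ)
  qed
  have ns: "normed_space K H'"
  proof (intro normed_space.intro md normed_space_axioms.intro)
    fix u assume "u \<in> carrier H'"
    then obtain h where h: "h \<in> S" "u = J h" by (auto simp: car)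
    show "0 \<le> vnorm H' u" using h SH H.norm_nonneg by (simp add: nJ)
    show "vnorm H' u = 0 \<longleftrightarrow> u = \<zero>\<^bsub>H'\<^esub>"
      using h SH H.norm_eq_zero inj_onD[OF J, of h "\<zero>\<^bsub>H\<^esub>"] S(2) by (auto simp: nJ zJ)
    show "vnorm H' (c \<odot>\<^bsub>H'\<^esub> u) = cmod c * vnorm H' u" if "c \<in> K" for c
      using h SH H.norm_smult that S by (simp add: nJ smJ)
  next
    fix u v assume "u \<in> carrier H'" "v \<in> carrier H'"
    then obtain h g where h: "h \<in> S" "u = J h" "g \<in> S" "v = J g" by (auto simp: car)
    show "vnorm H' (u \<oplus>\<^bsub>H'\<^esub> v) \<le> vnorm H' u + vnorm H' v"
      using h SH H.norm_triangle S by (simp add: nJ addJ)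
  qed
  have bs: "banach_space K H'"
  proof (intro banach_space.intro ns banach_space_axioms.intro)
    fix s :: "nat \<Rightarrow> 'g"
    assume s: "\<And>k. s k \<in> carrier H'"
      and cau: "\<And>e. 0 < e \<Longrightarrow> \<exists>N. \<forall>j\<ge>N. \<forall>k\<ge>N. vnorm H' (s j \<ominus>\<^bsub>H'\<^esub> s k) < e"
    have "\<forall>k. \<exists>h. h \<in> S \<and> s k = J h" using s by (auto simp: car)
    then obtain t where t: "\<And>k. t k \<in> S" "\<And>k. s k = J (t k)" by metis
    have "\<exists>l\<in>carrier H. (\<lambda>k. vnorm H (t k \<ominus>\<^bsub>H\<^esub> l)) \<longlonglongrightarrow> 0"
      using cau by (intro H.complete) (auto simp: t SH minJ nJ Sminus)
    then obtain l where l: "l \<in> carrier H" "(\<lambda>k. vnorm H (t k \<ominus>\<^bsub>H\<^esub> l)) \<longlonglongrightarrow> 0" by auto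
    have lS: "l \<in> S" using closed[OF t(1) l] .
    show "\<exists>l\<in>carrier H'. (\<lambda>k. vnorm H' (s k \<ominus>\<^bsub>H'\<^esub> l)) \<longlonglongrightarrow> 0"
      by (rule bexI[of _ "J l"]) (use l lS in \<open>auto simp: t minJ nJ Sminus car\<close>)
  qed
  have "inner_product K H' (\<lambda>u v. ip (I u) (I v))"
  proof (intro inner_product.intro md inner_product_axioms.intro)
    fix u v assume "u \<in> carrier H'" "v \<in> carrier H'"
    then obtain h g where h: "h \<in> S" "u = J h" "g \<in> S" "v = J g" by (auto simp: car)
    show "ip (I u) (I v) \<in> K" using h SH ip.ip_closed by simp
    show "ip (I v) (I u) = cnj (ip (I u) (I v))" by (rule ip.ip_commute) (use h SH in auto)
    show "ip (I (c \<odot>\<^bsub>H'\<^esub> u)) (I v) = c * ip (I u) (I v)" if "c \<in> K" for c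
      using h SH ip.ip_smult that S by (simp add: smJ)
  next
    fix u v w assume "u \<in> carrier H'" "v \<in> carrier H'" "w \<in> carrier H'"
    then obtain h g f where h: "h \<in> S" "u = J h" "g \<in> S" "v = J g" "f \<in> S" "w = J f" by (auto simp: car)
    show "ip (I (u \<oplus>\<^bsub>H'\<^esub> v)) (I w) = ip (I u) (I w) + ip (I v) (I w)"
      using h SH ip.ip_add S by (simp add: addJ)
  next
    fix u assume "u \<in> carrier H'"
    then obtain h where h: "h \<in> S" "u = J h" by (auto simp: car)
    show "0 \<le> Re (ip (I u) (I u))" using h SH ip.ip_nonneg by simp
    show "u = \<zero>\<^bsub>H'\<^esub>" if "ip (I u) (I u) = 0" using h SH[OF h(1)] ip.ip_eq_zero[of h] that by (simp add: zJ)
  qed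
  moreover have "\<forall>u\<in>carrier H'. vnorm H' u = sqrt (Re (ip (I u) (I u)))"
    by (auto simp: car nJ SH nip)
  ultimately have "hilbert_space K H'" using bs by (auto simp: hilbert_space_def)
  thus ?thesis using that[of H'] car nJ addJ minJ smJ by blast
qed

theorem hilbert_factorization_universe:
  fixes H :: "'h nspace" and X :: "nat \<Rightarrow> 'a nspace"
  assumes K: "K = \<real> \<or> K = UNIV" and X: "\<And>i. i \<in> {1..n} \<Longrightarrow> banach_space K (X i)"
    and fact: "hilbert_factorization K n X V T H M A B"
  shows "\<exists>(H' :: 'a hilbert_universe nspace) M' A' B'. hilbert_factorization K n X V T H' M' A' B' \<and>
    multilinear_norm n X H' A' = multilinear_norm n X H A \<and> Lip H' V M' B' \<le> Lip H V M B"
proof -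
  have hs: "hilbert_space K H" and MH: "M \<subseteq> carrier H" and bA: "bounded_multilinear K n X H A"
    and AM: "A ` tuples n X \<subseteq> M" and BM: "B \<in> M \<rightarrow> carrier V"
    and lip: "\<exists>L. lipschitz_const H V M B L" and T: "\<And>x. x \<in> tuples n X \<Longrightarrow> T x = B (A x)"
    using fact by (auto simp: hilbert_factorization_def)
  interpret H: banach_space K H using hs by (simp add: hilbert_space_def)
  obtain ip where ip: "inner_product K H ip" and nip: "\<And>x. x \<in> carrier H \<Longrightarrow> vnorm H x = sqrt (Re (ip x x))"
    using hs by (auto simp: hilbert_space_def)
  interpret ip: inner_product K H ip by (rule ip)
  have AH: "A x \<in> carrier H" if "x \<in> tuples n X" for x using AM MH that by auto
  define N where "N = {g \<in> carrier H. \<forall>x\<in>tuples n X. ip g (A x) = 0}"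
  define S where "S = {h \<in> carrier H. \<forall>g\<in>N. ip h g = 0}"
  define J where "J h = (\<lambda>x\<in>tuples n X. ip h (A x))" for h
  have NH: "g \<in> N \<Longrightarrow> g \<in> carrier H" for g by (simp add: N_def)
  have SH: "h \<in> S \<Longrightarrow> h \<in> carrier H" for h by (simp add: S_def)
  have SN: "ip h g = 0" if "h \<in> S" "g \<in> N" for g h using that by (simp add: S_def)
  have sc: "c \<odot>\<^bsub>H\<^esub> h \<in> carrier H" if "c \<in> K" "h \<in> carrier H" for c h
    using H.smult_closed that by (simp add: scalar_space_def)
  have ip0: "ip \<zero>\<^bsub>H\<^esub> g = 0" if "g \<in> carrier H" for g
    using ip.ip_add[of "\<zero>\<^bsub>H\<^esub>" "\<zero>\<^bsub>H\<^esub>" g] that by simp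
  have ip_minus: "ip (g \<ominus>\<^bsub>H\<^esub> h) f = ip g f - ip h f"
    if "g \<in> carrier H" "h \<in> carrier H" "f \<in> carrier H" for f g h
    using ip.ip_add[of "g \<ominus>\<^bsub>H\<^esub> h" h f] that
    by (simp add: a_minus_def H.a_assoc H.l_neg)
  have AS: "A x \<in> S" if "x \<in> tuples n X" for x
  proof -
    have "ip (A x) g = 0" if g: "g \<in> N" for g
      using ip.ip_commute[of g "A x"] g \<open>x \<in> tuples n X\<close> AH by (simp add: N_def)
    thus ?thesis using that AH by (simp add: S_def)
  qed
  have inj: "inj_on J S"
  proof (rule inj_onI)
    fix g h assume g: "g \<in> S" "h \<in> S" "J g = J h"
    have d: "g \<ominus>\<^bsub>H\<^esub> h \<in> carrier H" using g SH by simp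
    have "ip g (A x) = ip h (A x)" if "x \<in> tuples n X" for x
      using fun_cong[OF g(3), of x] that by (simp add: J_def)
    hence "g \<ominus>\<^bsub>H\<^esub> h \<in> N" using SH[OF g(1)] SH[OF g(2)] d AH by (simp add: N_def ip_minus)
    hence "ip (g \<ominus>\<^bsub>H\<^esub> h) (g \<ominus>\<^bsub>H\<^esub> h) = 0" using SN[OF g(1)] SN[OF g(2)] NH SH[OF g(1)] SH[OF g(2)] by (simp add: ip_minus)
    hence "g \<ominus>\<^bsub>H\<^esub> h = \<zero>\<^bsub>H\<^esub>" using d ip.ip_eq_zero by simp
    moreover have "g = (g \<ominus>\<^bsub>H\<^esub> h) \<oplus>\<^bsub>H\<^esub> h"
      using SH[OF g(1)] SH[OF g(2)] by (simp add: a_minus_def H.a_assoc H.l_neg)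
    ultimately show "g = h" using SH[OF g(2)] by simp
  qed
  have closed: "l \<in> S" if s: "\<And>k::nat. s k \<in> S" and l: "l \<in> carrier H"
    and lim: "(\<lambda>k. vnorm H (s k \<ominus>\<^bsub>H\<^esub> l)) \<longlonglongrightarrow> 0" for s l
  proof -
    have "ip l g = 0" if g: "g \<in> N" for g
    proof -
      have b: "cmod (ip l g) \<le> vnorm H (s k \<ominus>\<^bsub>H\<^esub> l) * vnorm H g" for k
      proof -
        have "ip (s k \<ominus>\<^bsub>H\<^esub> l) g = - ip l g" using SN[OF s[of k] g] SH[OF s[of k]] NH[OF g] l by (simp add: ip_minus)
        moreover have "cmod (ip (s k \<ominus>\<^bsub>H\<^esub> l) g) \<le> sqrt (Re (ip (s k \<ominus>\<^bsub>H\<^esub> l) (s k \<ominus>\<^bsub>H\<^esub> l)) * Re (ip g g))"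
          by (rule real_le_rsqrt, rule ip.cauchy_schwarz[OF K]) (use s SH l g NH in auto)
        ultimately show ?thesis using nip s SH l g NH by (simp add: real_sqrt_mult)
      qed
      have "(\<lambda>k. vnorm H (s k \<ominus>\<^bsub>H\<^esub> l) * vnorm H g) \<longlonglongrightarrow> 0"
        using tendsto_mult_right[OF lim, of "vnorm H g"] by simp
      hence "cmod (ip l g) \<le> 0" by (rule LIMSEQ_le_const) (use b in auto)
      thus ?thesis by simp
    qed
    thus ?thesis using l by (simp add: S_def)
  qed
  obtain H' :: "'a hilbert_universe nspace" where H': "hilbert_space K H'" "carrier H' = J ` S"
    "\<And>h. h \<in> S \<Longrightarrow> vnorm H' (J h) = vnorm H h"
    "\<And>g h. g \<in> S \<Longrightarrow> h \<in> S \<Longrightarrow> J g \<oplus>\<^bsub>H'\<^esub> J h = J (g \<oplus>\<^bsub>H\<^esub> h)"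
    "\<And>g h. g \<in> S \<Longrightarrow> h \<in> S \<Longrightarrow> J g \<ominus>\<^bsub>H'\<^esub> J h = J (g \<ominus>\<^bsub>H\<^esub> h)"
    "\<And>c h. c \<in> K \<Longrightarrow> h \<in> S \<Longrightarrow> c \<odot>\<^bsub>H'\<^esub> J h = J (c \<odot>\<^bsub>H\<^esub> h)"
    by (rule hilbert_space_transport[OF K hs _ _ _ _ closed inj])
      (simp_all add: S_def NH ip0 ip.ip_add ip.ip_smult sc subset_eq)
  have Sminus: "g \<ominus>\<^bsub>H\<^esub> h \<in> S" if "g \<in> S" "h \<in> S" for g h
    using SN[OF that(1)] SN[OF that(2)] SH[OF that(1)] SH[OF that(2)] NH
    by (simp add: S_def ip_minus)
  define A' where "A' = (\<lambda>x\<in>tuples n X. J (A x))"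
  define M' where "M' = J ` (M \<inter> S)"
  define B' where "B' f = B (inv_into S J f)" for f
  have B'J: "B' (J h) = B h" if "h \<in> S" for h using inj that by (simp add: B'_def)
  have A'x: "A' x = J (A x)" if "x \<in> tuples n X" for x using that by (simp add: A'_def)
  have upd: "x(i := a) \<in> tuples n X" if "x \<in> tuples n X" "i \<in> {1..n}" "a \<in> carrier (X i)" for x i a
    using that by (auto simp: tuples_def PiE_iff extensional_def)
  have mA: "multilinear K n X H A" using bA by (simp add: bounded_multilinear_def)
  have Xadd: "a \<oplus>\<^bsub>X i\<^esub> b \<in> carrier (X i)" if "i \<in> {1..n}" "a \<in> carrier (X i)" "b \<in> carrier (X i)" for i a b
  proof -
    interpret Xi: banach_space K "X i" using X that by simp
    show ?thesis using that by simp
  qed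
  have Xsm: "c \<odot>\<^bsub>X i\<^esub> a \<in> carrier (X i)" if "i \<in> {1..n}" "c \<in> K" "a \<in> carrier (X i)" for i c a
  proof -
    interpret Xi: banach_space K "X i" using X that by simp
    show ?thesis using Xi.smult_closed that by (simp add: scalar_space_def)
  qed
  have "multilinear K n X H' A'"
    unfolding multilinear_def
  proof (intro conjI ballI)
    show "A' \<in> tuples n X \<rightarrow>\<^sub>E carrier H'" using AS by (auto simp: A'_def H'(2))
  next
    fix x i a b
    assume h: "x \<in> tuples n X" "i \<in> {1..n}" "a \<in> carrier (X i)" "b \<in> carrier (X i)"
    have "A (x(i := a \<oplus>\<^bsub>X i\<^esub> b)) = A (x(i := a)) \<oplus>\<^bsub>H\<^esub> A (x(i := b))"
      using mA h by (auto simp: multilinear_def)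
    thus "A' (x(i := a \<oplus>\<^bsub>X i\<^esub> b)) = A' (x(i := a)) \<oplus>\<^bsub>H'\<^esub> A' (x(i := b))"
      using h upd[OF h(1,2)] Xadd[OF h(2-4)] AS H'(4) by (simp add: A'x)
  next
    fix x i c a
    assume h: "x \<in> tuples n X" "i \<in> {1..n}" "c \<in> K" "a \<in> carrier (X i)"
    have "A (x(i := c \<odot>\<^bsub>X i\<^esub> a)) = c \<odot>\<^bsub>H\<^esub> A (x(i := a))"
      using mA h by (auto simp: multilinear_def)
    thus "A' (x(i := c \<odot>\<^bsub>X i\<^esub> a)) = c \<odot>\<^bsub>H'\<^esub> A' (x(i := a))"
      using h upd[OF h(1,2)] Xsm[OF h(2-4)] AS H'(6) by (simp add: A'x)
  qed
  moreover have nA: "vnorm H' (A' x) = vnorm H (A x)" if "x \<in> tuples n X" for x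
    using that AS H'(3) by (simp add: A'x)
  ultimately have bA': "bounded_multilinear K n X H' A'"
    using bA by (simp add: bounded_multilinear_def)
  have norm: "multilinear_norm n X H' A' = multilinear_norm n X H A"
    unfolding multilinear_norm_def by (rule SUP_cong) (auto simp: nA)
  have lip': "lipschitz_const H' V M' B' L" if "lipschitz_const H V M B L" for L
    using that by (auto simp: lipschitz_const_def M'_def B'J H'(3,5) Sminus)
  have "Lip H' V M' B' \<le> Lip H V M B"
    unfolding Lip_def
    by (rule cInf_superset_mono) (use lip lip' in \<open>auto intro!: bdd_belowI[of _ 0] simp: lipschitz_const_def\<close>)
  moreover have "hilbert_factorization K n X V T H' M' A' B'"
    unfolding hilbert_factorization_def
  proof (intro conjI)
    show "\<exists>L. lipschitz_const H' V M' B' L" using lip lip' by blast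
    show "\<forall>x\<in>tuples n X. T x = B' (A' x)" using T AS by (simp add: A'x B'J)
    show "A' ` tuples n X \<subseteq> M'" using AM AS by (auto simp: A'x M'_def)
    show "M' \<subseteq> carrier H'" by (auto simp: M'_def H'(2))
    show "B' \<in> M' \<rightarrow> carrier V" using BM by (auto simp: M'_def B'J)
  qed (use H'(1) bA' in auto)
  ultimately show ?thesis using norm by blast
qed

end

theory Submission
  imports Defs "HOL-Library.Function_Algebras" "HOL-Analysis.L2_Norm"
begin

text \<open>
  If \<open>T = B \<circ> A\<close> factors through a Hilbert space and \<open>u = \<Sum> (p\<^sub>i - q\<^sub>i) \<otimes> y\<^sub>i\<close>, then \<open>(p\<^sub>i, q\<^sub>i) \<le>\<^sub>\<pi> (a\<^sub>i, b\<^sub>i)\<close>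
  applied to the forms \<open>\<langle>A(\<cdot>), e\<rangle>\<close>, with \<open>e\<close> running over an orthonormal system, gives
  \<open>\<Sum>\<parallel>A p\<^sub>i - A q\<^sub>i\<parallel>\<^sup>2 \<le> \<Sum>\<parallel>A a\<^sub>i - A b\<^sub>i\<parallel>\<^sup>2 \<le> \<parallel>A\<parallel>\<^sup>2 \<Sum> \<pi>(a\<^sub>i - b\<^sub>i)\<^sup>2\<close>, and the Cauchy-Schwarz inequality yields
  \<open>\<bar>\<phi>(u)\<bar> \<le> \<parallel>A\<parallel> Lip(B) \<gamma>(u)\<close> for the functional \<open>\<phi>\<close> of \<open>T\<close>.

  Conversely, if \<open>\<bar>\<phi>\<bar> \<le> C \<gamma>\<close>, then multiplying \<open>y\<^sub>i\<close> in the unit ball by the conjugate of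
  \<open>\<langle>T p\<^sub>i - T q\<^sub>i, y\<^sub>i\<rangle>\<close> shows that \<open>(p\<^sub>i, q\<^sub>i) \<le>\<^sub>\<pi> (a\<^sub>i, b\<^sub>i)\<close> implies
  \<open>\<Sum>\<bar>\<langle>T p\<^sub>i - T q\<^sub>i, y\<^sub>i\<rangle>\<bar>\<^sup>2 \<le> C\<^sup>2 \<Sum> \<pi>(a\<^sub>i - b\<^sub>i)\<^sup>2\<close>. By the Hahn-Banach theorem there is a positive functional \<open>\<Lambda>\<close> on
  functions of multilinear forms \<open>\<psi>\<close> with \<open>\<Lambda>(\<bar>\<psi>(a) - \<psi>(b)\<bar>\<^sup>2) \<le> C\<^sup>2 \<pi>(a - b)\<^sup>2\<close> and
  \<open>\<parallel>T p - T q\<parallel>\<^sup>2 \<le> \<Lambda>(\<bar>\<psi>(p) - \<psi>(q)\<bar>\<^sup>2)\<close>. So \<open>T\<close> factors through the completion \<open>L\<^sup>2(\<Lambda>)\<close> by way of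
  \<open>A x = (\<psi> \<mapsto> \<psi>(x))\<close>, with \<open>\<parallel>A\<parallel> \<le> C\<close> and \<open>Lip(B) \<le> 1\<close>.
\<close>

section \<open>Positive functionals by the Hahn-Banach theorem\<close>

text \<open>\<open>T\<close> is not linear on tensors, and domination compares one scalar form at a
  time, whereas a factorization needs norms of vectors and a map \<open>B\<close> that is only
  Lipschitz on the image of \<open>A\<close>. Squaring makes everything homogeneous: the upper
  constraints on \<open>\<Lambda>\<close> (from the projective norm) and the lower ones (from
  \<open>T\<close>) generate two cones of pairs, and the square bound says that these cones are
  compatible. One functional has to meet both kinds of constraint, hence a two-sided form of the
  Hahn-Banach theorem rather than an extension theorem. The test functions are quadratic in the form
  and in general unbounded, so \<open>\<Lambda>\<close> is not sought as a measure on a compact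
  ball; it lives on the order ideal of functions dominated by an upper constraint, which is enough
  for an inner product. The resulting Hilbert space has an iterated function type outside the range
  of \<open>gamma_functional\<close> and is carried back by
  \<open>hilbert_factorization_universe\<close>. Tensors are handled through tuples and tested on
  forms, so that their equations become scalar ones.\<close>

definition sublinear_on :: "'v::real_vector set \<Rightarrow> ('v \<Rightarrow> real) \<Rightarrow> bool" where
  "sublinear_on L p \<longleftrightarrow> p 0 = 0 \<and> (\<forall>x\<in>L. \<forall>y\<in>L. p (x + y) \<le> p x + p y) \<and>
     (\<forall>x\<in>L. \<forall>t>0. p (t *\<^sub>R x) \<le> t * p x)"

lemma sublinear_onD:
  assumes "sublinear_on L p"
  shows "p 0 = 0" and "x \<in> L \<Longrightarrow> y \<in> L \<Longrightarrow> p (x + y) \<le> p x + p y"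
    and "x \<in> L \<Longrightarrow> 0 < t \<Longrightarrow> p (t *\<^sub>R x) \<le> t * p x"
  using assms by (auto simp: sublinear_on_def)

text \<open>Applying the inequality for positive factors to \<open>1/t\<close> gives the reverse
  inequality.\<close>

lemma sublinear_on_scaleR:
  assumes p: "sublinear_on L p" and L: "subspace L" and x: "x \<in> L" and t: "0 \<le> t"
  shows "p (t *\<^sub>R x) = t * p x"
proof (cases "t = 0")
  case False
  hence t: "0 < t" using t by simp
  have "p ((1/t) *\<^sub>R (t *\<^sub>R x)) \<le> 1/t * p (t *\<^sub>R x)"
    by (rule sublinear_onD(3)[OF p]) (use t x L in \<open>auto simp: subspace_scale\<close>)
  thus ?thesis using sublinear_onD(3)[OF p x t] t by (simp add: field_simps)
qed (simp add: sublinear_onD(1)[OF p])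

lemma sublinear_on_ge_neg:
  assumes "sublinear_on L p" "subspace L" "x \<in> L"
  shows "- p (- x) \<le> p x"
  using sublinear_onD(2)[OF assms(1), of x "- x"] subspace_neg[OF assms(2)] assms
    sublinear_onD(1)[OF assms(1)] by simp

text \<open>Zorn's lemma on the sublinear minorants of \<open>p\<close>. The pointwise infimum of a
  chain is finite because every minorant is at least \<open>- p (- x)\<close>, and it is subadditive
  because of two members of a chain one lies below the other.\<close>

lemma minimal_sublinear_on_exists:
  fixes L :: "'v::real_vector set"
  assumes L: "subspace L" and p: "sublinear_on L p"
  obtains q where "sublinear_on L q" "\<And>x. x \<in> L \<Longrightarrow> q x \<le> p x"
    "\<And>r. sublinear_on L r \<Longrightarrow> (\<And>x. x \<in> L \<Longrightarrow> r x \<le> q x) \<Longrightarrow> (\<And>x. x \<in> L \<Longrightarrow> r x = q x)"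
proof -
  \<comment> \<open>Members are extensional so that comparison on \<open>L\<close> is antisymmetric.
    The relation \<open>P\<close> puts the smaller functional on top, so a maximal element for
    Zorn's lemma is a minimal functional.\<close>
  define A where "A = {q \<in> extensional L. sublinear_on L q \<and> (\<forall>x\<in>L. q x \<le> p x)}"
  define P where "P q r \<longleftrightarrow> (\<forall>x\<in>L. r x \<le> q x)" for q r :: "'v \<Rightarrow> real"
  have restr: "restrict r L \<in> A" if "sublinear_on L r" "\<And>x. x \<in> L \<Longrightarrow> r x \<le> p x" for r
    using that L by (auto simp: A_def sublinear_on_def subspace_add subspace_scale subspace_0)
  have po: "partial_order_on A (relation_of P A)"
  proof -
    have "q = r" if "q \<in> A" "r \<in> A" "P q r" "P r q" for q r
      by (rule extensionalityI[of _ L]) (use that in \<open>auto simp: A_def P_def intro: antisym\<close>)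
    moreover have "P q q" for q by (simp add: P_def)
    moreover have "P q s" if "P q r" "P r s" for q r s
      using that unfolding P_def by (meson order_trans)
    ultimately show ?thesis
      unfolding partial_order_on_def preorder_on_def refl_on_def antisym_def trans_on_def relation_of_def
      by blast
  qed
  have "\<exists>u\<in>A. \<forall>a\<in>C. P a u" if C: "C \<in> Chains (relation_of P A)" for C
  proof (cases "C = {}")
    case True
    thus ?thesis using restr[OF p] by auto
  next
    case False
    have CA: "q \<in> A" if "q \<in> C" for q using C that by (auto simp: Chains_def relation_of_def)
    have comp: "P q r \<or> P r q" if "q \<in> C" "r \<in> C" for q r
      using C that by (auto simp: Chains_def relation_of_def)
    define u where "u x = (INF q\<in>C. q x)" for x
    have bdd: "bdd_below ((\<lambda>q. q x) ` C)" if x: "x \<in> L" for x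
    proof (rule bdd_belowI2)
      fix q assume "q \<in> C"
      hence q: "sublinear_on L q" "\<forall>x\<in>L. q x \<le> p x" using CA by (auto simp: A_def)
      have "q (- x) \<le> p (- x)" using q(2) subspace_neg[OF L] x by auto
      thus "- p (- x) \<le> q x" using sublinear_on_ge_neg[OF q(1) L x] by linarith
    qed
    have lower: "u x \<le> q x" if "x \<in> L" "q \<in> C" for x q
      unfolding u_def by (rule cINF_lower[OF bdd]) (use that in auto)
    have "sublinear_on L u"
      unfolding sublinear_on_def
    proof (intro conjI ballI allI impI)
      have "u 0 = (INF q\<in>C. 0)"
        unfolding u_def by (rule INF_cong[OF refl]) (use CA sublinear_onD(1) in \<open>auto simp: A_def\<close>)
      thus "u 0 = 0" using False by simp
    next
      fix x y assume xy: "x \<in> L" "y \<in> L"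
      have *: "u (x + y) \<le> q x + r y" if qr: "q \<in> C" "r \<in> C" for q r
      proof -
        obtain m where m: "m \<in> C" "\<forall>z\<in>L. m z \<le> q z" "\<forall>z\<in>L. m z \<le> r z"
          using comp[OF qr] qr unfolding P_def by blast
        have "u (x + y) \<le> m (x + y)" by (rule lower) (use xy m L in \<open>auto simp: subspace_add\<close>)
        also have "\<dots> \<le> m x + m y" by (rule sublinear_onD(2)) (use CA m xy in \<open>auto simp: A_def\<close>)
        finally show ?thesis using m xy by fastforce
      qed
      have "u (x + y) - r y \<le> u x" if "r \<in> C" for r
        unfolding u_def[of x] by (rule cINF_greatest[OF False]) (use * that in \<open>auto simp: algebra_simps\<close>)
      hence "u (x + y) - u x \<le> r y" if "r \<in> C" for r using that by fastforce
      hence "u (x + y) - u x \<le> u y"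
        unfolding u_def[of y] by (intro cINF_greatest[OF False]) auto
      thus "u (x + y) \<le> u x + u y" by simp
    next
      fix x and t :: real assume x: "x \<in> L" and t: "0 < t"
      have "u (t *\<^sub>R x) / t \<le> q x" if "q \<in> C" for q
        using lower[of "t *\<^sub>R x" q] that CA[OF that] L x t sublinear_onD(3)[of L q x t]
        by (force simp: A_def subspace_scale field_simps)
      hence "u (t *\<^sub>R x) / t \<le> u x"
        unfolding u_def[of x] by (intro cINF_greatest[OF False]) auto
      thus "u (t *\<^sub>R x) \<le> t * u x" using t by (simp add: field_simps)
    qed
    moreover have "u x \<le> p x" if "x \<in> L" for x
    proof -
      obtain q where "q \<in> C" using False by auto
      thus ?thesis using lower[OF that] CA that by (force simp: A_def)
    qed
    ultimately have "restrict u L \<in> A" by (rule restr)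
    thus ?thesis by (intro bexI[of _ "restrict u L"]) (auto simp: P_def lower)
  qed
  from predicate_Zorn[OF po this] obtain q where q: "q \<in> A" "\<forall>r\<in>A. P q r \<longrightarrow> r = q" by blast
  show ?thesis
  proof (rule that[of q])
    fix r x assume r: "sublinear_on L r" "\<And>x. x \<in> L \<Longrightarrow> r x \<le> q x" and x: "x \<in> L"
    have "restrict r L \<in> A" by (rule restr[OF r(1)]) (use r(2) q(1) in \<open>force simp: A_def\<close>)
    moreover have "P q (restrict r L)" using r(2) by (simp add: P_def)
    ultimately have "restrict r L = q" using q(2) by blast
    thus "r x = q x" using x by auto
  qed (use q in \<open>auto simp: A_def\<close>)
qed

text \<open>A minimal sublinear functional \<open>q\<close> is already linear. For \<open>v\<close>
  in \<open>L\<close>, the infimum over \<open>t \<ge> 0\<close> of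
  \<open>q (x + t *\<^sub>R v) - t * q v\<close> is again sublinear and below \<open>q\<close>,
  hence equal to \<open>q\<close>; taking \<open>x = - v\<close> and \<open>t = 1\<close> gives
  \<open>q (- v) \<le> - q v\<close>. Oddness then turns subadditivity into additivity.\<close>

theorem hahn_banach_sublinear:
  fixes L :: "'v::real_vector set"
  assumes L: "subspace L" and p: "sublinear_on L p"
  obtains f where "\<And>x y. x \<in> L \<Longrightarrow> y \<in> L \<Longrightarrow> f (x + y) = f x + f y"
    "\<And>c x. x \<in> L \<Longrightarrow> f (c *\<^sub>R x) = c * f x" "\<And>x. x \<in> L \<Longrightarrow> f x \<le> p x"
proof -
  obtain q where q: "sublinear_on L q" "\<And>x. x \<in> L \<Longrightarrow> q x \<le> p x"
    and min: "\<And>r x. sublinear_on L r \<Longrightarrow> (\<And>x. x \<in> L \<Longrightarrow> r x \<le> q x) \<Longrightarrow> x \<in> L \<Longrightarrow> r x = q x"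
    using minimal_sublinear_on_exists[OF L p] by metis
  have neg: "q (- v) = - q v" if v: "v \<in> L" for v
  proof -
    define S where "S x = (\<lambda>t. q (x + t *\<^sub>R v) - t * q v) ` {0..}" for x
    define r where "r x = Inf (S x)" for x
    have cl: "x + t *\<^sub>R v \<in> L" if "x \<in> L" for x t using that v L by (simp add: subspace_add subspace_scale)
    have bdd: "bdd_below (S x)" if x: "x \<in> L" for x
      unfolding S_def
    proof (rule bdd_belowI2)
      fix t :: real assume "t \<in> {0..}"
      hence "t * q v \<le> q (x + t *\<^sub>R v) + q (- x)"
        using sublinear_onD(2)[OF q(1) cl[OF x, of t] subspace_neg[OF L x]] sublinear_on_scaleR[OF q(1) L v, of t] by simp
      thus "- q (- x) \<le> q (x + t *\<^sub>R v) - t * q v" by simp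
    qed
    have lower: "r x \<le> q (x + t *\<^sub>R v) - t * q v" if "x \<in> L" "0 \<le> t" for x t
      unfolding r_def by (rule cInf_lower[OF _ bdd]) (use that in \<open>auto simp: S_def\<close>)
    have greatest: "b \<le> r x" if "\<And>t. 0 \<le> t \<Longrightarrow> b \<le> q (x + t *\<^sub>R v) - t * q v" for b x
      unfolding r_def by (rule cInf_greatest) (use that in \<open>auto simp: S_def\<close>)
    have "sublinear_on L r"
      unfolding sublinear_on_def
    proof (intro conjI ballI allI impI)
      have "r 0 \<le> 0" using lower[of 0 0] L sublinear_onD(1)[OF q(1)] by (simp add: subspace_0)
      moreover have "0 \<le> r 0" by (rule greatest) (use sublinear_on_scaleR[OF q(1) L v] in auto)
      ultimately show "r 0 = 0" by simp
    next
      fix x y assume xy: "x \<in> L" "y \<in> L"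
      have *: "r (x + y) \<le> (q (x + s *\<^sub>R v) - s * q v) + (q (y + t *\<^sub>R v) - t * q v)"
        if st: "0 \<le> s" "0 \<le> t" for s t
      proof -
        have "r (x + y) \<le> q ((x + y) + (s + t) *\<^sub>R v) - (s + t) * q v"
          by (rule lower) (use xy st L in \<open>auto simp: subspace_add\<close>)
        also have "(x + y) + (s + t) *\<^sub>R v = (x + s *\<^sub>R v) + (y + t *\<^sub>R v)" by (simp add: algebra_simps)
        also have "q \<dots> \<le> q (x + s *\<^sub>R v) + q (y + t *\<^sub>R v)"
          by (rule sublinear_onD(2)[OF q(1)]) (use cl xy in auto)
        finally show ?thesis by (simp add: algebra_simps)
      qed
      have "r (x + y) - (q (y + t *\<^sub>R v) - t * q v) \<le> r x" if "0 \<le> t" for t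
        by (rule greatest) (use *[OF _ that] in \<open>fastforce simp: algebra_simps\<close>)
      hence "r (x + y) - r x \<le> r y" by (intro greatest) (fastforce simp: algebra_simps)
      thus "r (x + y) \<le> r x + r y" by simp
    next
      fix x and t :: real assume x: "x \<in> L" and t: "0 < t"
      have "r (t *\<^sub>R x) / t \<le> r x"
      proof (rule greatest)
        fix s :: real assume s: "0 \<le> s"
        have "r (t *\<^sub>R x) \<le> q (t *\<^sub>R x + (t * s) *\<^sub>R v) - (t * s) * q v"
          by (rule lower) (use x s t L in \<open>auto simp: subspace_scale\<close>)
        also have "t *\<^sub>R x + (t * s) *\<^sub>R v = t *\<^sub>R (x + s *\<^sub>R v)" by (simp add: algebra_simps)
        also have "q \<dots> \<le> t * q (x + s *\<^sub>R v)" by (rule sublinear_onD(3)[OF q(1) cl[OF x] t])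
        finally show "r (t *\<^sub>R x) / t \<le> q (x + s *\<^sub>R v) - s * q v" using t by (simp add: field_simps)
      qed
      thus "r (t *\<^sub>R x) \<le> t * r x" using t by (simp add: field_simps)
    qed
    moreover have "r x \<le> q x" if "x \<in> L" for x using lower[OF that, of 0] by simp
    ultimately have "r (- v) = q (- v)" by (rule min) (use v L in \<open>auto simp: subspace_neg\<close>)
    hence "q (- v) \<le> - q v"
      using lower[of "- v" 1] v L sublinear_onD(1)[OF q(1)] by (simp add: subspace_neg)
    thus ?thesis using sublinear_on_ge_neg[OF q(1) L v] by linarith
  qed
  show ?thesis
  proof (rule that[of q])
    fix x y assume xy: "x \<in> L" "y \<in> L"
    have "q (- x + - y) \<le> q (- x) + q (- y)"
      by (rule sublinear_onD(2)[OF q(1)]) (use xy L in \<open>auto simp: subspace_neg\<close>)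
    hence "q x + q y \<le> q (x + y)"
      using neg[OF xy(1)] neg[OF xy(2)] neg[OF subspace_add[OF L xy]] by (simp add: add.commute)
    thus "q (x + y) = q x + q y" using sublinear_onD(2)[OF q(1) xy] by simp
  next
    fix c x assume x: "x \<in> L"
    show "q (c *\<^sub>R x) = c * q x"
    proof (cases "0 \<le> c")
      case False
      have "q (- (c *\<^sub>R x)) = (- c) * q x" using sublinear_on_scaleR[OF q(1) L x, of "- c"] False by simp
      thus ?thesis using neg[OF subspace_scale[OF L x]] by simp
    qed (rule sublinear_on_scaleR[OF q(1) L x])
  qed (use q in auto)
qed

section \<open>Cones of constraints and positive functionals\<close>

instantiation "fun" :: (type, real_vector) real_vector
begin

definition "c *\<^sub>R f = (\<lambda>x. c *\<^sub>R f x)"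

instance
  by standard (auto simp: scaleR_fun_def fun_eq_iff scaleR_add_right scaleR_add_left)

end

definition pair_cone :: "(('f \<Rightarrow> real) \<times> real) set \<Rightarrow> bool" where
  "pair_cone U \<longleftrightarrow> (0, 0) \<in> U \<and> (\<forall>(g, s)\<in>U. \<forall>(h, t)\<in>U. (g + h, s + t) \<in> U) \<and>
     (\<forall>(g, s)\<in>U. \<forall>c\<ge>0. (c *\<^sub>R g, c * s) \<in> U)"

lemma pair_coneI:
  assumes "(0, 0) \<in> U" "\<And>g s h t. (g, s) \<in> U \<Longrightarrow> (h, t) \<in> U \<Longrightarrow> (g + h, s + t) \<in> U"
    "\<And>g s c. (g, s) \<in> U \<Longrightarrow> 0 \<le> c \<Longrightarrow> (c *\<^sub>R g, c * s) \<in> U"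
  shows "pair_cone U"
  using assms by (auto simp: pair_cone_def)

text \<open>Sums carry no coefficients: the generating sets used are closed under positive factors,
  so an element of the hull is literally a finite sequence of generators, matching the finite
  sequences in the definition of \<open>gamma_norm\<close>.\<close>

definition cone_hull :: "(('f \<Rightarrow> real) \<times> real) set \<Rightarrow> (('f \<Rightarrow> real) \<times> real) set" where
  "cone_hull S = {(\<lambda>x. \<Sum>(g, s)\<leftarrow>us. g x, \<Sum>(g, s)\<leftarrow>us. s) | us. set us \<subseteq> S}"

lemma cone_hullI: "(g, s) \<in> S \<Longrightarrow> (g, s) \<in> cone_hull S"
  unfolding cone_hull_def mem_Collect_eq by (rule exI[of _ "[(g, s)]"]) simp

lemma pair_cone_cone_hull:
  assumes S: "\<And>g s c. (g, s) \<in> S \<Longrightarrow> 0 < c \<Longrightarrow> (c *\<^sub>R g, c * s) \<in> S"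
  shows "pair_cone (cone_hull S)"
proof (rule pair_coneI)
  show zero: "(0, 0) \<in> cone_hull S"
    unfolding cone_hull_def mem_Collect_eq by (rule exI[of _ "[]"]) (simp add: zero_fun_def)
  fix g s assume "(g, s) \<in> cone_hull S"
  then obtain us where us: "g = (\<lambda>x. \<Sum>(g, s)\<leftarrow>us. g x)" "s = (\<Sum>(g, s)\<leftarrow>us. s)" "set us \<subseteq> S"
    by (auto simp: cone_hull_def)
  show "(g + h, s + t) \<in> cone_hull S" if ht: "(h, t) \<in> cone_hull S" for h t
  proof -
    obtain vs where vs: "h = (\<lambda>x. \<Sum>(g, s)\<leftarrow>vs. g x)" "t = (\<Sum>(g, s)\<leftarrow>vs. s)" "set vs \<subseteq> S"
      using ht by (auto simp: cone_hull_def)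
    show ?thesis
      unfolding cone_hull_def mem_Collect_eq
      by (rule exI[of _ "us @ vs"]) (use us vs in \<open>simp add: plus_fun_def\<close>)
  qed
  show "(c *\<^sub>R g, c * s) \<in> cone_hull S" if c: "0 \<le> c" for c
  proof (cases "c = 0")
    \<comment> \<open>Only positive factors preserve \<open>S\<close>; the factor 0 is covered by
      the empty sum.\<close>
    case True
    thus ?thesis using zero by simp
  next
    case False
    hence "set (map (\<lambda>(g, s). (c *\<^sub>R g, c * s)) us) \<subseteq> S" using us(3) S c by auto
    thus ?thesis
      unfolding cone_hull_def mem_Collect_eq
      by (intro exI[of _ "map (\<lambda>(g, s). (c *\<^sub>R g, c * s)) us"])
        (simp add: us(1,2) scaleR_fun_def comp_def case_prod_unfold sum_list_const_mult)
  qed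
qed

text \<open>Here the upper bounds keep a positive functional finite:
  \<open>\<bar>f\<bar> \<le> g\<close> with \<open>(g, s) \<in> U\<close> forces
  \<open>\<bar>\<Lambda> f\<bar> \<le> \<Lambda> g \<le> s\<close>.\<close>

definition dominated_functions :: "(('f \<Rightarrow> real) \<times> real) set \<Rightarrow> ('f \<Rightarrow> real) set" where
  "dominated_functions U = {f. \<exists>(g, s)\<in>U. \<forall>x. \<bar>f x\<bar> \<le> g x}"

lemma dominated_functionsI: "(g, s) \<in> U \<Longrightarrow> (\<And>x. \<bar>f x\<bar> \<le> g x) \<Longrightarrow> f \<in> dominated_functions U"
  unfolding dominated_functions_def by blast

text \<open>Closure under domination is what later makes products of square-integrable functions
  integrable.\<close>

locale positive_functional =
  fixes L :: "('f \<Rightarrow> real) set" and \<Lambda> :: "('f \<Rightarrow> real) \<Rightarrow> real"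
  assumes subspace: "subspace L"
    and ideal: "f \<in> L \<Longrightarrow> (\<And>x. \<bar>g x\<bar> \<le> f x) \<Longrightarrow> g \<in> L"
    and add: "f \<in> L \<Longrightarrow> g \<in> L \<Longrightarrow> \<Lambda> (f + g) = \<Lambda> f + \<Lambda> g"
    and scale: "f \<in> L \<Longrightarrow> \<Lambda> (c *\<^sub>R f) = c * \<Lambda> f"
    and nonneg: "f \<in> L \<Longrightarrow> (\<And>x. 0 \<le> f x) \<Longrightarrow> 0 \<le> \<Lambda> f"

text \<open>A simultaneous Mazur--Orlicz theorem: the pairs in \<open>U\<close> are the upper bounds \<open>\<Lambda> g \<le> s\<close>, those in
  \<open>V\<close> the lower bounds \<open>t \<le> \<Lambda> h\<close> which the positive functional \<open>\<Lambda>\<close> has to satisfy.\<close>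

theorem positive_functional_between:
  fixes U V :: "(('f \<Rightarrow> real) \<times> real) set"
  assumes U: "pair_cone U" and V: "pair_cone V"
    and consistent: "\<And>g s h t. (g, s) \<in> U \<Longrightarrow> (h, t) \<in> V \<Longrightarrow> (\<And>x. h x \<le> g x) \<Longrightarrow> t \<le> s"
  obtains \<Lambda> where "positive_functional (dominated_functions U) \<Lambda>"
    "\<And>g s. (g, s) \<in> U \<Longrightarrow> g \<in> dominated_functions U \<Longrightarrow> \<Lambda> g \<le> s"
    "\<And>h t. (h, t) \<in> V \<Longrightarrow> h \<in> dominated_functions U \<Longrightarrow> t \<le> \<Lambda> h"
proof -
  have cone0: "(0, 0) \<in> W" and cone_add: "(g, s) \<in> W \<Longrightarrow> (h, t) \<in> W \<Longrightarrow> (g + h, s + t) \<in> W"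
    and cone_scale: "(g, s) \<in> W \<Longrightarrow> 0 \<le> c \<Longrightarrow> (c *\<^sub>R g, c * s) \<in> W"
    if "pair_cone W" for W :: "(('f \<Rightarrow> real) \<times> real) set" and g h s t c
    using that unfolding pair_cone_def by blast+
  define L where "L = dominated_functions U"
  have LI: "f \<in> L" if "(g, s) \<in> U" "\<And>x. \<bar>f x\<bar> \<le> g x" for f g s
    using dominated_functionsI[OF that] by (simp add: L_def)
  have subL: "subspace L"
  proof (rule subspaceI)
    show "0 \<in> L" by (rule LI[OF cone0[OF U]]) simp
  next
    fix f f' assume "f \<in> L" "f' \<in> L"
    then obtain g s g' s' where *: "(g, s) \<in> U" "\<forall>x. \<bar>f x\<bar> \<le> g x" "(g', s') \<in> U" "\<forall>x. \<bar>f' x\<bar> \<le> g' x"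
      by (auto simp: L_def dominated_functions_def)
    have "\<bar>(f + f') x\<bar> \<le> (g + g') x" for x
      using *(2)[rule_format, of x] *(4)[rule_format, of x] by simp
    thus "f + f' \<in> L" by (rule LI[OF cone_add[OF U *(1,3)]])
  next
    fix c :: real and f assume "f \<in> L"
    then obtain g s where *: "(g, s) \<in> U" "\<forall>x. \<bar>f x\<bar> \<le> g x" by (auto simp: L_def dominated_functions_def)
    have "\<bar>(c *\<^sub>R f) x\<bar> \<le> (\<bar>c\<bar> *\<^sub>R g) x" for x
      using *(2) by (simp add: scaleR_fun_def abs_mult mult_left_mono)
    thus "c *\<^sub>R f \<in> L" by (intro LI[OF cone_scale[OF U *(1), of "\<bar>c\<bar>"]]) auto
  qed
  \<comment> \<open>A positive \<open>\<Lambda>\<close> obeying both kinds of bounds satisfies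
    \<open>\<Lambda> f \<le> \<Lambda> g - \<Lambda> h \<le> s - t\<close> whenever
    \<open>f + h \<le> g\<close>. \<open>p\<close> is the best bound of this kind, and conversely
    every linear functional below \<open>p\<close> turns out to be positive and to obey all
    bounds.\<close>
  define S where "S f = {s - t | s t. \<exists>g h. (g, s) \<in> U \<and> (h, t) \<in> V \<and> (\<forall>x. f x + h x \<le> g x)}" for f
  define p where "p f = Inf (S f)" for f
  have bdd: "bdd_below (S f)" if f: "f \<in> L" for f
  proof -
    obtain g s where *: "(g, s) \<in> U" "\<forall>x. \<bar>f x\<bar> \<le> g x" using f by (auto simp: L_def dominated_functions_def)
    have "- s \<le> s' - t" if h: "(g', s') \<in> U" "(h, t) \<in> V" "\<forall>x. f x + h x \<le> g' x" for g' s' h t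
    proof -
      \<comment> \<open>From \<open>f + h \<le> g'\<close> and \<open>- f \<le> g\<close>;
        consistency then bounds \<open>t\<close> by \<open>s' + s\<close>, so the infimum is
        finite.\<close>
      have "h x \<le> (g' + g) x" for x using h(3)[rule_format, of x] *(2)[rule_format, of x] by simp
      thus ?thesis using consistent[OF cone_add[OF U h(1) *(1)] h(2)] by simp
    qed
    thus ?thesis by (auto simp: S_def intro!: bdd_belowI[of _ "- s"])
  qed
  have ne: "S f \<noteq> {}" if f: "f \<in> L" for f
  proof -
    obtain g s where *: "(g, s) \<in> U" "\<forall>x. \<bar>f x\<bar> \<le> g x" using f by (auto simp: L_def dominated_functions_def)
    have "f x + 0 \<le> g x" for x using *(2)[rule_format, of x] by simp
    thus ?thesis using cone0[OF V] *(1) unfolding S_def by fastforce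
  qed
  have lower: "p f \<le> s - t" if "f \<in> L" "(g, s) \<in> U" "(h, t) \<in> V" "\<And>x. f x + h x \<le> g x" for f g s h t
    unfolding p_def by (rule cInf_lower[OF _ bdd]) (use that in \<open>auto simp: S_def\<close>)
  have greatest: "b \<le> p f" if "f \<in> L"
    "\<And>g s h t. (g, s) \<in> U \<Longrightarrow> (h, t) \<in> V \<Longrightarrow> (\<And>x. f x + h x \<le> g x) \<Longrightarrow> b \<le> s - t" for b f
    unfolding p_def by (rule cInf_greatest[OF ne]) (use that in \<open>auto simp: S_def\<close>)
  have "sublinear_on L p"
    unfolding sublinear_on_def
  proof (intro conjI ballI allI impI)
    have "p 0 \<le> 0" using lower[OF subspace_0[OF subL] cone0[OF U] cone0[OF V]] by simp
    moreover have "0 \<le> p 0" by (rule greatest[OF subspace_0[OF subL]]) (use consistent in fastforce)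
    ultimately show "p 0 = 0" by simp
  next
    fix f f' assume f: "f \<in> L" "f' \<in> L"
    have *: "p (f + f') \<le> (s - t) + (s' - t')"
      if h: "(g, s) \<in> U" "(h, t) \<in> V" "\<And>x. f x + h x \<le> g x"
        "(g', s') \<in> U" "(h', t') \<in> V" "\<And>x. f' x + h' x \<le> g' x" for g s h t g' s' h' t'
    proof -
      have "(f + f') x + (h + h') x \<le> (g + g') x" for x using h(3)[of x] h(6)[of x] by simp
      thus ?thesis
        using lower[OF subspace_add[OF subL f] cone_add[OF U h(1,4)] cone_add[OF V h(2,5)]] by simp
    qed
    have "p (f + f') - (s' - t') \<le> p f"
      if "(g', s') \<in> U" "(h', t') \<in> V" "\<And>x. f' x + h' x \<le> g' x" for g' s' h' t'
      by (rule greatest[OF f(1)]) (use *[OF _ _ _ that] in \<open>fastforce simp: algebra_simps\<close>)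
    hence "p (f + f') - p f \<le> p f'" by (intro greatest[OF f(2)]) (fastforce simp: algebra_simps)
    thus "p (f + f') \<le> p f + p f'" by simp
  next
    fix f and c :: real assume f: "f \<in> L" and c: "0 < c"
    have "p (c *\<^sub>R f) / c \<le> p f"
    proof (rule greatest[OF f])
      fix g s h t assume h: "(g, s) \<in> U" "(h, t) \<in> V" "\<And>x. f x + h x \<le> g x"
      have "(c *\<^sub>R f) x + (c *\<^sub>R h) x \<le> (c *\<^sub>R g) x" for x
        using h(3)[of x] c by (simp add: scaleR_fun_def flip: distrib_left)
      hence "p (c *\<^sub>R f) \<le> c * s - c * t"
        using lower[OF subspace_scale[OF subL f] cone_scale[OF U h(1)] cone_scale[OF V h(2)], of c c c] c by simp
      thus "p (c *\<^sub>R f) / c \<le> s - t" using c by (simp add: field_simps)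
    qed
    thus "p (c *\<^sub>R f) \<le> c * p f" using c by (simp add: field_simps)
  qed
  from hahn_banach_sublinear[OF subL this] obtain \<Lambda>
    where add: "\<And>f g. f \<in> L \<Longrightarrow> g \<in> L \<Longrightarrow> \<Lambda> (f + g) = \<Lambda> f + \<Lambda> g"
    and scale: "\<And>c f. f \<in> L \<Longrightarrow> \<Lambda> (c *\<^sub>R f) = c * \<Lambda> f" and le: "\<And>f. f \<in> L \<Longrightarrow> \<Lambda> f \<le> p f" by blast
  have neg: "\<Lambda> (- f) = - \<Lambda> f" "- f \<in> L" if "f \<in> L" for f
    using scale[OF that, of "- 1"] subspace_neg[OF subL that] by simp_all
  show ?thesis
  proof (rule that, fold L_def)
    show "positive_functional L \<Lambda>"
    proof
      fix f g assume f: "f \<in> L" and g: "\<And>x. \<bar>g x\<bar> \<le> f x"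
      obtain h s where *: "(h, s) \<in> U" "\<forall>x. \<bar>f x\<bar> \<le> h x" using f by (auto simp: L_def dominated_functions_def)
      show "g \<in> L" by (rule LI[OF *(1)]) (use g *(2) in \<open>smt (verit)\<close>)
    next
      fix f assume f: "f \<in> L" "\<And>x. 0 \<le> f x"
      \<comment> \<open>Positivity comes from the zero pairs of both cones:
        \<open>- f + 0 \<le> 0\<close> gives \<open>p (- f) \<le> 0\<close>.\<close>
      have "\<Lambda> (- f) \<le> 0 - 0"
        by (rule order_trans[OF le lower[OF _ cone0[OF U] cone0[OF V]]]) (use f neg in auto)
      thus "0 \<le> \<Lambda> f" using neg f by simp
    qed (fact subL add scale)+
  next
    fix g s assume "(g, s) \<in> U" "g \<in> L"
    thus "\<Lambda> g \<le> s" using order_trans[OF le lower[OF _ _ cone0[OF V]]] by fastforce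
  next
    fix h t assume h: "(h, t) \<in> V" "h \<in> L"
    \<comment> \<open>\<open>- h + h \<le> 0\<close>, so the pairs \<open>(0, 0)\<close> and
      \<open>(h, t)\<close> contribute \<open>0 - t\<close> to \<open>S (- h)\<close>.\<close>
    have "\<Lambda> (- h) \<le> 0 - t"
      by (rule order_trans[OF le lower[OF _ cone0[OF U] h(1)]]) (use h neg in auto)
    thus "t \<le> \<Lambda> h" using neg h by simp
  qed
qed

section \<open>Inner products and completion\<close>

context inner_product
begin

lemma smult_in_carrier: "c \<in> K \<Longrightarrow> x \<in> carrier V \<Longrightarrow> c \<odot> x \<in> carrier V"
  using smult_closed by (simp add: scalar_space_def)

lemma ip_add_right:
  assumes "x \<in> carrier V" "y \<in> carrier V" "z \<in> carrier V"
  shows "ip x (y \<oplus> z) = ip x y + ip x z"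
  using ip_commute[of "y \<oplus> z" x] ip_commute[of y x] ip_commute[of z x] assms by (simp add: ip_add)

lemma ip_smult_right:
  assumes "c \<in> K" "x \<in> carrier V" "y \<in> carrier V"
  shows "ip x (c \<odot> y) = cnj c * ip x y"
  using ip_commute[of "c \<odot> y" x] ip_commute[of y x] assms by (simp add: ip_smult smult_in_carrier)

lemma ip_zero_left: "x \<in> carrier V \<Longrightarrow> ip \<zero> x = 0"
  using ip_add[of "\<zero>" "\<zero>" x] by simp

lemma ip_minus_left:
  assumes "x \<in> carrier V" "y \<in> carrier V" "z \<in> carrier V"
  shows "ip (x \<ominus> y) z = ip x z - ip y z"
  using ip_add[of "x \<ominus> y" y z] assms by (simp add: a_minus_def a_assoc l_neg)

lemma ip_minus_right:
  assumes "x \<in> carrier V" "y \<in> carrier V" "z \<in> carrier V"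
  shows "ip x (y \<ominus> z) = ip x y - ip x z"
  using ip_add_right[of x "y \<ominus> z" z] assms by (simp add: a_minus_def a_assoc l_neg)

lemma ip_self:
  assumes "x \<in> carrier V"
  shows "ip x x = of_real (Re (ip x x))"
  using arg_cong[OF ip_commute[OF assms assms], of Im] by (simp add: complex_eq_iff)

lemma cmod_ip_le:
  assumes K: "K = \<real> \<or> K = UNIV" and x: "x \<in> carrier V" and y: "y \<in> carrier V"
  shows "cmod (ip x y) \<le> sqrt (Re (ip x x)) * sqrt (Re (ip y y))"
  using real_le_rsqrt[OF cauchy_schwarz[OF assms]] by (simp add: real_sqrt_mult)

lemma normed_space_of_inner_product:
  assumes K: "K = \<real> \<or> K = UNIV" and norm: "\<And>x. x \<in> carrier V \<Longrightarrow> vnorm V x = sqrt (Re (ip x x))"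
  shows "normed_space K V"
proof (intro normed_space.intro normed_space_axioms.intro)
  show "module (scalar_space K) V" by (rule module_axioms)
next
  fix x assume x: "x \<in> carrier V"
  show "0 \<le> vnorm V x" using norm[OF x] ip_nonneg[OF x] by simp
  show "vnorm V x = 0 \<longleftrightarrow> x = \<zero>"
  proof
    assume "vnorm V x = 0"
    hence "of_real (Re (ip x x)) = (0::complex)" using norm[OF x] by simp
    thus "x = \<zero>" by (intro ip_eq_zero[OF x]) (metis ip_self[OF x])
  next
    assume "x = \<zero>"
    hence "ip x x = 0" using ip_zero_left[OF x] by blast
    thus "vnorm V x = 0" using norm[OF x] by simp
  qed
next
  fix x y assume xy: "x \<in> carrier V" "y \<in> carrier V"
  let ?a = "Re (ip x x)" and ?b = "Re (ip y y)"
  have "Re (ip (x \<oplus> y) (x \<oplus> y)) = ?a + ?b + 2 * Re (ip x y)"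
    using ip_commute[of x y] xy by (simp add: ip_add ip_add_right)
  also have "\<dots> \<le> ?a + ?b + 2 * (sqrt ?a * sqrt ?b)"
    using cmod_ip_le[OF K xy] complex_Re_le_cmod[of "ip x y"] by simp
  also have "\<dots> = (sqrt ?a + sqrt ?b)\<^sup>2"
    using ip_nonneg xy by (simp add: power2_sum)
  finally show "vnorm V (x \<oplus> y) \<le> vnorm V x + vnorm V y"
    using xy ip_nonneg by (simp add: norm real_le_lsqrt)
next
  fix c x assume c: "c \<in> K" and x: "x \<in> carrier V"
  have "ip (c \<odot> x) (c \<odot> x) = (c * cnj c) * ip x x"
    using c x by (simp add: ip_smult ip_smult_right smult_in_carrier)
  also have "\<dots> = of_real ((cmod c)\<^sup>2 * Re (ip x x))"
    by (subst ip_self[OF x]) (simp add: complex_norm_square[symmetric])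
  finally show "vnorm V (c \<odot> x) = cmod c * vnorm V x"
    using c x by (simp add: norm smult_in_carrier real_sqrt_mult)
qed

end

section \<open>Completion of a possibly degenerate inner product on functions\<close>

locale semi_inner_product =
  fixes K :: "complex set" and G :: "('f \<Rightarrow> complex) set"
    and q :: "('f \<Rightarrow> complex) \<Rightarrow> ('f \<Rightarrow> complex) \<Rightarrow> complex"
  assumes K: "K = \<real> \<or> K = UNIV"
    and zero_closed: "0 \<in> G"
    and add_closed: "f \<in> G \<Longrightarrow> g \<in> G \<Longrightarrow> f + g \<in> G"
    and scale_closed: "c \<in> K \<Longrightarrow> f \<in> G \<Longrightarrow> (\<lambda>x. c * f x) \<in> G"
    and q_closed: "f \<in> G \<Longrightarrow> g \<in> G \<Longrightarrow> q f g \<in> K"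
    and q_add: "f \<in> G \<Longrightarrow> g \<in> G \<Longrightarrow> h \<in> G \<Longrightarrow> q (f + g) h = q f h + q g h"
    and q_scale: "c \<in> K \<Longrightarrow> f \<in> G \<Longrightarrow> g \<in> G \<Longrightarrow> q (\<lambda>x. c * f x) g = c * q f g"
    and q_commute: "f \<in> G \<Longrightarrow> g \<in> G \<Longrightarrow> q g f = cnj (q f g)"
    and q_nonneg: "f \<in> G \<Longrightarrow> 0 \<le> Re (q f f)"
begin

lemma K_closed: "0 \<in> K" "1 \<in> K" "- 1 \<in> K" "c \<in> K \<Longrightarrow> d \<in> K \<Longrightarrow> c + d \<in> K"
  "c \<in> K \<Longrightarrow> d \<in> K \<Longrightarrow> c * d \<in> K" "c \<in> K \<Longrightarrow> - c \<in> K" "of_real r \<in> K"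
  using K by auto

lemma K_limit:
  assumes "\<And>k. s k \<in> K" "s \<longlonglongrightarrow> l"
  shows "l \<in> K"
  using K
proof
  assume "K = \<real>"
  hence "(\<lambda>k. Im (s k)) = (\<lambda>_. 0)" using assms(1) by (simp add: complex_is_Real_iff)
  hence "Im l = 0" using tendsto_Im[OF assms(2)] LIMSEQ_unique[OF tendsto_const] by metis
  thus ?thesis using \<open>K = \<real>\<close> by (simp add: complex_is_Real_iff)
qed auto

lemma diff_closed: "f \<in> G \<Longrightarrow> g \<in> G \<Longrightarrow> f - g \<in> G"
  using add_closed[OF _ scale_closed[OF K_closed(3)], of f g] by (simp add: fun_diff_def plus_fun_def)

lemma q_diff: "f \<in> G \<Longrightarrow> g \<in> G \<Longrightarrow> h \<in> G \<Longrightarrow> q (f - g) h = q f h - q g h"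
  using q_add[of "f - g" g h] diff_closed[of f g] by simp

lemma q_add_right: "f \<in> G \<Longrightarrow> g \<in> G \<Longrightarrow> h \<in> G \<Longrightarrow> q h (f + g) = q h f + q h g"
  using q_commute[of "f + g" h] q_commute[of f h] q_commute[of g h] by (simp add: q_add add_closed)

lemma q_diff_right: "f \<in> G \<Longrightarrow> g \<in> G \<Longrightarrow> h \<in> G \<Longrightarrow> q h (f - g) = q h f - q h g"
  using q_add_right[of "f - g" g h] diff_closed[of f g] by simp

lemma q_scale_right: "c \<in> K \<Longrightarrow> f \<in> G \<Longrightarrow> g \<in> G \<Longrightarrow> q f (\<lambda>x. c * g x) = cnj c * q f g"
  using q_commute[of "\<lambda>x. c * g x" f] q_commute[of g f] by (simp add: q_scale scale_closed)

lemma q_zero: "f \<in> G \<Longrightarrow> q 0 f = 0"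
  using q_add[of 0 0 f] zero_closed by simp

lemma q_self: "f \<in> G \<Longrightarrow> q f f = of_real (Re (q f f))"
  using arg_cong[OF q_commute[of f f], of Im] by (simp add: complex_eq_iff)

definition nrm :: "('f \<Rightarrow> complex) \<Rightarrow> real" where
  "nrm f = sqrt (Re (q f f))"

lemma nrm_nonneg: "f \<in> G \<Longrightarrow> 0 \<le> nrm f"
  by (simp add: nrm_def q_nonneg)

lemma cauchy_schwarz:
  assumes f: "f \<in> G" and g: "g \<in> G"
  shows "cmod (q f g) \<le> nrm f * nrm g"
proof -
  define p where "p = q f g"
  define a where "a = Re (q f f)"
  define b where "b = Re (q g g)"
  have gf: "q g f = cnj p" and ff: "q f f = of_real a" and gg: "q g g = of_real b" and fg: "q f g = p"
    unfolding p_def a_def b_def by (rule q_commute[OF f g] q_self[OF f] q_self[OF g] refl)+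
  have a0: "0 \<le> a" and b0: "0 \<le> b" using q_nonneg f g by (auto simp: a_def b_def)
  \<comment> \<open>The vector tested is \<open>f - t p g\<close>; the factor \<open>p\<close> turns
    both cross terms into \<open>(cmod p)\<^sup>2\<close>, so that real \<open>t\<close> suffice
    over either field.\<close>
  have quad: "0 \<le> a - 2 * t * (cmod p)\<^sup>2 + t\<^sup>2 * (cmod p)\<^sup>2 * b" for t :: real
  proof -
    have c: "- (of_real t * p) \<in> K" using q_closed[OF f g] by (auto intro!: K_closed simp: p_def)
    let ?h = "f + (\<lambda>x. - (of_real t * p) * g x)"
    have sg: "(\<lambda>x. - (of_real t * p) * g x) \<in> G" by (rule scale_closed[OF c g])
    have "q ?h ?h = q f f + cnj (- (of_real t * p)) * q f g
        + (- (of_real t * p)) * (q g f + cnj (- (of_real t * p)) * q g g)"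
      using f g sg c by (simp only: q_add q_add_right q_scale q_scale_right add_closed)
        (simp add: algebra_simps)
    also have "\<dots> = of_real a - 2 * of_real t * (p * cnj p) + (of_real t)\<^sup>2 * (p * cnj p) * of_real b"
      by (simp add: gf ff gg fg power2_eq_square algebra_simps)
    also have "\<dots> = of_real (a - 2 * t * (cmod p)\<^sup>2 + t\<^sup>2 * (cmod p)\<^sup>2 * b)"
      by (simp add: complex_norm_square[symmetric])
    finally show ?thesis using q_nonneg[OF add_closed[OF f sg]] by simp
  qed
  have "(cmod p)\<^sup>2 \<le> a * b"
  proof (cases "b = 0")
    case True
    \<comment> \<open>Degenerate case: for \<open>b = 0\<close> the quadratic is affine in
      \<open>t\<close>, and the chosen \<open>t\<close> would give it the value
      \<open>- 1\<close>.\<close>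
    have "p = 0"
    proof (rule ccontr)
      assume "p \<noteq> 0"
      thus False using quad[of "(a + 1) / (2 * (cmod p)\<^sup>2)"] True by (simp add: field_simps)
    qed
    thus ?thesis using True by simp
  next
    case False
    hence "0 \<le> a - (cmod p)\<^sup>2 / b"
      using quad[of "1 / b"] by (simp add: power2_eq_square field_simps)
    thus ?thesis using False b0 by (simp add: field_simps)
  qed
  hence "cmod p \<le> sqrt (a * b)" by (rule real_le_rsqrt)
  thus ?thesis by (simp add: nrm_def p_def a_def b_def real_sqrt_mult)
qed

lemma nrm_triangle:
  assumes f: "f \<in> G" and g: "g \<in> G"
  shows "nrm (f + g) \<le> nrm f + nrm g"
proof -
  have "Re (q (f + g) (f + g)) = Re (q f f) + Re (q g g) + 2 * Re (q f g)"
    using q_commute[OF f g] f g by (simp add: q_add q_add_right add_closed)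
  also have "\<dots> \<le> Re (q f f) + Re (q g g) + 2 * (nrm f * nrm g)"
    using cauchy_schwarz[OF f g] complex_Re_le_cmod[of "q f g"] by simp
  also have "\<dots> = (nrm f + nrm g)\<^sup>2" using f g by (simp add: power2_sum nrm_def q_nonneg)
  finally show ?thesis
    unfolding nrm_def[of "f + g"] using nrm_nonneg f g by (intro real_le_lsqrt) (auto simp: q_nonneg add_closed)
qed

definition cauchy_seq :: "(nat \<Rightarrow> 'f \<Rightarrow> complex) \<Rightarrow> bool" where
  "cauchy_seq s \<longleftrightarrow> (\<forall>k. s k \<in> G) \<and> (\<forall>e>0. \<exists>N. \<forall>j\<ge>N. \<forall>k\<ge>N. nrm (s j - s k) < e)"

lemma cauchy_seqD:
  assumes "cauchy_seq s"
  shows "s k \<in> G" and "0 < e \<Longrightarrow> \<exists>N. \<forall>j\<ge>N. \<forall>k\<ge>N. nrm (s j - s k) < e"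
  using assms by (auto simp: cauchy_seq_def)

lemma cauchy_seq_const: "f \<in> G \<Longrightarrow> cauchy_seq (\<lambda>_. f)"
  using q_zero[OF zero_closed] by (simp add: cauchy_seq_def nrm_def)

lemma cauchy_seq_add:
  assumes s: "cauchy_seq s" and t: "cauchy_seq t"
  shows "cauchy_seq (\<lambda>k. s k + t k)"
  unfolding cauchy_seq_def
proof (intro conjI allI impI)
  fix e :: real assume e: "0 < e"
  obtain M N where *: "\<forall>j\<ge>M. \<forall>k\<ge>M. nrm (s j - s k) < e / 2" "\<forall>j\<ge>N. \<forall>k\<ge>N. nrm (t j - t k) < e / 2"
    using cauchy_seqD(2)[OF s, of "e/2"] cauchy_seqD(2)[OF t, of "e/2"] e by auto
  have "nrm (s j + t j - (s k + t k)) < e" if "j \<ge> max M N" "k \<ge> max M N" for j k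
  proof -
    have eq: "s j + t j - (s k + t k) = (s j - s k) + (t j - t k)" by simp
    have "nrm ((s j - s k) + (t j - t k)) \<le> nrm (s j - s k) + nrm (t j - t k)"
      by (intro nrm_triangle diff_closed cauchy_seqD(1)[OF s] cauchy_seqD(1)[OF t])
    moreover have "nrm (s j - s k) < e / 2" "nrm (t j - t k) < e / 2" using * that by auto
    ultimately show ?thesis unfolding eq by linarith
  qed
  thus "\<exists>N. \<forall>j\<ge>N. \<forall>k\<ge>N. nrm (s j + t j - (s k + t k)) < e" by blast
qed (use cauchy_seqD(1) s t add_closed in auto)

lemma nrm_scale: "c \<in> K \<Longrightarrow> f \<in> G \<Longrightarrow> nrm (\<lambda>x. c * f x) = cmod c * nrm f"
proof -
  assume c: "c \<in> K" and f: "f \<in> G"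
  have "q (\<lambda>x. c * f x) (\<lambda>x. c * f x) = (c * cnj c) * q f f"
    using c f by (simp add: q_scale q_scale_right scale_closed)
  also have "\<dots> = of_real ((cmod c)\<^sup>2 * Re (q f f))"
    by (subst q_self[OF f]) (simp add: complex_norm_square[symmetric])
  finally show ?thesis by (simp add: nrm_def real_sqrt_mult)
qed

lemma cauchy_seq_scale:
  assumes c: "c \<in> K" and s: "cauchy_seq s"
  shows "cauchy_seq (\<lambda>k x. c * s k x)"
  unfolding cauchy_seq_def
proof (intro conjI allI impI)
  fix e :: real assume e: "0 < e"
  have pos: "0 < cmod c + 1" by (simp add: add_nonneg_pos)
  obtain N where N: "\<forall>j\<ge>N. \<forall>k\<ge>N. nrm (s j - s k) < e / (cmod c + 1)"
    using cauchy_seqD(2)[OF s, of "e / (cmod c + 1)"] e pos by auto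
  have "nrm ((\<lambda>x. c * s j x) - (\<lambda>x. c * s k x)) < e" if "j \<ge> N" "k \<ge> N" for j k
  proof -
    have d: "s j - s k \<in> G" using cauchy_seqD(1)[OF s] diff_closed by blast
    have "(\<lambda>x. c * s j x) - (\<lambda>x. c * s k x) = (\<lambda>x. c * (s j - s k) x)"
      by (simp add: fun_eq_iff algebra_simps)
    hence "nrm ((\<lambda>x. c * s j x) - (\<lambda>x. c * s k x)) = cmod c * nrm (s j - s k)"
      using nrm_scale[OF c d] by simp
    also have "\<dots> \<le> (cmod c + 1) * nrm (s j - s k)" using nrm_nonneg[OF d] by (simp add: mult_right_mono)
    also have "\<dots> < e" using N that pos by (simp add: field_simps)
    finally show ?thesis .
  qed
  thus "\<exists>N. \<forall>j\<ge>N. \<forall>k\<ge>N. nrm ((\<lambda>x. c * s j x) - (\<lambda>x. c * s k x)) < e" by blast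
qed (use cauchy_seqD(1)[OF s] scale_closed[OF c] in auto)

lemma cauchy_seq_diff: "cauchy_seq s \<Longrightarrow> cauchy_seq t \<Longrightarrow> cauchy_seq (\<lambda>k. s k - t k)"
  using cauchy_seq_add[OF _ cauchy_seq_scale[OF K_closed(3)], of s t]
  by (simp add: plus_fun_def fun_diff_def)

lemma cauchy_seq_bounded:
  assumes s: "cauchy_seq s"
  obtains B where "0 < B" "\<And>k. nrm (s k) \<le> B"
proof -
  obtain N where N: "\<forall>j\<ge>N. \<forall>k\<ge>N. nrm (s j - s k) < 1" using cauchy_seqD(2)[OF s, of 1] by auto
  define B where "B = (\<Sum>k\<le>N. nrm (s k)) + 1"
  have nn: "0 \<le> nrm (s k)" for k using nrm_nonneg cauchy_seqD(1)[OF s] by blast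
  have le: "nrm (s k) \<le> (\<Sum>k\<le>N. nrm (s k))" if "k \<le> N" for k
    by (rule member_le_sum) (use that nn in auto)
  have "nrm (s k) \<le> B" for k
  proof (cases "k \<le> N")
    case False
    have "nrm (s k) \<le> nrm (s k - s N) + nrm (s N)"
      using nrm_triangle[of "s k - s N" "s N"] cauchy_seqD(1)[OF s] diff_closed by simp
    moreover have "nrm (s k - s N) < 1" using N False by simp
    ultimately show ?thesis using le[of N] by (simp add: B_def)
  qed (use le in \<open>fastforce simp: B_def\<close>)
  moreover have "0 < B" unfolding B_def by (intro add_nonneg_pos sum_nonneg) (auto simp: nn)
  ultimately show ?thesis using that by blast
qed

lemma q_convergent:
  assumes s: "cauchy_seq s" and t: "cauchy_seq t"
  shows "convergent (\<lambda>k. q (s k) (t k))"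
proof -
  obtain B where B: "0 < B" "\<And>k. nrm (s k) \<le> B" using cauchy_seq_bounded[OF s] by blast
  obtain C where C: "0 < C" "\<And>k. nrm (t k) \<le> C" using cauchy_seq_bounded[OF t] by blast
  have sG: "s k \<in> G" and tG: "t k \<in> G" for k using cauchy_seqD(1) s t by auto
  have "Cauchy (\<lambda>k. q (s k) (t k))"
  proof (rule CauchyI)
    fix e :: real assume e: "0 < e"
    obtain M N where *: "\<forall>j\<ge>M. \<forall>k\<ge>M. nrm (s j - s k) < e / (2 * C)" "\<forall>j\<ge>N. \<forall>k\<ge>N. nrm (t j - t k) < e / (2 * B)"
      using cauchy_seqD(2)[OF s, of "e/(2 * C)"] cauchy_seqD(2)[OF t, of "e/(2 * B)"] e B C by auto
    have "cmod (q (s j) (t j) - q (s k) (t k)) < e" if "j \<ge> max M N" "k \<ge> max M N" for j k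
    proof -
      have ds: "nrm (s j - s k) < e / (2 * C)" and dt: "nrm (t j - t k) < e / (2 * B)" using * that by auto
      have "cmod (q (s j) (t j) - q (s k) (t k)) = cmod (q (s j - s k) (t j) + q (s k) (t j - t k))"
        by (simp add: q_diff q_diff_right sG tG diff_closed)
      hence le: "cmod (q (s j) (t j) - q (s k) (t k)) \<le>
          nrm (s j - s k) * nrm (t j) + nrm (s k) * nrm (t j - t k)"
        using norm_triangle_ineq[of "q (s j - s k) (t j)" "q (s k) (t j - t k)"]
          cauchy_schwarz[OF diff_closed[OF sG[of j] sG[of k]] tG[of j]]
          cauchy_schwarz[OF sG[of k] diff_closed[OF tG[of j] tG[of k]]] by linarith
      have "nrm (s j - s k) * nrm (t j) \<le> nrm (s j - s k) * C"
        by (rule mult_left_mono[OF C(2) nrm_nonneg[OF diff_closed[OF sG sG]]])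
      moreover have "nrm (s k) * nrm (t j - t k) \<le> B * nrm (t j - t k)"
        by (rule mult_right_mono[OF B(2) nrm_nonneg[OF diff_closed[OF tG tG]]])
      moreover have "nrm (s j - s k) * C < e / 2" using ds C(1) by (simp add: field_simps)
      moreover have "B * nrm (t j - t k) < e / 2" using dt B(1) by (simp add: field_simps)
      ultimately show ?thesis using le by linarith
    qed
    thus "\<exists>M. \<forall>m\<ge>M. \<forall>n\<ge>M. cmod (q (s m) (t m) - q (s n) (t n)) < e" by blast
  qed
  thus ?thesis by (rule Cauchy_convergent)
qed

definition qlim :: "(nat \<Rightarrow> 'f \<Rightarrow> complex) \<Rightarrow> (nat \<Rightarrow> 'f \<Rightarrow> complex) \<Rightarrow> complex" where
  "qlim s t = lim (\<lambda>k. q (s k) (t k))"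

lemma qlim: "cauchy_seq s \<Longrightarrow> cauchy_seq t \<Longrightarrow> (\<lambda>k. q (s k) (t k)) \<longlonglongrightarrow> qlim s t"
  unfolding qlim_def using q_convergent by (simp add: convergent_LIMSEQ_iff)

lemma qlim_eqI: "(\<lambda>k. q (s k) (t k)) \<longlonglongrightarrow> l \<Longrightarrow> qlim s t = l"
  unfolding qlim_def by (rule limI)

lemma qlim_add: "cauchy_seq s \<Longrightarrow> cauchy_seq s' \<Longrightarrow> cauchy_seq t \<Longrightarrow>
    qlim (\<lambda>k. s k + s' k) t = qlim s t + qlim s' t"
  by (rule qlim_eqI) (simp add: q_add cauchy_seqD(1) tendsto_add qlim)

lemma qlim_diff: "cauchy_seq s \<Longrightarrow> cauchy_seq s' \<Longrightarrow> cauchy_seq t \<Longrightarrow>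
    qlim (\<lambda>k. s k - s' k) t = qlim s t - qlim s' t"
  by (rule qlim_eqI) (simp add: q_diff cauchy_seqD(1) tendsto_diff qlim)

lemma qlim_scale: "c \<in> K \<Longrightarrow> cauchy_seq s \<Longrightarrow> cauchy_seq t \<Longrightarrow> qlim (\<lambda>k x. c * s k x) t = c * qlim s t"
  by (rule qlim_eqI) (simp add: q_scale cauchy_seqD(1) tendsto_mult_left qlim)

lemma qlim_commute: "cauchy_seq s \<Longrightarrow> cauchy_seq t \<Longrightarrow> qlim t s = cnj (qlim s t)"
  using tendsto_cnj[OF qlim[of s t]] by (intro qlim_eqI) (simp add: q_commute[of "s _" "t _"] cauchy_seqD(1))

lemma qlim_closed: "cauchy_seq s \<Longrightarrow> cauchy_seq t \<Longrightarrow> qlim s t \<in> K"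
  by (rule K_limit[OF _ qlim]) (auto simp: q_closed cauchy_seqD(1))

lemma nrm_tendsto: "cauchy_seq s \<Longrightarrow> (\<lambda>k. nrm (s k)) \<longlonglongrightarrow> sqrt (Re (qlim s s))"
  unfolding nrm_def by (intro tendsto_real_sqrt tendsto_Re qlim)

lemma qlim_nonneg: "cauchy_seq s \<Longrightarrow> 0 \<le> Re (qlim s s)"
  by (rule LIMSEQ_le_const[OF tendsto_Re[OF qlim]]) (auto simp: q_nonneg cauchy_seqD(1))

text \<open>Riesz-type encoding: a Cauchy sequence is represented by its limiting inner products
  with the vectors of \<open>G\<close>. Sequences at distance zero give the same functional, so the
  functional itself is the equivalence class, and the operations are pointwise.\<close>

definition emb :: "(nat \<Rightarrow> 'f \<Rightarrow> complex) \<Rightarrow> ('f \<Rightarrow> complex) \<Rightarrow> complex" where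
  "emb s = (\<lambda>w\<in>G. qlim s (\<lambda>_. w))"

text \<open>\<open>G\<close> is dense: replacing \<open>t k\<close> by a late fixed term
  \<open>t N\<close> costs at most \<open>B * nrm (t k - t N)\<close>, and against the fixed vector
  \<open>t N\<close> the limit is 0. Hence the limiting inner product of two sequences depends only
  on their functionals.\<close>

lemma qlim_eq_zero_of_emb:
  assumes d: "cauchy_seq d" and t: "cauchy_seq t" and 0: "\<And>w. w \<in> G \<Longrightarrow> qlim d (\<lambda>_. w) = 0"
  shows "qlim d t = 0"
proof (rule qlim_eqI, rule LIMSEQ_I)
  fix e :: real assume e: "0 < e"
  obtain B where B: "0 < B" "\<And>k. nrm (d k) \<le> B" using cauchy_seq_bounded[OF d] by blast
  obtain N where N: "\<forall>j\<ge>N. \<forall>k\<ge>N. nrm (t j - t k) < e / (2 * B)"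
    using cauchy_seqD(2)[OF t, of "e/(2 * B)"] e B by auto
  have dG: "d k \<in> G" and tG: "t k \<in> G" for k using cauchy_seqD(1) d t by auto
  have "(\<lambda>k. q (d k) (t N)) \<longlonglongrightarrow> 0"
    using qlim[OF d cauchy_seq_const[OF tG]] 0[OF tG] by simp
  then obtain M where M: "\<forall>k\<ge>M. cmod (q (d k) (t N)) < e / 2" using LIMSEQ_D[of _ 0 "e/2"] e by fastforce
  have "norm (q (d k) (t k) - 0) < e" if "k \<ge> max M N" for k
  proof -
    have "cmod (q (d k) (t k - t N)) \<le> nrm (d k) * nrm (t k - t N)"
      by (rule cauchy_schwarz[OF dG diff_closed[OF tG tG]])
    also have "\<dots> \<le> B * nrm (t k - t N)" by (rule mult_right_mono[OF B(2) nrm_nonneg[OF diff_closed[OF tG tG]]])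
    also have "\<dots> < B * (e / (2 * B))" by (rule mult_strict_left_mono[OF _ B(1)]) (use N that in auto)
    also have "\<dots> = e / 2" using B by simp
    finally have "cmod (q (d k) (t k - t N)) < e / 2" .
    moreover have "q (d k) (t k) = q (d k) (t N) + q (d k) (t k - t N)"
      by (simp add: q_diff_right dG tG)
    ultimately show ?thesis using M[rule_format, of k] that norm_triangle_ineq[of "q (d k) (t N)" "q (d k) (t k - t N)"] by simp
  qed
  thus "\<exists>N. \<forall>k\<ge>N. norm (q (d k) (t k) - 0) < e" by blast
qed

lemma qlim_cong_emb:
  assumes s: "cauchy_seq s" "cauchy_seq s'" "cauchy_seq t" and eq: "emb s = emb s'"
  shows "qlim s t = qlim s' t"
proof -
  have "qlim (\<lambda>k. s k - s' k) (\<lambda>_. w) = 0" if "w \<in> G" for w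
    using fun_cong[OF eq, of w] that s by (simp add: emb_def qlim_diff cauchy_seq_const)
  from qlim_eq_zero_of_emb[OF cauchy_seq_diff[OF s(1,2)] s(3) this] show ?thesis
    using s by (simp add: qlim_diff)
qed

definition rep :: "(('f \<Rightarrow> complex) \<Rightarrow> complex) \<Rightarrow> nat \<Rightarrow> 'f \<Rightarrow> complex" where
  "rep u = (SOME s. cauchy_seq s \<and> emb s = u)"

definition completion_ip :: "(('f \<Rightarrow> complex) \<Rightarrow> complex) \<Rightarrow> (('f \<Rightarrow> complex) \<Rightarrow> complex) \<Rightarrow> complex" where
  "completion_ip u v = qlim (rep u) (rep v)"

definition completion :: "(('f \<Rightarrow> complex) \<Rightarrow> complex) nspace" where
  "completion = \<lparr>carrier = emb ` {s. cauchy_seq s}, mult = undefined, one = undefined,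
     zero = (\<lambda>w\<in>G. 0), add = (\<lambda>u v. \<lambda>w\<in>G. u w + v w), smult = (\<lambda>c u. \<lambda>w\<in>G. c * u w),
     vnorm = (\<lambda>u. sqrt (Re (completion_ip u u)))\<rparr>"

lemma completion_ip_emb:
  assumes "cauchy_seq s" "cauchy_seq t"
  shows "completion_ip (emb s) (emb t) = qlim s t"
proof -
  have rep: "cauchy_seq (rep (emb s)) \<and> emb (rep (emb s)) = emb s" if "cauchy_seq s" for s
    unfolding rep_def by (rule someI[of _ s]) (use that in auto)
  have "qlim (rep (emb s)) (rep (emb t)) = qlim s (rep (emb t))"
    by (rule qlim_cong_emb) (use rep assms in auto)
  also have "\<dots> = cnj (qlim (rep (emb t)) s)" by (rule qlim_commute) (use rep assms in auto)
  also have "qlim (rep (emb t)) s = qlim t s" by (rule qlim_cong_emb) (use rep assms in auto)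
  also have "cnj \<dots> = qlim s t" using qlim_commute[OF assms] by simp
  finally show ?thesis by (simp add: completion_ip_def)
qed

lemma emb_add: "cauchy_seq s \<Longrightarrow> cauchy_seq t \<Longrightarrow> emb s \<oplus>\<^bsub>completion\<^esub> emb t = emb (\<lambda>k. s k + t k)"
  by (auto simp: completion_def emb_def fun_eq_iff qlim_add cauchy_seq_const)

lemma emb_scale: "c \<in> K \<Longrightarrow> cauchy_seq s \<Longrightarrow> c \<odot>\<^bsub>completion\<^esub> emb s = emb (\<lambda>k x. c * s k x)"
  by (auto simp: completion_def emb_def fun_eq_iff qlim_scale cauchy_seq_const)

lemma emb_zero: "\<zero>\<^bsub>completion\<^esub> = emb (\<lambda>_. 0)"
proof -
  have "qlim (\<lambda>_. 0) (\<lambda>_. w) = 0" if "w \<in> G" for w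
    by (rule qlim_eqI) (simp add: q_zero that)
  thus ?thesis by (auto simp: completion_def emb_def)
qed

lemma emb_in_completion: "cauchy_seq s \<Longrightarrow> emb s \<in> carrier completion"
  by (simp add: completion_def)

lemma completion_cases:
  assumes "u \<in> carrier completion"
  obtains s where "cauchy_seq s" "u = emb s"
  using assms by (auto simp: completion_def)

lemma cauchy_seq_zero: "cauchy_seq (\<lambda>_. 0)"
  by (rule cauchy_seq_const[OF zero_closed])

lemma module_completion: "module (scalar_space K) completion"
proof -
  have ops: "u \<oplus>\<^bsub>completion\<^esub> v = (\<lambda>w\<in>G. u w + v w)" "c \<odot>\<^bsub>completion\<^esub> u = (\<lambda>w\<in>G. c * u w)"
    "\<zero>\<^bsub>completion\<^esub> = (\<lambda>w\<in>G. 0)" for u v c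
    by (simp_all add: completion_def)
  have ext: "restrict u G = u" if "u \<in> carrier completion" for u
    using that by (auto simp: completion_def emb_def)
  have add: "u \<oplus>\<^bsub>completion\<^esub> v \<in> carrier completion"
    if "u \<in> carrier completion" "v \<in> carrier completion" for u v
    using that by (auto elim!: completion_cases simp: emb_add intro!: emb_in_completion cauchy_seq_add)
  have smult: "c \<odot>\<^bsub>completion\<^esub> u \<in> carrier completion" if "c \<in> K" "u \<in> carrier completion" for u c
    using that by (auto elim!: completion_cases simp: emb_scale intro!: emb_in_completion cauchy_seq_scale)
  have zero: "\<zero>\<^bsub>completion\<^esub> \<in> carrier completion"
    unfolding emb_zero by (rule emb_in_completion[OF cauchy_seq_zero])
  have "abelian_group completion"
  proof (rule abelian_groupI)
    fix u assume u: "u \<in> carrier completion"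
    show "\<zero>\<^bsub>completion\<^esub> \<oplus>\<^bsub>completion\<^esub> u = u" using ext[OF u] by (simp add: ops cong: restrict_cong)
    show "\<exists>v\<in>carrier completion. v \<oplus>\<^bsub>completion\<^esub> u = \<zero>\<^bsub>completion\<^esub>"
      by (rule bexI[OF _ smult[OF K_closed(3) u]]) (auto simp: ops restrict_def)
  qed (use add zero in \<open>auto simp: ops algebra_simps restrict_def\<close>)
  moreover have "\<one>\<^bsub>scalar_space K\<^esub> \<odot>\<^bsub>completion\<^esub> u = u" if "u \<in> carrier completion" for u
    using ext[OF that] by (simp add: ops scalar_space_def)
  ultimately show ?thesis
    by (intro moduleI cring_scalar_space K)
      (auto simp: scalar_space_def smult, auto simp: ops algebra_simps restrict_def)
qed

lemma inner_product_completion: "inner_product K completion completion_ip"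
proof (intro inner_product.intro module_completion inner_product_axioms.intro)
  fix u v assume "u \<in> carrier completion" "v \<in> carrier completion"
  then obtain s t where *: "cauchy_seq s" "u = emb s" "cauchy_seq t" "v = emb t"
    by (metis completion_cases)
  show "completion_ip u v \<in> K" "completion_ip v u = cnj (completion_ip u v)"
    using * qlim_commute[OF *(1,3)] by (simp_all only: completion_ip_emb qlim_closed)
  show "completion_ip (c \<odot>\<^bsub>completion\<^esub> u) v = c * completion_ip u v" if "c \<in> K" for c
    using * that by (simp add: completion_ip_emb emb_scale qlim_scale cauchy_seq_scale)
next
  fix u v w assume "u \<in> carrier completion" "v \<in> carrier completion" "w \<in> carrier completion"
  then obtain s t r where *: "cauchy_seq s" "u = emb s" "cauchy_seq t" "v = emb t" "cauchy_seq r" "w = emb r"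
    by (metis completion_cases)
  thus "completion_ip (u \<oplus>\<^bsub>completion\<^esub> v) w = completion_ip u w + completion_ip v w"
    by (simp add: completion_ip_emb emb_add qlim_add cauchy_seq_add)
next
  fix u assume "u \<in> carrier completion"
  then obtain s where *: "cauchy_seq s" "u = emb s" by (metis completion_cases)
  show "0 \<le> Re (completion_ip u u)" using * by (simp add: completion_ip_emb qlim_nonneg)
  assume "completion_ip u u = 0"
  hence 0: "(\<lambda>k. nrm (s k)) \<longlonglongrightarrow> 0" using nrm_tendsto[OF *(1)] * by (simp add: completion_ip_emb)
  \<comment> \<open>Definiteness: by Cauchy-Schwarz a sequence whose norms tend to 0 has vanishing
    limiting products with all of \<open>G\<close>, so its functional is 0.\<close>
  have "qlim s (\<lambda>_. w) = 0" if w: "w \<in> G" for w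
  proof (rule qlim_eqI, rule tendsto_0_le[OF 0, of _ "nrm w"])
    show "\<forall>\<^sub>F k in sequentially. cmod (q (s k) w) \<le> norm (nrm (s k)) * nrm w"
      using cauchy_schwarz[OF cauchy_seqD(1)[OF *(1)] w] nrm_nonneg[OF cauchy_seqD(1)[OF *(1)]] by simp
  qed
  thus "u = \<zero>\<^bsub>completion\<^esub>" using * by (auto simp: completion_def emb_def)
qed

lemma emb_minus:
  assumes s: "cauchy_seq s" and t: "cauchy_seq t"
  shows "emb s \<ominus>\<^bsub>completion\<^esub> emb t = emb (\<lambda>k. s k - t k)"
proof -
  interpret C: module "scalar_space K" completion by (rule module_completion)
  have "emb (\<lambda>k. s k - t k) \<oplus>\<^bsub>completion\<^esub> emb t = emb s"
    by (subst emb_add) (use s t cauchy_seq_diff in auto)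
  moreover have "emb (\<lambda>k. s k - t k) \<in> carrier completion" "emb t \<in> carrier completion"
    using s t cauchy_seq_diff emb_in_completion by auto
  moreover from this have "(emb (\<lambda>k. s k - t k) \<oplus>\<^bsub>completion\<^esub> emb t) \<ominus>\<^bsub>completion\<^esub> emb t = emb (\<lambda>k. s k - t k)"
    by (simp add: a_minus_def C.a_assoc C.r_neg)
  ultimately show ?thesis by simp
qed

lemma vnorm_emb: "cauchy_seq s \<Longrightarrow> vnorm completion (emb s) = sqrt (Re (qlim s s))"
  by (simp add: completion_def flip: completion_ip_emb)

text \<open>Completeness by a diagonal choice: \<open>u k\<close> is approximated within
  \<open>1 / Suc k\<close> by a vector \<open>w k\<close> of \<open>G\<close>; the sequence
  \<open>w\<close> is then Cauchy in \<open>G\<close>, and its own class \<open>emb w\<close> is the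
  limit.\<close>

lemma hilbert_space_completion: "hilbert_space K completion"
proof -
  interpret C: inner_product K completion completion_ip by (rule inner_product_completion)
  have norm: "vnorm completion u = sqrt (Re (completion_ip u u))" for u by (simp add: completion_def)
  interpret N: normed_space K completion
    by (rule C.normed_space_of_inner_product[OF K norm])
  let ?d = "\<lambda>u v. vnorm completion (u \<ominus>\<^bsub>completion\<^esub> v)"
  have near: "\<exists>w\<in>G. ?d u (emb (\<lambda>_. w)) \<le> e"
    if u: "u \<in> carrier completion" and e: "0 < e" for u and e :: real
  proof -
    obtain s where s: "cauchy_seq s" "u = emb s" using completion_cases[OF u] by blast
    obtain N where N: "\<forall>j\<ge>N. \<forall>k\<ge>N. nrm (s j - s k) < e" using cauchy_seqD(2)[OF s(1) e] by blast
    have sN: "s N \<in> G" using cauchy_seqD(1)[OF s(1)] .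
    let ?t = "\<lambda>k. s k - s N"
    have d: "cauchy_seq ?t" by (rule cauchy_seq_diff[OF s(1) cauchy_seq_const[OF sN]])
    have "vnorm completion (emb ?t) \<le> e"
      unfolding vnorm_emb[OF d] by (rule LIMSEQ_le_const2[OF nrm_tendsto[OF d]]) (use N less_imp_le in blast)
    thus ?thesis
      by (intro bexI[OF _ sN]) (simp only: s(2) emb_minus[OF s(1) cauchy_seq_const[OF sN]])
  qed
  have tri: "?d u w \<le>
      ?d u v + ?d v w"
    if "u \<in> carrier completion" "v \<in> carrier completion" "w \<in> carrier completion" for u v w
  proof -
    have "u \<ominus>\<^bsub>completion\<^esub> w = (u \<ominus>\<^bsub>completion\<^esub> v) \<oplus>\<^bsub>completion\<^esub> (v \<ominus>\<^bsub>completion\<^esub> w)"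
      using that by (elim completion_cases) (simp add: emb_minus emb_add cauchy_seq_diff)
    thus ?thesis using N.norm_triangle[of "u \<ominus>\<^bsub>completion\<^esub> v" "v \<ominus>\<^bsub>completion\<^esub> w"] that by simp
  qed
  have sym: "?d u v = ?d v u"
    if "u \<in> carrier completion" "v \<in> carrier completion" for u v
    using that by (simp add: norm C.ip_minus_left C.ip_minus_right)
  have "banach_space K completion"
  proof (intro banach_space.intro N.normed_space_axioms banach_space_axioms.intro)
    fix u :: "nat \<Rightarrow> ('f \<Rightarrow> complex) \<Rightarrow> complex"
    assume u: "\<And>k. u k \<in> carrier completion"
      and cau: "\<And>e. 0 < e \<Longrightarrow> \<exists>N. \<forall>j\<ge>N. \<forall>k\<ge>N. ?d (u j) (u k) < e"
    have "\<forall>k. \<exists>w\<in>G. ?d (u k) (emb (\<lambda>_. w)) \<le> 1 / Suc k"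
      using near[OF u] by simp
    then obtain w where wG: "\<And>k. w k \<in> G"
      and w: "\<And>k. ?d (u k) (emb (\<lambda>_. w k)) \<le> 1 / Suc k" by metis
    have ew: "emb (\<lambda>_. w k) \<in> carrier completion" for k
      by (rule emb_in_completion[OF cauchy_seq_const[OF wG]])
    have eww: "?d (emb (\<lambda>_. w j)) (emb (\<lambda>_. w k)) = nrm (w j - w k)" for j k
    proof -
      have d: "cauchy_seq (\<lambda>_. w j - w k)" by (rule cauchy_seq_const[OF diff_closed[OF wG wG]])
      have "qlim (\<lambda>_. w j - w k) (\<lambda>_. w j - w k) = q (w j - w k) (w j - w k)"
        by (rule qlim_eqI) simp
      thus ?thesis by (simp add: emb_minus cauchy_seq_const wG vnorm_emb[OF d] nrm_def)
    qed
    have inv0: "(\<lambda>k. 1 / real (Suc k)) \<longlonglongrightarrow> 0" using LIMSEQ_inverse_real_of_nat by (simp add: inverse_eq_divide)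
    have wc: "cauchy_seq w"
      unfolding cauchy_seq_def
    proof (intro conjI allI impI wG)
      fix e :: real assume e: "0 < e"
      obtain N where N: "\<forall>j\<ge>N. \<forall>k\<ge>N. ?d (u j) (u k) < e / 3" using cau[of "e/3"] e by auto
      obtain M where M: "\<And>k. k \<ge> M \<Longrightarrow> 1 / real (Suc k) < e / 3"
        using LIMSEQ_D[OF inv0, of "e/3"] e by auto
      have "nrm (w j - w k) < e" if jk: "j \<ge> max M N" "k \<ge> max M N" for j k
      proof -
        have "nrm (w j - w k) \<le> ?d (emb (\<lambda>_. w j)) (u j) +
            (?d (u j) (u k) + ?d (u k) (emb (\<lambda>_. w k)))"
          using tri[OF ew[of j] u[of j] ew[of k]] tri[OF u[of j] u[of k] ew[of k]] eww[of j k] by linarith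
        moreover have "?d (emb (\<lambda>_. w j)) (u j) < e / 3"
          using sym[OF ew u] w[of j] M[of j] jk by fastforce
        moreover have "?d (u k) (emb (\<lambda>_. w k)) < e / 3"
          using w[of k] M[of k] jk by fastforce
        moreover have "?d (u j) (u k) < e / 3" using N jk by simp
        ultimately show ?thesis by linarith
      qed
      thus "\<exists>N. \<forall>j\<ge>N. \<forall>k\<ge>N. nrm (w j - w k) < e" by blast
    qed
    have el: "emb w \<in> carrier completion" by (rule emb_in_completion[OF wc])
    have "(\<lambda>k. ?d (u k) (emb w)) \<longlonglongrightarrow> 0"
    proof (rule LIMSEQ_I)
      fix e :: real assume e: "0 < e"
      obtain N where N: "\<forall>j\<ge>N. \<forall>k\<ge>N. nrm (w j - w k) < e / 3" using cauchy_seqD(2)[OF wc, of "e/3"] e by auto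
      obtain M where M: "\<And>k. k \<ge> M \<Longrightarrow> 1 / real (Suc k) < e / 3"
        using LIMSEQ_D[OF inv0, of "e/3"] e by auto
      have "norm (?d (u k) (emb w) - 0) < e" if k: "k \<ge> max M N" for k
      proof -
        have d: "cauchy_seq (\<lambda>j. w k - w j)" by (rule cauchy_seq_diff[OF cauchy_seq_const[OF wG] wc])
        have "?d (emb (\<lambda>_. w k)) (emb w) \<le> e / 3"
          unfolding emb_minus[OF cauchy_seq_const[OF wG] wc] vnorm_emb[OF d]
          by (rule LIMSEQ_le_const2[OF nrm_tendsto[OF d]]) (use N k less_imp_le in \<open>meson max.boundedE\<close>)
        moreover have "?d (u k) (emb (\<lambda>_. w k)) < e / 3"
          using w[of k] M[of k] k by fastforce
        ultimately have "?d (u k) (emb w) < e"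
          using tri[OF u[of k] ew[of k] el] e by linarith
        thus ?thesis using N.norm_nonneg[of "u k \<ominus>\<^bsub>completion\<^esub> emb w"] u el by simp
      qed
      thus "\<exists>N. \<forall>k\<ge>N. norm (?d (u k) (emb w) - 0) < e" by blast
    qed
    thus "\<exists>l\<in>carrier completion. (\<lambda>k. ?d (u k) l) \<longlonglongrightarrow> 0" using el by blast
  qed
  thus ?thesis unfolding hilbert_space_def using inner_product_completion norm by blast
qed

theorem completion_exists:
  obtains H :: "(('f \<Rightarrow> complex) \<Rightarrow> complex) nspace" and J where "hilbert_space K H"
    "\<And>f. f \<in> G \<Longrightarrow> J f \<in> carrier H"
    "\<And>f g. f \<in> G \<Longrightarrow> g \<in> G \<Longrightarrow> J (f + g) = J f \<oplus>\<^bsub>H\<^esub> J g"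
    "\<And>c f. c \<in> K \<Longrightarrow> f \<in> G \<Longrightarrow> J (\<lambda>x. c * f x) = c \<odot>\<^bsub>H\<^esub> J f"
    "\<And>f g. f \<in> G \<Longrightarrow> g \<in> G \<Longrightarrow> J (f - g) = J f \<ominus>\<^bsub>H\<^esub> J g"
    "\<And>f. f \<in> G \<Longrightarrow> vnorm H (J f) = sqrt (Re (q f f))"
proof
  show "vnorm completion (emb (\<lambda>_. f)) = sqrt (Re (q f f))" if "f \<in> G" for f
    using that by (simp add: vnorm_emb cauchy_seq_const qlim_eqI[OF tendsto_const])
qed (simp_all add: hilbert_space_completion emb_in_completion emb_add emb_scale emb_minus cauchy_seq_const)

end

section \<open>Comparing sums of squared norms through scalar products\<close>

context inner_product
begin

text \<open>Deflation: removing from all vectors their components along \<open>v\<close> preserves the hypothesis and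
  subtracts \<open>\<Sum>\<bar>\<langle>v\<^sub>i, e\<rangle>\<bar>\<^sup>2\<close> and \<open>\<Sum>\<bar>\<langle>w\<^sub>j, e\<rangle>\<bar>\<^sup>2\<close> from the two sides of the conclusion.\<close>

lemma sum_norm_mono:
  assumes K: "K = \<real> \<or> K = UNIV" and "set vs \<subseteq> carrier V" "set ws \<subseteq> carrier V"
    and "\<And>h. h \<in> carrier V \<Longrightarrow> (\<Sum>v\<leftarrow>vs. (cmod (ip v h))\<^sup>2) \<le> (\<Sum>w\<leftarrow>ws. (cmod (ip w h))\<^sup>2)"
  shows "(\<Sum>v\<leftarrow>vs. Re (ip v v)) \<le> (\<Sum>w\<leftarrow>ws. Re (ip w w))"
  using assms(2-)
proof (induction "length vs" arbitrary: vs ws)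
  case 0
  thus ?case using ip_nonneg by (auto intro!: sum_list_nonneg simp: subset_iff)
next
  case (Suc k)
  then obtain v us where vs: "vs = v # us" and k: "k = length us" by (cases vs) auto
  have v: "v \<in> carrier V" and us: "set us \<subseteq> carrier V" using Suc.prems(1) vs by auto
  define a where "a = Re (ip v v)"
  have vv: "ip v v = of_real a" unfolding a_def by (rule ip_self[OF v])
  show ?case
  proof (cases "a = 0")
    case True
    hence "v = \<zero>" using ip_eq_zero[OF v] vv by simp
    hence "(\<Sum>v\<leftarrow>us. (cmod (ip v h))\<^sup>2) \<le> (\<Sum>w\<leftarrow>ws. (cmod (ip w h))\<^sup>2)" if "h \<in> carrier V" for h
      using Suc.prems(3)[OF that] that by (simp add: vs ip_zero_left)
    from Suc.hyps(1)[OF k us Suc.prems(2) this] show ?thesis using True by (simp add: vs a_def)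
  next
    case False
    hence a: "0 < a" using ip_nonneg[OF v] by (simp add: a_def)
    \<comment> \<open>\<open>e\<close> is the unit vector along the first vector \<open>v\<close>;
      removing components along \<open>e\<close> annihilates \<open>v\<close>, so that the list to
      be treated becomes shorter.\<close>
    define c :: complex where "c = of_real (1 / sqrt a)"
    define e where "e = c \<odot> v"
    have c: "c \<in> K" using K by (auto simp: c_def)
    have e: "e \<in> carrier V" unfolding e_def by (rule smult_in_carrier[OF c v])
    have cc: "c * c * of_real a = 1" using a by (simp add: c_def flip: of_real_mult)
    have ee: "ip e e = 1"
      using c v e cc vv by (simp add: e_def ip_smult ip_smult_right) (simp add: c_def)
    define P where "P x = x \<ominus> ip x e \<odot> e" for x
    have sc: "ip x e \<odot> e \<in> carrier V" if "x \<in> carrier V" for x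
      using ip_closed[OF that e] e by (rule smult_in_carrier)
    have P: "P x \<in> carrier V" if "x \<in> carrier V" for x using that sc by (simp add: P_def)
    have Pl: "ip (P x) h = ip x h - ip x e * ip e h" if "x \<in> carrier V" "h \<in> carrier V" for x h
      using that e sc ip_closed by (simp add: P_def ip_minus_left ip_smult)
    have Pr: "ip h (P x) = ip h x - cnj (ip x e) * ip h e" if "x \<in> carrier V" "h \<in> carrier V" for x h
      using that e sc ip_closed by (simp add: P_def ip_minus_right ip_smult_right)
    have PP: "ip (P x) h = ip x (P h)" if "x \<in> carrier V" "h \<in> carrier V" for x h
      using Pl[OF that] Pr[OF that(2,1)] ip_commute[OF that(2) e] by simp
    have eP: "ip e (P x) = 0" if "x \<in> carrier V" for x
      using Pr[OF that e] ip_commute[OF that e] by (simp add: ee)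
    have norm: "Re (ip x x) = Re (ip (P x) (P x)) + (cmod (ip x e))\<^sup>2" if x: "x \<in> carrier V" for x
    proof -
      have "ip (P x) (P x) = ip x x - ip x e * cnj (ip x e)"
        using Pl[OF x P[OF x]] Pr[OF x x] eP[OF x] by (simp add: mult.commute)
      thus ?thesis by (simp add: complex_norm_square[symmetric])
    qed
    have sums: "(\<Sum>x\<leftarrow>xs. Re (ip x x)) = (\<Sum>x\<leftarrow>map P xs. Re (ip x x)) + (\<Sum>x\<leftarrow>xs. (cmod (ip x e))\<^sup>2)"
      if "set xs \<subseteq> carrier V" for xs
      using that by (induction xs) (use norm in auto)
    have Pv: "ip (P v) h = 0" if h: "h \<in> carrier V" for h
    proof -
      have "ip v e * ip e h = (c * c * of_real a) * ip v h"
        using c v h vv by (simp add: e_def ip_smult ip_smult_right) (simp add: c_def)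
      thus ?thesis using Pl[OF v h] by (simp add: cc)
    qed
    \<comment> \<open>\<open>P\<close> is self-adjoint, so testing projected vectors against
      \<open>h\<close> is testing the original ones against \<open>P h\<close>. The summand of
      \<open>v\<close> on the smaller side is nonnegative and is dropped.\<close>
    have dom: "(\<Sum>x\<leftarrow>map P us. (cmod (ip x h))\<^sup>2) \<le> (\<Sum>x\<leftarrow>map P ws. (cmod (ip x h))\<^sup>2)" if h: "h \<in> carrier V" for h
    proof -
      have *: "(\<Sum>x\<leftarrow>map P xs. (cmod (ip x h))\<^sup>2) = (\<Sum>x\<leftarrow>xs. (cmod (ip x (P h)))\<^sup>2)"
        if "set xs \<subseteq> carrier V" for xs
        using that by (induction xs) (use PP h in auto)
      show ?thesis
        using Suc.prems(3)[OF P[OF h]] *[OF us] *[OF Suc.prems(2)] by (simp add: vs)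
          (use zero_le_power2[of "cmod (ip v (P h))"] in linarith)
    qed
    have "(\<Sum>x\<leftarrow>map P us. Re (ip x x)) \<le> (\<Sum>x\<leftarrow>map P ws. Re (ip x x))"
      by (rule Suc.hyps(1)) (use k us Suc.prems(2) P dom in auto)
    moreover have "Re (ip (P v) (P v)) = 0" using Pv[OF P[OF v]] by simp
    ultimately have "(\<Sum>x\<leftarrow>map P vs. Re (ip x x)) \<le> (\<Sum>x\<leftarrow>map P ws. Re (ip x x))" by (simp add: vs)
    \<comment> \<open>The hypothesis at \<open>h = e\<close> compares the components that were
      removed.\<close>
    thus ?thesis
      using sums[OF Suc.prems(1)] sums[OF Suc.prems(2)] Suc.prems(3)[OF e] by linarith
  qed
qed

end

section \<open>Square-integrable functions of a positive functional\<close>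

locale L2_setting = positive_functional L \<Lambda>
  for L :: "('f \<Rightarrow> real) set" and \<Lambda> +
  fixes K :: "complex set"
  assumes K: "K = \<real> \<or> K = UNIV"
begin

definition square_integrable :: "('f \<Rightarrow> complex) set" where
  "square_integrable = {g. (\<forall>x. g x \<in> K) \<and> (\<lambda>x. (cmod (g x))\<^sup>2) \<in> L}"

text \<open>\<open>\<Lambda>\<close> acts on real functions, so real and imaginary parts are
  integrated separately.\<close>

definition L2_ip :: "('f \<Rightarrow> complex) \<Rightarrow> ('f \<Rightarrow> complex) \<Rightarrow> complex" where
  "L2_ip g h = Complex (\<Lambda> (\<lambda>x. Re (g x * cnj (h x)))) (\<Lambda> (\<lambda>x. Im (g x * cnj (h x))))"

lemma ideal_sum:
  assumes "f \<in> L" "g \<in> L" "\<And>x. \<bar>h x\<bar> \<le> f x + g x"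
  shows "h \<in> L"
  using ideal[OF subspace_add[OF subspace assms(1,2)]] assms(3) by simp

lemma cmod_mult_cnj_le: "cmod (a * cnj b) \<le> (cmod a)\<^sup>2 + (cmod b)\<^sup>2"
  unfolding norm_mult complex_mod_cnj
  using sum_squares_bound[of "cmod a" "cmod b"] mult_nonneg_nonneg[OF norm_ge_zero norm_ge_zero, of a b] by linarith

text \<open>The product is dominated by the sum of the two squares, and \<open>L\<close> is an
  ideal.\<close>

lemma ReIm_in:
  assumes g: "g \<in> square_integrable" and h: "h \<in> square_integrable"
  shows "(\<lambda>x. Re (g x * cnj (h x))) \<in> L" "(\<lambda>x. Im (g x * cnj (h x))) \<in> L"
proof -
  have "(\<lambda>x. (cmod (g x))\<^sup>2) \<in> L" "(\<lambda>x. (cmod (h x))\<^sup>2) \<in> L"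
    using g h by (auto simp: square_integrable_def)
  note * = ideal_sum[OF this]
  show "(\<lambda>x. Re (g x * cnj (h x))) \<in> L"
    by (rule *) (rule order_trans[OF abs_Re_le_cmod cmod_mult_cnj_le])
  show "(\<lambda>x. Im (g x * cnj (h x))) \<in> L"
    by (rule *) (rule order_trans[OF abs_Im_le_cmod cmod_mult_cnj_le])
qed

lemma add': "f \<in> L \<Longrightarrow> g \<in> L \<Longrightarrow> \<Lambda> (\<lambda>x. f x + g x) = \<Lambda> f + \<Lambda> g"
  using add by (simp add: plus_fun_def)

lemma scale': "f \<in> L \<Longrightarrow> \<Lambda> (\<lambda>x. c * f x) = c * \<Lambda> f"
  using scale by (simp add: scaleR_fun_def)

lemma scale_in: "f \<in> L \<Longrightarrow> (\<lambda>x. c * f x) \<in> L"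
  using subspace_scale[OF subspace] by (simp add: scaleR_fun_def)

lemma zero: "\<Lambda> (\<lambda>x. 0) = 0"
  using scale'[OF subspace_0[OF subspace], of 0] by simp

lemma L2_ip_self: "L2_ip g g = of_real (\<Lambda> (\<lambda>x. (cmod (g x))\<^sup>2))"
  unfolding L2_ip_def complex_norm_square[symmetric] by (simp add: zero complex_of_real_def)

lemma semi_inner_product_L2: "semi_inner_product K square_integrable L2_ip"
proof
  show "K = \<real> \<or> K = UNIV" by (rule K)
  have zL: "(\<lambda>_. 0) \<in> L" using subspace_0[OF subspace] by (simp add: zero_fun_def)
  show "0 \<in> square_integrable"
    using K zL by (auto simp: square_integrable_def)
next
  fix f g assume f: "f \<in> square_integrable" and g: "g \<in> square_integrable"
  show "f + g \<in> square_integrable"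
  proof -
    have fL: "(\<lambda>x. 2 * (cmod (f x))\<^sup>2) \<in> L" and gL: "(\<lambda>x. 2 * (cmod (g x))\<^sup>2) \<in> L"
      using f g scale_in by (auto simp: square_integrable_def)
    have "(\<lambda>x. (cmod (f x + g x))\<^sup>2) \<in> L"
    proof (rule ideal_sum[OF fL gL])
      fix x
      have "(cmod (f x + g x))\<^sup>2 \<le> (cmod (f x) + cmod (g x))\<^sup>2"
        by (intro power_mono norm_triangle_ineq norm_ge_zero)
      also have "\<dots> \<le> 2 * (cmod (f x))\<^sup>2 + 2 * (cmod (g x))\<^sup>2"
        using sum_squares_bound[of "cmod (f x)" "cmod (g x)"] by (simp add: power2_sum)
      finally show "\<bar>(cmod (f x + g x))\<^sup>2\<bar> \<le> 2 * (cmod (f x))\<^sup>2 + 2 * (cmod (g x))\<^sup>2" by simp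
    qed
    moreover have "f x + g x \<in> K" for x using f g K by (auto simp: square_integrable_def)
    ultimately show ?thesis by (simp add: square_integrable_def)
  qed
  show "L2_ip f g \<in> K"
    using K
  proof
    assume KR: "K = \<real>"
    have "f x \<in> K" "g x \<in> K" for x using f g by (auto simp: square_integrable_def)
    hence "(\<lambda>x. Im (f x * cnj (g x))) = (\<lambda>x. 0)" using KR by (simp add: complex_is_Real_iff)
    hence "Im (L2_ip f g) = 0" unfolding L2_ip_def by (simp only: zero complex.sel)
    thus ?thesis using KR by (simp add: complex_is_Real_iff)
  qed auto
  have "\<Lambda> (\<lambda>x. Im (g x * cnj (f x))) = \<Lambda> (\<lambda>x. (- 1) * Im (f x * cnj (g x)))"
    by (rule arg_cong[of _ _ \<Lambda>]) (auto simp: algebra_simps)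
  moreover have "\<Lambda> (\<lambda>x. Re (g x * cnj (f x))) = \<Lambda> (\<lambda>x. Re (f x * cnj (g x)))"
    by (rule arg_cong[of _ _ \<Lambda>]) (auto simp: algebra_simps)
  ultimately show "L2_ip g f = cnj (L2_ip f g)"
    unfolding L2_ip_def scale'[OF ReIm_in(2)[OF f g]] by (simp add: complex_eq_iff)
next
  fix c f assume c: "c \<in> K" and f: "f \<in> square_integrable"
  have "(\<lambda>x. (cmod (c * f x))\<^sup>2) \<in> L"
    using scale_in[of "\<lambda>x. (cmod (f x))\<^sup>2" "(cmod c)\<^sup>2"] f
    by (simp add: square_integrable_def norm_mult power_mult_distrib)
  moreover have "c * f x \<in> K" for x using c f K by (auto simp: square_integrable_def)
  ultimately show "(\<lambda>x. c * f x) \<in> square_integrable" by (simp add: square_integrable_def)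
next
  fix f g h assume f: "f \<in> square_integrable" and g: "g \<in> square_integrable" and h: "h \<in> square_integrable"
  have "(\<lambda>x. Re ((f + g) x * cnj (h x))) = (\<lambda>x. Re (f x * cnj (h x)) + Re (g x * cnj (h x)))"
    "(\<lambda>x. Im ((f + g) x * cnj (h x))) = (\<lambda>x. Im (f x * cnj (h x)) + Im (g x * cnj (h x)))"
    by (auto simp: algebra_simps)
  thus "L2_ip (f + g) h = L2_ip f h + L2_ip g h"
    unfolding L2_ip_def using ReIm_in[OF f h] ReIm_in[OF g h] by (simp only: add') (simp add: complex_eq_iff)
next
  fix c f g assume c: "c \<in> K" and f: "f \<in> square_integrable" and g: "g \<in> square_integrable"
  have *: "(\<lambda>x. Re (c * f x * cnj (g x))) = (\<lambda>x. Re c * Re (f x * cnj (g x)) + (- Im c) * Im (f x * cnj (g x)))"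
    "(\<lambda>x. Im (c * f x * cnj (g x))) = (\<lambda>x. Re c * Im (f x * cnj (g x)) + Im c * Re (f x * cnj (g x)))"
    by (auto simp: algebra_simps)
  show "L2_ip (\<lambda>x. c * f x) g = c * L2_ip f g"
    unfolding L2_ip_def * using ReIm_in[OF f g]
    by (simp only: add' scale' scale_in) (simp add: complex_eq_iff)
next
  fix f assume f: "f \<in> square_integrable"
  have "0 \<le> \<Lambda> (\<lambda>x. (cmod (f x))\<^sup>2)" by (rule nonneg) (use f in \<open>auto simp: square_integrable_def\<close>)
  thus "0 \<le> Re (L2_ip f f)" by (simp add: L2_ip_self)
qed

end

section \<open>Multilinear maps and elementary tensors\<close>

lemma scalar_space_simps [simp]:
  "carrier (scalar_space K) = K" "x \<oplus>\<^bsub>scalar_space K\<^esub> y = x + y" "c \<odot>\<^bsub>scalar_space K\<^esub> x = c * x"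
  "\<zero>\<^bsub>scalar_space K\<^esub> = 0" "\<one>\<^bsub>scalar_space K\<^esub> = 1" "x \<otimes>\<^bsub>scalar_space K\<^esub> y = x * y"
  "vnorm (scalar_space K) = cmod"
  by (simp_all add: scalar_space_def)

section \<open>Spans of point evaluations and linear functionals on them\<close>

lemma evaluation_span_simps:
  "u \<oplus>\<^bsub>evaluation_span K F P\<^esub> v = (\<lambda>\<phi>\<in>F. u \<phi> + v \<phi>)"
  "c \<odot>\<^bsub>evaluation_span K F P\<^esub> u = (\<lambda>\<phi>\<in>F. c * u \<phi>)"
  "\<zero>\<^bsub>evaluation_span K F P\<^esub> = (\<lambda>\<phi>\<in>F. 0)"
  by (simp_all add: evaluation_span_def)

lemma evaluation_span_minus:
  assumes K: "K = \<real> \<or> K = UNIV"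
    and u: "u \<in> carrier (evaluation_span K F P)" and v: "v \<in> carrier (evaluation_span K F P)"
  shows "u \<ominus>\<^bsub>evaluation_span K F P\<^esub> v = (\<lambda>\<phi>\<in>F. u \<phi> - v \<phi>)"
proof -
  let ?E = "evaluation_span K F P"
  interpret E: module "scalar_space K" ?E by (rule module_evaluation_span[OF K])
  have "(- 1) \<odot>\<^bsub>?E\<^esub> v \<in> carrier ?E" by (rule E.smult_closed) (use K v in auto)
  moreover have "(- 1) \<odot>\<^bsub>?E\<^esub> v \<oplus>\<^bsub>?E\<^esub> v = \<zero>\<^bsub>?E\<^esub>" by (auto simp: evaluation_span_simps)
  ultimately have "\<ominus>\<^bsub>?E\<^esub> v = (- 1) \<odot>\<^bsub>?E\<^esub> v" using v by (intro E.minus_equality)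
  thus ?thesis by (auto simp: a_minus_def evaluation_span_simps)
qed

lemma evaluation_span_finsum:
  assumes K: "K = \<real> \<or> K = UNIV" and "finite A" and "\<And>i. i \<in> A \<Longrightarrow> f i \<in> carrier (evaluation_span K F P)"
  shows "(\<Oplus>\<^bsub>evaluation_span K F P\<^esub>i\<in>A. f i) = (\<lambda>\<phi>\<in>F. \<Sum>i\<in>A. f i \<phi>)"
proof -
  interpret E: module "scalar_space K" "evaluation_span K F P" by (rule module_evaluation_span[OF K])
  show ?thesis
    using assms(2,3)
  proof (induction A rule: finite_induct)
    case (insert i A)
    thus ?case by (subst E.finsum_insert) (auto simp: evaluation_span_simps)
  qed (simp add: evaluation_span_simps)
qed

lemma point_evaluation_in_span:
  assumes "K = \<real> \<or> K = UNIV" "x \<in> P"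
  shows "point_evaluation F x \<in> carrier (evaluation_span K F P)"
  unfolding evaluation_span_def
  by (simp, rule exI[of _ "1::nat"], rule exI[of _ "\<lambda>_. 1"], rule exI[of _ "\<lambda>_. x"])
    (use assms in \<open>auto simp: point_evaluation_def\<close>)

lemma evaluation_span_cases:
  assumes "u \<in> carrier (evaluation_span K F P)"
  obtains m :: nat and c x where "\<And>j. j < m \<Longrightarrow> c j \<in> K" "\<And>j. j < m \<Longrightarrow> x j \<in> P"
    "u = (\<lambda>\<phi>\<in>F. \<Sum>j<m. c j * \<phi> (x j))"
proof -
  from assms obtain m :: nat and c x where "\<forall>j<m. c j \<in> K \<and> x j \<in> P"
    "u = (\<lambda>\<phi>\<in>F. \<Sum>j<m. c j * point_evaluation F (x j) \<phi>)"
    by (simp add: evaluation_span_def) blast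
  thus ?thesis by (intro that[of m c x]) (auto simp: point_evaluation_def)
qed

lemma linear_onD:
  assumes "linear_on K E F f"
  shows "x \<in> carrier E \<Longrightarrow> f x \<in> carrier F"
    and "x \<in> carrier E \<Longrightarrow> y \<in> carrier E \<Longrightarrow> f (x \<oplus>\<^bsub>E\<^esub> y) = f x \<oplus>\<^bsub>F\<^esub> f y"
    and "c \<in> K \<Longrightarrow> x \<in> carrier E \<Longrightarrow> f (c \<odot>\<^bsub>E\<^esub> x) = c \<odot>\<^bsub>F\<^esub> f x"
  using assms by (auto simp: linear_on_def)

lemma linear_on_zero:
  assumes "module (scalar_space K) E" "linear_on K E (scalar_space K) f"
  shows "f \<zero>\<^bsub>E\<^esub> = 0"
proof -
  interpret E: module "scalar_space K" E by (rule assms)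
  show ?thesis using linear_onD(2)[OF assms(2), of "\<zero>\<^bsub>E\<^esub>" "\<zero>\<^bsub>E\<^esub>"] by simp
qed

lemma linear_on_minus:
  assumes "module (scalar_space K) E" "linear_on K E (scalar_space K) f" "x \<in> carrier E" "y \<in> carrier E"
  shows "f (x \<ominus>\<^bsub>E\<^esub> y) = f x - f y"
proof -
  interpret E: module "scalar_space K" E by (rule assms)
  show ?thesis using linear_onD(2)[OF assms(2), of "x \<ominus>\<^bsub>E\<^esub> y" y] assms(3,4)
    by (simp add: a_minus_def E.a_assoc E.l_neg)
qed

lemma linear_on_evaluation_span_sum:
  assumes K: "K = \<real> \<or> K = UNIV" and f: "linear_on K (evaluation_span K F P) (scalar_space K) f"
    and "\<And>j. j < m \<Longrightarrow> c j \<in> K" "\<And>j. j < m \<Longrightarrow> x j \<in> P"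
  shows "f (\<lambda>\<phi>\<in>F. \<Sum>j<m. c j * \<phi> (x j)) = (\<Sum>j<(m::nat). c j * f (point_evaluation F (x j)))"
  using assms(3,4)
proof (induction m)
  case 0
  have "(\<lambda>\<phi>\<in>F. \<Sum>j<0. c j * \<phi> (x j)) = \<zero>\<^bsub>evaluation_span K F P\<^esub>" by (auto simp: evaluation_span_simps)
  thus ?case using linear_on_zero[OF module_evaluation_span[OF K] f] by (simp only: lessThan_0 sum.empty)
next
  case (Suc m)
  let ?E = "evaluation_span K F P" and ?u = "\<lambda>\<phi>\<in>F. \<Sum>j<m. c j * \<phi> (x j)"
  interpret E: module "scalar_space K" ?E by (rule module_evaluation_span[OF K])
  have p: "point_evaluation F (x m) \<in> carrier ?E" by (rule point_evaluation_in_span[OF K]) (use Suc.prems in auto)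
  have u: "?u \<in> carrier ?E"
    unfolding evaluation_span_def
    by (simp, rule exI[of _ m], rule exI[of _ c], rule exI[of _ x])
      (use Suc.prems in \<open>auto simp: point_evaluation_def\<close>)
  have eq: "(\<lambda>\<phi>\<in>F. \<Sum>j<Suc m. c j * \<phi> (x j)) = ?u \<oplus>\<^bsub>?E\<^esub> c m \<odot>\<^bsub>?E\<^esub> point_evaluation F (x m)"
    by (auto simp: evaluation_span_simps point_evaluation_def)
  have "f (\<lambda>\<phi>\<in>F. \<Sum>j<Suc m. c j * \<phi> (x j)) = f ?u + c m * f (point_evaluation F (x m))"
    unfolding eq using linear_onD(2)[OF f u E.smult_closed[OF _ p]] linear_onD(3)[OF f _ p] Suc.prems by simp
  moreover have "f ?u = (\<Sum>j<m. c j * f (point_evaluation F (x j)))"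
    by (rule Suc.IH) (use Suc.prems in auto)
  ultimately show ?case by (simp only: sum.lessThan_Suc)
qed

lemma normed_space_sc: "normed_space K V \<Longrightarrow> c \<in> K \<Longrightarrow> x \<in> carrier V \<Longrightarrow> c \<odot>\<^bsub>V\<^esub> x \<in> carrier V"
  using module.smult_closed[of "scalar_space K" V] by (simp add: normed_space_def)

section \<open>Dual spaces and their norm\<close>

lemma dual_space_simps:
  "f \<oplus>\<^bsub>dual_space K E\<^esub> g = (\<lambda>x\<in>carrier E. f x + g x)"
  "c \<odot>\<^bsub>dual_space K E\<^esub> f = (\<lambda>x\<in>carrier E. c * f x)"
  "\<zero>\<^bsub>dual_space K E\<^esub> = (\<lambda>x\<in>carrier E. 0)"
  "f \<in> carrier (dual_space K E) \<longleftrightarrow> f \<in> extensional (carrier E) \<and> linear_on K E (scalar_space K) f \<and>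
     (\<exists>C. \<forall>x\<in>carrier E. cmod (f x) \<le> C * vnorm E x)"
  "vnorm (dual_space K E) f = (SUP x\<in>{x \<in> carrier E. vnorm E x \<le> 1}. cmod (f x))"
  by (simp_all add: dual_space_def)

lemma abelian_group_dual_space:
  assumes K: "K = \<real> \<or> K = UNIV" and E: "module (scalar_space K) E"
  shows "abelian_group (dual_space K E)"
    and "f \<in> carrier (dual_space K E) \<Longrightarrow> g \<in> carrier (dual_space K E) \<Longrightarrow>
      f \<ominus>\<^bsub>dual_space K E\<^esub> g = (\<lambda>x\<in>carrier E. f x - g x)"
    and "c \<in> K \<Longrightarrow> f \<in> carrier (dual_space K E) \<Longrightarrow> c \<odot>\<^bsub>dual_space K E\<^esub> f \<in> carrier (dual_space K E)"
proof -
  let ?D = "dual_space K E"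
  interpret E: module "scalar_space K" E by (rule E)
  have add: "f \<oplus>\<^bsub>?D\<^esub> g \<in> carrier ?D" if f: "f \<in> carrier ?D" and g: "g \<in> carrier ?D" for f g
  proof -
    obtain C D where *: "\<forall>x\<in>carrier E. cmod (f x) \<le> C * vnorm E x" "\<forall>x\<in>carrier E. cmod (g x) \<le> D * vnorm E x"
      using f g by (auto simp: dual_space_simps)
    have "cmod (f x + g x) \<le> (C + D) * vnorm E x" if "x \<in> carrier E" for x
      using * that norm_triangle_ineq[of "f x" "g x"] by (fastforce simp: distrib_right)
    moreover have "f x + g x \<in> K" if "x \<in> carrier E" for x
      using linear_onD(1)[of K E "scalar_space K"] f g K that by (fastforce simp: dual_space_simps)
    hence "linear_on K E (scalar_space K) (\<lambda>x\<in>carrier E. f x + g x)"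
      using f g E.smult_closed by (auto simp: dual_space_simps linear_on_def algebra_simps)
    ultimately show ?thesis by (auto simp: dual_space_simps)
  qed
  have smult: "c \<odot>\<^bsub>?D\<^esub> f \<in> carrier ?D" if f: "f \<in> carrier ?D" and c: "c \<in> K" for f c
  proof -
    obtain C where *: "\<forall>x\<in>carrier E. cmod (f x) \<le> C * vnorm E x" using f by (auto simp: dual_space_simps)
    have "cmod (c * f x) \<le> (cmod c * C) * vnorm E x" if "x \<in> carrier E" for x
      using mult_left_mono[OF *[rule_format, OF that], of "cmod c"] by (simp add: norm_mult mult.assoc)
    moreover have "c * f x \<in> K" if "x \<in> carrier E" for x
      using linear_onD(1)[of K E "scalar_space K"] f K c that by (fastforce simp: dual_space_simps)
    hence "linear_on K E (scalar_space K) (\<lambda>x\<in>carrier E. c * f x)"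
      using f E.smult_closed by (auto simp: dual_space_simps linear_on_def algebra_simps)
    ultimately show ?thesis by (auto simp: dual_space_simps)
  qed
  have m1: "- 1 \<in> K" using K by auto
  have zero: "\<zero>\<^bsub>?D\<^esub> \<in> carrier ?D"
    using K E.smult_closed by (auto simp: dual_space_simps linear_on_def intro!: exI[of _ 0])
  have ext: "restrict f (carrier E) = f" if "f \<in> carrier ?D" for f
    using that by (simp add: dual_space_simps extensional_restrict)
  have inv: "(- 1) \<odot>\<^bsub>?D\<^esub> f \<oplus>\<^bsub>?D\<^esub> f = \<zero>\<^bsub>?D\<^esub>" for f by (auto simp: dual_space_simps)
  show ag: "abelian_group ?D"
  proof (rule abelian_groupI)
    fix f assume f: "f \<in> carrier ?D"
    show "\<zero>\<^bsub>?D\<^esub> \<oplus>\<^bsub>?D\<^esub> f = f" using ext[OF f] by (simp add: dual_space_simps(1,3) cong: restrict_cong)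
    show "\<exists>g\<in>carrier ?D. g \<oplus>\<^bsub>?D\<^esub> f = \<zero>\<^bsub>?D\<^esub>" using inv smult[OF f m1] by blast
  qed (use add zero in \<open>auto simp: dual_space_simps(1,2,3) algebra_simps restrict_def\<close>)
  interpret D: abelian_group ?D by (rule ag)
  show "f \<ominus>\<^bsub>?D\<^esub> g = (\<lambda>x\<in>carrier E. f x - g x)" if "f \<in> carrier ?D" "g \<in> carrier ?D"
  proof -
    have "\<ominus>\<^bsub>?D\<^esub> g = (- 1) \<odot>\<^bsub>?D\<^esub> g" using that smult[OF _ m1] inv by (intro D.minus_equality) auto
    thus ?thesis by (auto simp: a_minus_def dual_space_simps(1,2))
  qed
  show "c \<odot>\<^bsub>?D\<^esub> f \<in> carrier ?D" if "c \<in> K" "f \<in> carrier ?D" using smult that by blast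
qed

text \<open>A bounded functional is bounded on the unit ball, so the supremum is a genuine one.
  Phrased for a nonnegative \<open>vnorm E\<close>, it serves both for \<open>Y\<close> and for the
  tensor space with \<open>gamma_norm\<close>.\<close>

lemma dual_space_norm_upper:
  assumes E: "\<And>x. x \<in> carrier E \<Longrightarrow> 0 \<le> vnorm E x"
    and f: "f \<in> carrier (dual_space K E)" and x: "x \<in> carrier E" "vnorm E x \<le> 1"
  shows "cmod (f x) \<le> vnorm (dual_space K E) f"
proof -
  obtain C where C: "\<forall>x\<in>carrier E. cmod (f x) \<le> C * vnorm E x" using f by (auto simp: dual_space_simps)
  have "cmod (f x) \<le> \<bar>C\<bar>" if "x \<in> carrier E" "vnorm E x \<le> 1" for x
  proof -
    have "C * vnorm E x \<le> \<bar>C\<bar> * 1" using that E by (intro mult_mono) auto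
    thus ?thesis using C that by force
  qed
  hence "bdd_above ((\<lambda>x. cmod (f x)) ` {x \<in> carrier E. vnorm E x \<le> 1})" by (intro bdd_aboveI2) auto
  thus ?thesis unfolding dual_space_simps by (rule cSUP_upper[rotated]) (use x in auto)
qed

lemma dual_space_norm_bound:
  assumes E: "normed_space K E" and K: "K = \<real> \<or> K = UNIV"
    and f: "f \<in> carrier (dual_space K E)" and x: "x \<in> carrier E"
  shows "cmod (f x) \<le> vnorm (dual_space K E) f * vnorm E x"
proof -
  interpret E: normed_space K E by (rule E)
  have lin: "linear_on K E (scalar_space K) f" using f by (simp add: dual_space_simps)
  show ?thesis
  proof (cases "vnorm E x = 0")
    case True
    hence "x = \<zero>\<^bsub>E\<^esub>" using E.norm_eq_zero[OF x] by simp
    thus ?thesis using linear_on_zero[OF E.module_axioms lin] True by simp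
  next
    case False
    hence pos: "0 < vnorm E x" using E.norm_nonneg[OF x] by simp
    define c :: complex where "c = of_real (1 / vnorm E x)"
    have c: "c \<in> K" using K by (auto simp: c_def)
    have cx: "c \<odot>\<^bsub>E\<^esub> x \<in> carrier E" by (rule normed_space_sc[OF E c x])
    have "vnorm E (c \<odot>\<^bsub>E\<^esub> x) \<le> 1" using E.norm_smult[OF c x] pos by (simp add: c_def norm_divide)
    from dual_space_norm_upper[OF E.norm_nonneg f cx this]
    have "cmod c * cmod (f x) \<le> vnorm (dual_space K E) f"
      using linear_onD(3)[OF lin c x] by (simp add: norm_mult)
    thus ?thesis using pos by (simp add: c_def norm_divide field_simps)
  qed
qed

section \<open>Multilinear maps on tuples\<close>

locale multilinear_setting =
  fixes K :: "complex set" and n :: nat and X :: "nat \<Rightarrow> 'a nspace"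
  assumes K: "K = \<real> \<or> K = UNIV" and n: "1 \<le> n"
    and X: "\<And>i. i \<in> {1..n} \<Longrightarrow> normed_space K (X i)"
begin

abbreviation tup :: "(nat \<Rightarrow> 'a) set" where
  "tup \<equiv> tuples n X"

abbreviation forms :: "((nat \<Rightarrow> 'a) \<Rightarrow> complex) set" where
  "forms \<equiv> {\<phi>. multilinear K n X (scalar_space K) \<phi>}"

abbreviation tensors :: "(complex, 'a tensor) module" where
  "tensors \<equiv> tensor_product K n X"

abbreviation et :: "(nat \<Rightarrow> 'a) \<Rightarrow> 'a tensor" where
  "et \<equiv> elementary_tensor K n X"

abbreviation pnorm :: "(nat \<Rightarrow> 'a) \<Rightarrow> real" where
  "pnorm x \<equiv> \<Prod>i=1..n. vnorm (X i) (x i)"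

lemma tuples_upd: "x \<in> tup \<Longrightarrow> i \<in> {1..n} \<Longrightarrow> a \<in> carrier (X i) \<Longrightarrow> x(i := a) \<in> tup"
  by (auto simp: tuples_def PiE_iff extensional_def)

lemma tuples_nth: "x \<in> tup \<Longrightarrow> i \<in> {1..n} \<Longrightarrow> x i \<in> carrier (X i)"
  by (auto simp: tuples_def)

lemma X_smult: "i \<in> {1..n} \<Longrightarrow> c \<in> K \<Longrightarrow> a \<in> carrier (X i) \<Longrightarrow> c \<odot>\<^bsub>X i\<^esub> a \<in> carrier (X i)"
  using normed_space_sc[OF X] .

lemma X_add: "i \<in> {1..n} \<Longrightarrow> a \<in> carrier (X i) \<Longrightarrow> b \<in> carrier (X i) \<Longrightarrow> a \<oplus>\<^bsub>X i\<^esub> b \<in> carrier (X i)"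
proof -
  assume *: "i \<in> {1..n}" "a \<in> carrier (X i)" "b \<in> carrier (X i)"
  interpret Xi: normed_space K "X i" by (rule X[OF *(1)])
  show ?thesis using * by simp
qed

lemma X_nonneg: "i \<in> {1..n} \<Longrightarrow> a \<in> carrier (X i) \<Longrightarrow> 0 \<le> vnorm (X i) a"
  using normed_space.norm_nonneg[OF X] .

lemma prod_norm_nonneg: "x \<in> tup \<Longrightarrow> 0 \<le> pnorm x"
  by (intro prod_nonneg) (use X_nonneg tuples_nth in auto)

lemma multilinearD:
  assumes "multilinear K n X V T" "x \<in> tup"
  shows "T x \<in> carrier V"
    and "i \<in> {1..n} \<Longrightarrow> a \<in> carrier (X i) \<Longrightarrow> b \<in> carrier (X i) \<Longrightarrow>
      T (x(i := a \<oplus>\<^bsub>X i\<^esub> b)) = T (x(i := a)) \<oplus>\<^bsub>V\<^esub> T (x(i := b))"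
    and "i \<in> {1..n} \<Longrightarrow> c \<in> K \<Longrightarrow> a \<in> carrier (X i) \<Longrightarrow>
      T (x(i := c \<odot>\<^bsub>X i\<^esub> a)) = c \<odot>\<^bsub>V\<^esub> T (x(i := a))"
  using assms by (auto simp: multilinear_def)

text \<open>\<open>scale1 c x\<close> represents \<open>c x\<^sup>1 \<otimes> \<dots> \<otimes> x\<^sup>n\<close>.\<close>

definition scale1 :: "complex \<Rightarrow> (nat \<Rightarrow> 'a) \<Rightarrow> nat \<Rightarrow> 'a" where
  "scale1 c x = x(1 := c \<odot>\<^bsub>X 1\<^esub> x 1)"

lemma scale1_in: "c \<in> K \<Longrightarrow> x \<in> tup \<Longrightarrow> scale1 c x \<in> tup"
  unfolding scale1_def using n by (intro tuples_upd X_smult tuples_nth) auto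

lemma multilinear_scale1:
  "multilinear K n X V T \<Longrightarrow> c \<in> K \<Longrightarrow> x \<in> tup \<Longrightarrow> T (scale1 c x) = c \<odot>\<^bsub>V\<^esub> T x"
  using multilinearD(3)[of V T x 1 c "x 1"] tuples_nth[of x 1] n by (simp add: scale1_def)

lemma prod_norm_scale1:
  assumes "c \<in> K" "x \<in> tup"
  shows "(\<Prod>i=1..n. vnorm (X i) (scale1 c x i)) = cmod c * pnorm x"
proof -
  have 1: "1 \<in> {1..n}" using n by simp
  have "vnorm (X 1) (c \<odot>\<^bsub>X 1\<^esub> x 1) = cmod c * vnorm (X 1) (x 1)"
    by (rule normed_space.norm_smult[OF X[OF 1] assms(1) tuples_nth[OF assms(2) 1]])
  moreover have "(\<Prod>i\<in>{1..n} - {1}. vnorm (X i) (scale1 c x i)) = (\<Prod>i\<in>{1..n} - {1}. vnorm (X i) (x i))"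
    by (rule prod.cong) (auto simp: scale1_def)
  ultimately show ?thesis
    using prod.remove[OF _ 1, of "\<lambda>i. vnorm (X i) (scale1 c x i)"] prod.remove[OF _ 1, of "\<lambda>i. vnorm (X i) (x i)"]
    by (simp add: scale1_def)
qed

text \<open>Its elementary tensor is 0: it exhibits \<open>p\<close> as the difference
  \<open>p - 0\<close> and pads lists to equal length.\<close>

definition zero_tuple :: "nat \<Rightarrow> 'a" where
  "zero_tuple = (\<lambda>i\<in>{1..n}. \<zero>\<^bsub>X i\<^esub>)"

lemma X_zero: "i \<in> {1..n} \<Longrightarrow> \<zero>\<^bsub>X i\<^esub> \<in> carrier (X i) \<and> vnorm (X i) \<zero>\<^bsub>X i\<^esub> = 0 \<and> 0 \<odot>\<^bsub>X i\<^esub> \<zero>\<^bsub>X i\<^esub> = \<zero>\<^bsub>X i\<^esub>"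
proof -
  assume i: "i \<in> {1..n}"
  interpret Xi: normed_space K "X i" by (rule X[OF i])
  show ?thesis using Xi.norm_eq_zero[of "\<zero>\<^bsub>X i\<^esub>"] Xi.smult_l_null[of "\<zero>\<^bsub>X i\<^esub>"] by simp
qed

lemma zero_tuple_in: "zero_tuple \<in> tup"
  using X_zero by (auto simp: zero_tuple_def tuples_def)

lemma multilinear_zero_tuple:
  assumes V: "module (scalar_space K) V" and T: "multilinear K n X V T"
  shows "T zero_tuple = \<zero>\<^bsub>V\<^esub>"
proof -
  have "0 \<in> K" using K by auto
  have "scale1 0 zero_tuple = zero_tuple"
    using X_zero[of 1] n by (auto simp: scale1_def zero_tuple_def)
  hence "T zero_tuple = 0 \<odot>\<^bsub>V\<^esub> T zero_tuple"
    using multilinear_scale1[OF T \<open>0 \<in> K\<close> zero_tuple_in] by simp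
  thus ?thesis using module.smult_l_null[OF V multilinearD(1)[OF T zero_tuple_in]] by simp
qed

lemma module_scalar_space: "module (scalar_space K) (scalar_space K)"
  by (rule moduleI)
    (use cring_scalar_space[OF K] K in \<open>auto simp: cring_def ring_def algebra_simps\<close>)

lemma form_zero_tuple: "\<phi> \<in> forms \<Longrightarrow> \<phi> zero_tuple = 0"
  using multilinear_zero_tuple[OF module_scalar_space] by simp

lemma form_scale1: "\<phi> \<in> forms \<Longrightarrow> c \<in> K \<Longrightarrow> x \<in> tup \<Longrightarrow> \<phi> (scale1 c x) = c * \<phi> x"
  using multilinear_scale1[of "scalar_space K" \<phi> c x] by simp

text \<open>Normalizing every slot to length 1 moves the tuple into the set over which the supremum
  is taken, and multilinearity collects the factors.\<close>

lemma multilinear_norm_bound: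
  assumes V: "normed_space K V" and A: "bounded_multilinear K n X V A" and x: "x \<in> tup"
  shows "vnorm V (A x) \<le> multilinear_norm n X V A * pnorm x"
    and "0 \<le> multilinear_norm n X V A"
proof -
  interpret V: normed_space K V by (rule V)
  have mA: "multilinear K n X V A" using A by (simp add: bounded_multilinear_def)
  obtain C where C: "\<And>x. x \<in> tup \<Longrightarrow> vnorm V (A x) \<le> C * pnorm x"
    using A by (auto simp: bounded_multilinear_def)
  let ?B = "{x \<in> tup. \<forall>i\<in>{1..n}. vnorm (X i) (x i) \<le> 1}"
  have bdd: "bdd_above ((\<lambda>x. vnorm V (A x)) ` ?B)"
  proof (rule bdd_aboveI2)
    fix x assume x: "x \<in> ?B"
    have "pnorm x \<le> 1" by (rule prod_le_1) (use x X_nonneg tuples_nth in auto)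
    hence "C * pnorm x \<le> \<bar>C\<bar> * 1"
      using prod_norm_nonneg x by (intro mult_mono) auto
    thus "vnorm V (A x) \<le> \<bar>C\<bar>" using C x by force
  qed
  have upper: "vnorm V (A x) \<le> multilinear_norm n X V A" if "x \<in> ?B" for x
    unfolding multilinear_norm_def by (rule cSUP_upper[OF that bdd])
  show "0 \<le> multilinear_norm n X V A"
  proof -
    have "zero_tuple \<in> ?B" using zero_tuple_in X_zero by (auto simp: zero_tuple_def)
    from upper[OF this] show ?thesis
      using V.norm_nonneg[OF multilinearD(1)[OF mA zero_tuple_in]] by linarith
  qed
  show "vnorm V (A x) \<le> multilinear_norm n X V A * pnorm x"
  proof (cases "\<exists>i\<in>{1..n}. vnorm (X i) (x i) = 0")
    \<comment> \<open>A slot of norm 0 cannot be normalized; here the product vanishes, and any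
      bound \<open>C\<close> gives the estimate.\<close>
    case True
    hence 0: "pnorm x = 0" by (intro prod_zero) auto
    show ?thesis using C[OF x] unfolding 0 by simp
  next
    case False
    define c :: "nat \<Rightarrow> complex" where "c i = of_real (1 / vnorm (X i) (x i))" for i
    have c: "c i \<in> K" for i using K by (auto simp: c_def)
    have pK: "(\<Prod>i\<in>S. c i) \<in> K" for S
      unfolding c_def of_real_prod[symmetric] using K by auto
    \<comment> \<open>\<open>S\<close> is the set of slots already normalized; the induction
      enlarges it by one element because multilinearity acts on one slot at a time.\<close>
    define y where "y S = (\<lambda>i. if i \<in> S then c i \<odot>\<^bsub>X i\<^esub> x i else x i)" for S
    have y: "y S \<in> tup \<and> A (y S) = (\<Prod>i\<in>S. c i) \<odot>\<^bsub>V\<^esub> A x" if "S \<subseteq> {1..n}" for S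
      using finite_subset[OF that finite_atLeastAtMost] that
    proof (induction S rule: finite_induct)
      case empty
      show ?case using x V.smult_one[OF multilinearD(1)[OF mA x]] by (simp add: y_def)
    next
      case (insert j S)
      have j: "j \<in> {1..n}" and IH: "y S \<in> tup" "A (y S) = (\<Prod>i\<in>S. c i) \<odot>\<^bsub>V\<^esub> A x" using insert by auto
      have eq: "y (insert j S) = (y S)(j := c j \<odot>\<^bsub>X j\<^esub> x j)" "(y S)(j := x j) = y S"
        using insert.hyps by (auto simp: y_def)
      have "A (y (insert j S)) = c j \<odot>\<^bsub>V\<^esub> A (y S)"
        unfolding eq(1) using multilinearD(3)[OF mA IH(1) j c tuples_nth[OF x j]] eq(2) by simp
      also have "\<dots> = (\<Prod>i\<in>insert j S. c i) \<odot>\<^bsub>V\<^esub> A x"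
        using V.smult_assoc1[of "c j" "\<Prod>i\<in>S. c i" "A x"] multilinearD(1)[OF mA x] c pK insert.hyps IH(2) by simp
      finally show ?case
        using tuples_upd[OF IH(1) j X_smult[OF j c tuples_nth[OF x j]]] unfolding eq(1) by blast
    qed
    let ?y = "y {1..n}" and ?P = "\<Prod>i=1..n. vnorm (X i) (x i)"
    have pos: "0 < vnorm (X i) (x i)" if "i \<in> {1..n}" for i
      using False X_nonneg[OF that tuples_nth[OF x that]] that by fastforce
    have P: "0 < ?P" using pos by (intro prod_pos) auto
    have "vnorm (X i) (?y i) = 1" if "i \<in> {1..n}" for i
      using normed_space.norm_smult[OF X[OF that] c tuples_nth[OF x that]] that pos[OF that]
      by (simp add: y_def c_def norm_divide)
    hence "?y \<in> ?B" using y[OF order_refl] by simp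
    from upper[OF this] have "cmod (\<Prod>i=1..n. c i) * vnorm V (A x) \<le> multilinear_norm n X V A"
      using y[OF order_refl] V.norm_smult[OF pK multilinearD(1)[OF mA x], of "{1..n}"] by simp
    moreover have "cmod (\<Prod>i=1..n. c i) = 1 / ?P"
      unfolding c_def of_real_prod[symmetric] norm_of_real prod_dividef using P by (simp del: One_nat_def)
    ultimately show ?thesis using P by (simp add: field_simps)
  qed
qed

section \<open>Elementary tensors and the projective distance\<close>

lemma module_tensors: "module (scalar_space K) tensors"
  unfolding tensor_product_def by (rule module_evaluation_span[OF K])

lemma et_in: "x \<in> tup \<Longrightarrow> et x \<in> carrier tensors"
  unfolding tensor_product_def elementary_tensor_def by (rule point_evaluation_in_span[OF K])

lemma et_apply: "\<phi> \<in> forms \<Longrightarrow> et x \<phi> = \<phi> x"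
  by (simp add: elementary_tensor_def point_evaluation_def)

lemma et_eqI: "(\<And>\<phi>. \<phi> \<in> forms \<Longrightarrow> \<phi> x = w \<phi>) \<Longrightarrow> w \<in> extensional forms \<Longrightarrow> et x = w"
  by (rule extensionalityI[of _ forms]) (auto simp: elementary_tensor_def point_evaluation_def)

lemma et_add:
  assumes "x \<in> tup" "i \<in> {1..n}" "a \<in> carrier (X i)" "b \<in> carrier (X i)"
  shows "et (x(i := a \<oplus>\<^bsub>X i\<^esub> b)) = et (x(i := a)) \<oplus>\<^bsub>tensors\<^esub> et (x(i := b))"
proof (rule et_eqI)
  fix \<phi> assume "\<phi> \<in> forms"
  thus "\<phi> (x(i := a \<oplus>\<^bsub>X i\<^esub> b)) = (et (x(i := a)) \<oplus>\<^bsub>tensors\<^esub> et (x(i := b))) \<phi>"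
    using multilinearD(2)[of "scalar_space K" \<phi> x i] assms by (simp add: tensor_product_def evaluation_span_simps et_apply)
qed (auto simp: tensor_product_def evaluation_span_simps)

lemma et_smult:
  assumes "x \<in> tup" "i \<in> {1..n}" "c \<in> K" "a \<in> carrier (X i)"
  shows "et (x(i := c \<odot>\<^bsub>X i\<^esub> a)) = c \<odot>\<^bsub>tensors\<^esub> et (x(i := a))"
proof (rule et_eqI)
  fix \<phi> assume "\<phi> \<in> forms"
  thus "\<phi> (x(i := c \<odot>\<^bsub>X i\<^esub> a)) = (c \<odot>\<^bsub>tensors\<^esub> et (x(i := a))) \<phi>"
    using multilinearD(3)[of "scalar_space K" \<phi> x i] assms by (simp add: tensor_product_def evaluation_span_simps et_apply)
qed (auto simp: tensor_product_def evaluation_span_simps)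

lemma et_zero_tuple: "et zero_tuple = \<zero>\<^bsub>tensors\<^esub>"
  by (rule et_eqI) (auto simp: tensor_product_def evaluation_span_simps form_zero_tuple)

definition proj_dist :: "(nat \<Rightarrow> 'a) \<Rightarrow> (nat \<Rightarrow> 'a) \<Rightarrow> real" where
  "proj_dist a b = projective_norm K n X (et a \<ominus>\<^bsub>tensors\<^esub> et b)"

text \<open>The equation \<open>p - q = \<Sum>\<^sub>j p\<^sub>j\<close> between the elementary tensors of \<open>a\<close>, \<open>b\<close> and \<open>x j\<close>, tested on multilinear forms.\<close>

definition difference_rep :: "(nat \<Rightarrow> 'a) \<Rightarrow> (nat \<Rightarrow> 'a) \<Rightarrow> nat \<Rightarrow> (nat \<Rightarrow> nat \<Rightarrow> 'a) \<Rightarrow> bool" where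
  "difference_rep a b m x \<longleftrightarrow> (\<forall>j<m. x j \<in> tup) \<and> (\<forall>\<phi>\<in>forms. \<phi> a - \<phi> b = (\<Sum>j<m. \<phi> (x j)))"

text \<open>A tensor is a functional on the multilinear forms, so an equation between tensors is one
  scalar equation for each form. From here on the projective norm of a difference is computed from
  tuples.\<close>

lemma proj_dist_eq:
  assumes "a \<in> tup" "b \<in> tup"
  shows "proj_dist a b = Inf {\<Sum>j<m. pnorm (x j) | m x. difference_rep a b m x}"
proof -
  have "(et a \<ominus>\<^bsub>tensors\<^esub> et b = (\<Oplus>\<^bsub>tensors\<^esub>j\<in>{..<m}. et (x j))) \<longleftrightarrow> (\<forall>\<phi>\<in>forms. \<phi> a - \<phi> b = (\<Sum>j<m. \<phi> (x j)))"
    if x: "\<forall>j<m. x j \<in> tup" for m :: nat and x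
  proof -
    have "et a \<ominus>\<^bsub>tensors\<^esub> et b = (\<lambda>\<phi>\<in>forms. \<phi> a - \<phi> b)"
      using evaluation_span_minus[OF K et_in[OF assms(1), unfolded tensor_product_def] et_in[OF assms(2), unfolded tensor_product_def]]
      by (simp add: tensor_product_def et_apply cong: restrict_cong)
    moreover have "(\<Oplus>\<^bsub>tensors\<^esub>j\<in>{..<m}. et (x j)) = (\<lambda>\<phi>\<in>forms. \<Sum>j<m. \<phi> (x j))"
      unfolding tensor_product_def
      by (subst evaluation_span_finsum[OF K])
        (use x et_in in \<open>auto simp: et_apply tensor_product_def[symmetric] cong: restrict_cong\<close>)
    ultimately show ?thesis by (auto simp: fun_eq_iff restrict_def)
  qed
  hence "{\<Sum>j<m. pnorm (x j) | m x. difference_rep a b m x} =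
    {(\<Sum>j<m. pnorm (x j)) | (m::nat) x. (\<forall>j<m. x j \<in> tup) \<and>
      et a \<ominus>\<^bsub>tensors\<^esub> et b = (\<Oplus>\<^bsub>tensors\<^esub>j\<in>{..<m}. et (x j))}"
    unfolding difference_rep_def by blast
  thus ?thesis unfolding proj_dist_def projective_norm_def by simp
qed

lemma difference_rep_sum_nonneg:
  "difference_rep a b m x \<Longrightarrow> 0 \<le> (\<Sum>j<m. pnorm (x j))"
  using prod_norm_nonneg by (auto simp: difference_rep_def intro!: sum_nonneg)

lemma proj_dist_le:
  assumes "a \<in> tup" "b \<in> tup" "difference_rep a b m x"
  shows "proj_dist a b \<le> (\<Sum>j<m. pnorm (x j))"
  unfolding proj_dist_eq[OF assms(1,2)]
  by (rule cInf_lower) (use assms(3) difference_rep_sum_nonneg in \<open>auto intro!: bdd_belowI[of _ 0]\<close>)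

lemma proj_dist_greatest:
  assumes ab: "a \<in> tup" "b \<in> tup"
    and le: "\<And>m x. difference_rep a b m x \<Longrightarrow> B \<le> (\<Sum>j<m. pnorm (x j))"
  shows "B \<le> proj_dist a b"
  unfolding proj_dist_eq[OF ab]
proof (rule cInf_greatest)
  \<comment> \<open>The infimum needs some representation: \<open>a\<close> together with
    \<open>- b\<close>, the sign being put into the first slot.\<close>
  have "- 1 \<in> K" using K by auto
  moreover from this have "\<phi> (scale1 (- 1) b) = - \<phi> b" if "\<phi> \<in> forms" for \<phi>
    using form_scale1[OF that _ ab(2), of "- 1"] by simp
  ultimately have "difference_rep a b 2 (\<lambda>j. if j = 0 then a else scale1 (- 1) b)"
    using ab scale1_in by (auto simp: difference_rep_def numeral_2_eq_2)
  thus "{\<Sum>j<m. pnorm (x j) | m x. difference_rep a b m x} \<noteq> {}" by blast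
qed (use le in blast)

lemma proj_dist_nonneg: "a \<in> tup \<Longrightarrow> b \<in> tup \<Longrightarrow> 0 \<le> proj_dist a b"
  by (rule proj_dist_greatest) (assumption | rule difference_rep_sum_nonneg)+

lemma proj_dist_zero: "proj_dist zero_tuple zero_tuple = 0"
proof (rule antisym)
  show "proj_dist zero_tuple zero_tuple \<le> 0"
    using proj_dist_le[OF zero_tuple_in zero_tuple_in, of 0] by (simp add: difference_rep_def)
qed (rule proj_dist_nonneg[OF zero_tuple_in zero_tuple_in])

lemma proj_dist_zero_right: "a \<in> tup \<Longrightarrow> proj_dist a zero_tuple \<le> pnorm a"
  using proj_dist_le[OF _ zero_tuple_in, of a 1 "\<lambda>_. a"] by (simp add: difference_rep_def form_zero_tuple)

lemma proj_dist_scale1: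
  assumes ab: "a \<in> tup" "b \<in> tup" and c: "0 < c"
  shows "proj_dist (scale1 (of_real c) a) (scale1 (of_real c) b) \<le> c * proj_dist a b"
proof -
  have cK: "of_real c \<in> K" using K by auto
  have "proj_dist (scale1 (of_real c) a) (scale1 (of_real c) b) / c \<le> proj_dist a b"
  proof (rule proj_dist_greatest[OF ab])
    fix m x assume x: "difference_rep a b m x"
    hence xt: "\<And>j. j < m \<Longrightarrow> x j \<in> tup" by (simp add: difference_rep_def)
    have "difference_rep (scale1 (of_real c) a) (scale1 (of_real c) b) m (\<lambda>j. scale1 (of_real c) (x j))"
      using x scale1_in[OF cK] ab
      by (auto simp: difference_rep_def form_scale1[OF _ cK] sum_distrib_left[symmetric] right_diff_distrib[symmetric])
    from proj_dist_le[OF scale1_in[OF cK ab(1)] scale1_in[OF cK ab(2)] this]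
    have "proj_dist (scale1 (of_real c) a) (scale1 (of_real c) b) \<le> c * (\<Sum>j<m. pnorm (x j))"
      using c by (simp add: prod_norm_scale1[OF cK xt] sum_distrib_left del: One_nat_def)
    thus "proj_dist (scale1 (of_real c) a) (scale1 (of_real c) b) / c \<le> (\<Sum>j<m. pnorm (x j))"
      using c by (simp add: field_simps)
  qed
  thus ?thesis using c by (simp add: field_simps)
qed

end

section \<open>The norm on the tensor product with Y\<close>

lemma sum_list_map_nth: "(\<Sum>x\<leftarrow>xs. g x) = (\<Sum>i<length xs. g (xs ! i))"
  for g :: "'b \<Rightarrow> 'c::comm_monoid_add"
  by (simp add: sum_list_sum_nth atLeast0LessThan)

lemma sum_list_replicate_zero: "sum_list (replicate k 0) = (0::'c::comm_monoid_add)"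
  by (induction k) auto

locale gamma_setting = multilinear_setting K n X
  for K and n and X :: "nat \<Rightarrow> 'a nspace" +
  fixes Y :: "'y nspace"
  assumes Y: "normed_space K Y"
begin

abbreviation bforms :: "('a tensor \<times> 'y \<Rightarrow> complex) set" where
  "bforms \<equiv> {\<beta>. bilinear_form K tensors Y \<beta>}"

abbreviation tensors2 :: "(complex, ('a, 'y) tensor2) module" where
  "tensors2 \<equiv> tensor_product2 K n X Y"

abbreviation et2 :: "'a tensor \<Rightarrow> 'y \<Rightarrow> ('a, 'y) tensor2" where
  "et2 \<equiv> elementary_tensor2 K n X Y"

abbreviation bounded_forms :: "((nat \<Rightarrow> 'a) \<Rightarrow> complex) set" where
  "bounded_forms \<equiv> {\<phi>. bounded_multilinear K n X (scalar_space K) \<phi>}"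

abbreviation pairs :: "((nat \<Rightarrow> 'a) \<times> (nat \<Rightarrow> 'a)) set" where
  "pairs \<equiv> tup \<times> tup"

abbreviation triples :: "((nat \<Rightarrow> 'a) \<times> (nat \<Rightarrow> 'a) \<times> 'y) set" where
  "triples \<equiv> tup \<times> tup \<times> carrier Y"

lemma bounded_forms_forms: "\<phi> \<in> bounded_forms \<Longrightarrow> \<phi> \<in> forms"
  by (simp add: bounded_multilinear_def)

lemma bforms_linear:
  assumes "\<beta> \<in> bforms"
  shows "y \<in> carrier Y \<Longrightarrow> linear_on K tensors (scalar_space K) (\<lambda>u. \<beta> (u, y))"
    and "u \<in> carrier tensors \<Longrightarrow> linear_on K Y (scalar_space K) (\<lambda>y. \<beta> (u, y))"
  using assms by (auto simp: bilinear_form_def)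

lemma Y_zero: "\<zero>\<^bsub>Y\<^esub> \<in> carrier Y" "vnorm Y \<zero>\<^bsub>Y\<^esub> = 0"
proof -
  interpret Y: normed_space K Y by (rule Y)
  show "\<zero>\<^bsub>Y\<^esub> \<in> carrier Y" "vnorm Y \<zero>\<^bsub>Y\<^esub> = 0" using Y.norm_eq_zero[of "\<zero>\<^bsub>Y\<^esub>"] by auto
qed

lemma module_tensors2: "module (scalar_space K) tensors2"
  unfolding tensor_product2_def by (rule module_evaluation_span[OF K])

lemma tensors_minus: "u \<in> carrier tensors \<Longrightarrow> v \<in> carrier tensors \<Longrightarrow> u \<ominus>\<^bsub>tensors\<^esub> v \<in> carrier tensors"
proof -
  assume *: "u \<in> carrier tensors" "v \<in> carrier tensors"
  interpret E: module "scalar_space K" tensors by (rule module_tensors)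
  show ?thesis using * by simp
qed

lemma et2_in: "u \<in> carrier tensors \<Longrightarrow> y \<in> carrier Y \<Longrightarrow> et2 u y \<in> carrier tensors2"
  unfolding tensor_product2_def elementary_tensor2_def by (rule point_evaluation_in_span[OF K]) simp

lemma et2_apply: "\<beta> \<in> bforms \<Longrightarrow> et2 u y \<beta> = \<beta> (u, y)"
  by (simp add: elementary_tensor2_def point_evaluation_def)

lemma et2_ext: "et2 u y \<in> extensional bforms"
  by (simp add: elementary_tensor2_def point_evaluation_def)

lemma tensors2_simps:
  "u \<oplus>\<^bsub>tensors2\<^esub> v = (\<lambda>\<beta>\<in>bforms. u \<beta> + v \<beta>)" "c \<odot>\<^bsub>tensors2\<^esub> u = (\<lambda>\<beta>\<in>bforms. c * u \<beta>)"
  "\<zero>\<^bsub>tensors2\<^esub> = (\<lambda>\<beta>\<in>bforms. 0)"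
  by (simp_all add: tensor_product2_def evaluation_span_simps)

lemma tensors2_minus:
  "u \<in> carrier tensors2 \<Longrightarrow> v \<in> carrier tensors2 \<Longrightarrow> u \<ominus>\<^bsub>tensors2\<^esub> v = (\<lambda>\<beta>\<in>bforms. u \<beta> - v \<beta>)"
  unfolding tensor_product2_def by (rule evaluation_span_minus[OF K])

lemma et2_add_left:
  assumes "u \<in> carrier tensors" "v \<in> carrier tensors" "y \<in> carrier Y"
  shows "et2 (u \<oplus>\<^bsub>tensors\<^esub> v) y = et2 u y \<oplus>\<^bsub>tensors2\<^esub> et2 v y"
  by (rule extensionalityI[OF et2_ext])
    (use assms linear_onD(2)[OF bforms_linear(1)] in \<open>auto simp: tensors2_simps et2_apply\<close>)

lemma et2_smult_left:
  assumes "c \<in> K" "u \<in> carrier tensors" "y \<in> carrier Y"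
  shows "et2 (c \<odot>\<^bsub>tensors\<^esub> u) y = c \<odot>\<^bsub>tensors2\<^esub> et2 u y"
  by (rule extensionalityI[OF et2_ext])
    (use assms linear_onD(3)[OF bforms_linear(1)] in \<open>auto simp: tensors2_simps et2_apply\<close>)

lemma et2_add_right:
  assumes "u \<in> carrier tensors" "y \<in> carrier Y" "z \<in> carrier Y"
  shows "et2 u (y \<oplus>\<^bsub>Y\<^esub> z) = et2 u y \<oplus>\<^bsub>tensors2\<^esub> et2 u z"
  by (rule extensionalityI[OF et2_ext])
    (use assms linear_onD(2)[OF bforms_linear(2)] in \<open>auto simp: tensors2_simps et2_apply\<close>)

lemma et2_smult_right:
  assumes "c \<in> K" "u \<in> carrier tensors" "y \<in> carrier Y"
  shows "et2 u (c \<odot>\<^bsub>Y\<^esub> y) = c \<odot>\<^bsub>tensors2\<^esub> et2 u y"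
  by (rule extensionalityI[OF et2_ext])
    (use assms linear_onD(3)[OF bforms_linear(2)] in \<open>auto simp: tensors2_simps et2_apply\<close>)

text \<open>A triple \<open>(x, x', y)\<close> stands for \<open>(p - q) \<otimes> y\<close>, where \<open>p\<close> and \<open>q\<close> are the elementary tensors of \<open>x\<close> and \<open>x'\<close>.\<close>

definition diff_tensor :: "((nat \<Rightarrow> 'a) \<times> (nat \<Rightarrow> 'a) \<times> 'y) list \<Rightarrow> ('a, 'y) tensor2" where
  "diff_tensor zs = (\<lambda>\<beta>\<in>bforms. \<Sum>(x, x', y)\<leftarrow>zs. \<beta> (et x, y) - \<beta> (et x', y))"

lemma diff_tensor_Cons:
  assumes "(x, x', y) \<in> triples"
  shows "diff_tensor ((x, x', y) # zs) = (et2 (et x) y \<ominus>\<^bsub>tensors2\<^esub> et2 (et x') y) \<oplus>\<^bsub>tensors2\<^esub> diff_tensor zs"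
  using assms et2_in et_in
  by (auto simp: diff_tensor_def tensors2_simps tensors2_minus et2_apply)

lemma diff_tensor_Nil: "diff_tensor [] = \<zero>\<^bsub>tensors2\<^esub>"
  by (simp add: diff_tensor_def tensors2_simps)

lemma diff_tensor_in: "set zs \<subseteq> triples \<Longrightarrow> diff_tensor zs \<in> carrier tensors2"
proof -
  interpret E: module "scalar_space K" tensors2 by (rule module_tensors2)
  show "set zs \<subseteq> triples \<Longrightarrow> diff_tensor zs \<in> carrier tensors2"
    by (induction zs) (auto simp: diff_tensor_Nil diff_tensor_Cons et2_in et_in)
qed

lemma linear_diff_tensor:
  assumes f: "linear_on K tensors2 (scalar_space K) f" and zs: "set zs \<subseteq> triples"
  shows "f (diff_tensor zs) = (\<Sum>(x, x', y)\<leftarrow>zs. f (et2 (et x) y) - f (et2 (et x') y))"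
proof -
  interpret E: module "scalar_space K" tensors2 by (rule module_tensors2)
  show ?thesis
    using zs
  proof (induction zs)
    case Nil
    show ?case using linear_on_zero[OF module_tensors2 f] by (simp add: diff_tensor_Nil)
  next
    case (Cons z zs)
    obtain x x' y where z: "z = (x, x', y)" by (cases z)
    have t: "(x, x', y) \<in> triples" "set zs \<subseteq> triples" using Cons.prems z by auto
    have e: "et2 (et x) y \<in> carrier tensors2" "et2 (et x') y \<in> carrier tensors2" using t et2_in et_in by auto
    show ?case
      unfolding z diff_tensor_Cons[OF t(1)]
      using linear_onD(2)[OF f E.minus_closed[OF e] diff_tensor_in[OF t(2)]]
        linear_on_minus[OF module_tensors2 f e] Cons.IH[OF t(2)] by simp
  qed
qed

text \<open>Two expansions: the tensor is a combination of products \<open>w \<otimes> y\<close>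
  with arbitrary tensors \<open>w\<close>, and each \<open>w\<close> is a combination of elementary
  ones. All coefficients move into the \<open>Y\<close> factor, and \<open>zero_tuple\<close>
  supplies the subtrahend.\<close>

lemma diff_tensor_exists:
  assumes u: "u \<in> carrier tensors2"
  obtains zs where "set zs \<subseteq> triples" "u = diff_tensor zs"
proof -
  have b0: "\<beta> (et zero_tuple, y) = 0" if "\<beta> \<in> bforms" "y \<in> carrier Y" for \<beta> y
    using linear_on_zero[OF module_tensors bforms_linear(1)[OF that]] by (simp add: et_zero_tuple)
  have elem: "\<exists>zs. set zs \<subseteq> triples \<and> (\<forall>\<beta>\<in>bforms. d * \<beta> (w, y) = (\<Sum>(x, x', y)\<leftarrow>zs. \<beta> (et x, y) - \<beta> (et x', y)))"
    if w: "w \<in> carrier tensors" and y: "y \<in> carrier Y" and d: "d \<in> K" for w y d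
  proof -
    from w obtain m :: nat and c x where c: "\<And>j. j < m \<Longrightarrow> c j \<in> K" and x: "\<And>j. j < m \<Longrightarrow> x j \<in> tup"
      and w: "w = (\<lambda>\<phi>\<in>forms. \<Sum>j<m. c j * \<phi> (x j))"
      unfolding tensor_product_def by (rule evaluation_span_cases) (rule that)
    have dc: "d * c j \<in> K" if "j < m" for j using K d c[OF that] by auto
    let ?zs = "map (\<lambda>j. (x j, zero_tuple, (d * c j) \<odot>\<^bsub>Y\<^esub> y)) [0..<m]"
    have "d * \<beta> (w, y) = (\<Sum>(x, x', y)\<leftarrow>?zs. \<beta> (et x, y) - \<beta> (et x', y))" if b: "\<beta> \<in> bforms" for \<beta>
    proof -
      have "\<beta> (w, y) = (\<Sum>j<m. c j * \<beta> (et (x j), y))"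
        unfolding w elementary_tensor_def
        by (rule linear_on_evaluation_span_sum[OF K, where f = "\<lambda>w. \<beta> (w, y)"])
          (use bforms_linear(1)[OF b y] c x in \<open>auto simp: tensor_product_def\<close>)
      moreover have "\<beta> (et (x j), (d * c j) \<odot>\<^bsub>Y\<^esub> y) = d * (c j * \<beta> (et (x j), y))" if "j < m" for j
        using linear_onD(3)[OF bforms_linear(2)[OF b et_in[OF x[OF that]]] dc[OF that] y] by simp
      ultimately show ?thesis
        using b0[OF b normed_space_sc[OF Y dc y]] by (simp add: sum_list_map_nth sum_distrib_left)
    qed
    moreover have "set ?zs \<subseteq> triples" using x zero_tuple_in normed_space_sc[OF Y dc y] by auto
    ultimately show ?thesis by blast
  qed
  from u obtain l :: nat and d v where d: "\<And>k. k < l \<Longrightarrow> d k \<in> K"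
    and v: "\<And>k. k < l \<Longrightarrow> v k \<in> carrier tensors \<times> carrier Y"
    and u: "u = (\<lambda>\<beta>\<in>bforms. \<Sum>k<l. d k * \<beta> (v k))"
    unfolding tensor_product2_def by (rule evaluation_span_cases) (rule that)
  have "\<exists>zs. set zs \<subseteq> triples \<and>
      (\<forall>\<beta>\<in>bforms. d k * \<beta> (v k) = (\<Sum>(x, x', y)\<leftarrow>zs. \<beta> (et x, y) - \<beta> (et x', y)))" if k: "k < l" for k
  proof -
    have "fst (v k) \<in> carrier tensors" "snd (v k) \<in> carrier Y" using v[OF k] by (simp_all add: mem_Times_iff)
    from elem[OF this d[OF k]] show ?thesis by (simp only: prod.collapse)
  qed
  hence "\<forall>k\<in>{..<l}. \<exists>zs. set zs \<subseteq> triples \<and>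
      (\<forall>\<beta>\<in>bforms. d k * \<beta> (v k) = (\<Sum>(x, x', y)\<leftarrow>zs. \<beta> (et x, y) - \<beta> (et x', y)))" by simp
  from bchoice[OF this] obtain zs where zs: "\<And>k. k < l \<Longrightarrow> set (zs k) \<subseteq> triples"
    "\<And>k \<beta>. k < l \<Longrightarrow> \<beta> \<in> bforms \<Longrightarrow> d k * \<beta> (v k) = (\<Sum>(x, x', y)\<leftarrow>zs k. \<beta> (et x, y) - \<beta> (et x', y))"
    by auto
  have conc: "(\<Sum>z\<leftarrow>concat (map zs [0..<j]). g z) = (\<Sum>k<j. \<Sum>z\<leftarrow>zs k. g z)" for g :: "_ \<Rightarrow> complex" and j
    by (induction j) auto
  show ?thesis
  proof (rule that[of "concat (map zs [0..<l])"])
    show "set (concat (map zs [0..<l])) \<subseteq> triples"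
    proof
      fix z assume "z \<in> set (concat (map zs [0..<l]))"
      then obtain k where "k < l" "z \<in> set (zs k)" by auto
      thus "z \<in> triples" using zs(1) by blast
    qed
    show "u = diff_tensor (concat (map zs [0..<l]))"
      unfolding u diff_tensor_def by (rule restrict_ext) (simp add: conc zs(2))
  qed
qed

section \<open>The gamma norm in terms of lists of tuples\<close>

definition dominates :: "((nat \<Rightarrow> 'a) \<times> (nat \<Rightarrow> 'a) \<times> 'y) list \<Rightarrow> ((nat \<Rightarrow> 'a) \<times> (nat \<Rightarrow> 'a)) list \<Rightarrow> bool" where
  "dominates zs ws \<longleftrightarrow> (\<forall>\<phi>\<in>bounded_forms.
     (\<Sum>(x, x', y)\<leftarrow>zs. (cmod (\<phi> x - \<phi> x'))\<^sup>2) \<le> (\<Sum>(a, b)\<leftarrow>ws. (cmod (\<phi> a - \<phi> b))\<^sup>2))"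

abbreviation dist_sum :: "((nat \<Rightarrow> 'a) \<times> (nat \<Rightarrow> 'a)) list \<Rightarrow> real" where
  "dist_sum ws \<equiv> \<Sum>(a, b)\<leftarrow>ws. (proj_dist a b)\<^sup>2"

definition gamma_cost :: "((nat \<Rightarrow> 'a) \<times> (nat \<Rightarrow> 'a) \<times> 'y) list \<Rightarrow> ((nat \<Rightarrow> 'a) \<times> (nat \<Rightarrow> 'a)) list \<Rightarrow> real" where
  "gamma_cost zs ws = sqrt (dist_sum ws) * sqrt (\<Sum>(x, x', y)\<leftarrow>zs. (vnorm Y y)\<^sup>2)"

definition gamma_rep :: "('a, 'y) tensor2 \<Rightarrow> ((nat \<Rightarrow> 'a) \<times> (nat \<Rightarrow> 'a) \<times> 'y) list \<Rightarrow>
    ((nat \<Rightarrow> 'a) \<times> (nat \<Rightarrow> 'a)) list \<Rightarrow> bool" where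
  "gamma_rep u zs ws \<longleftrightarrow> set zs \<subseteq> triples \<and> set ws \<subseteq> pairs \<and> u = diff_tensor zs \<and> dominates zs ws"

lemma gamma_cost_nonneg: "0 \<le> gamma_cost zs ws"
  unfolding gamma_cost_def by (intro mult_nonneg_nonneg real_sqrt_ge_zero sum_list_nonneg) auto

text \<open>Dictionary between indexed families on the Segre cone and lists of representing tuples.
  The families are tied to the lists by equations below \<open>m\<close> only, so that both
  inclusions in \<open>gamma_norm_eq\<close> can use it.\<close>

lemma gamma_indexed:
  assumes zs: "set zs \<subseteq> triples" and ws: "set ws \<subseteq> pairs" and l: "length zs = m" "length ws = m"
    and p: "\<And>i. i < m \<Longrightarrow> p i = et (fst (zs ! i))" "\<And>i. i < m \<Longrightarrow> q i = et (fst (snd (zs ! i)))"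
      "\<And>i. i < m \<Longrightarrow> y i = snd (snd (zs ! i))"
      "\<And>i. i < m \<Longrightarrow> a i = et (fst (ws ! i))" "\<And>i. i < m \<Longrightarrow> b i = et (snd (ws ! i))"
  shows "(\<Oplus>\<^bsub>tensors2\<^esub>i\<in>{..<m}. et2 (p i \<ominus>\<^bsub>tensors\<^esub> q i) (y i)) = diff_tensor zs" (is ?sum)
    and "segre_dominated K n X m p q m a b \<longleftrightarrow> dominates zs ws" (is ?dom)
    and "sqrt (\<Sum>i<m. (projective_norm K n X (a i \<ominus>\<^bsub>tensors\<^esub> b i))\<^sup>2) * sqrt (\<Sum>i<m. (vnorm Y (y i))\<^sup>2) =
      gamma_cost zs ws" (is ?cost)
proof -
  have z: "fst (zs ! i) \<in> tup \<and> fst (snd (zs ! i)) \<in> tup \<and> snd (snd (zs ! i)) \<in> carrier Y" if "i < m" for i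
  proof -
    have "zs ! i \<in> triples" using zs nth_mem[of i zs] that l(1) by blast
    thus ?thesis by (simp add: mem_Times_iff)
  qed
  have pq: "p i \<in> carrier tensors" "q i \<in> carrier tensors" "y i \<in> carrier Y" if "i < m" for i
    using z[OF that] p that et_in by auto
  have "(\<Oplus>\<^bsub>tensors2\<^esub>i\<in>{..<m}. et2 (p i \<ominus>\<^bsub>tensors\<^esub> q i) (y i)) =
      (\<lambda>\<beta>\<in>bforms. \<Sum>i<m. et2 (p i \<ominus>\<^bsub>tensors\<^esub> q i) (y i) \<beta>)"
    unfolding tensor_product2_def
    by (rule evaluation_span_finsum[OF K])
      (use pq et2_in tensors_minus in \<open>auto simp: tensor_product2_def[symmetric]\<close>)
  also have "\<dots> = diff_tensor zs"
    unfolding diff_tensor_def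
  proof (rule restrict_ext)
    fix \<beta> assume b: "\<beta> \<in> bforms"
    have "et2 (p i \<ominus>\<^bsub>tensors\<^esub> q i) (y i) \<beta> = \<beta> (p i, y i) - \<beta> (q i, y i)" if "i < m" for i
      unfolding et2_apply[OF b]
      by (rule linear_on_minus[OF module_tensors bforms_linear(1)[OF b pq(3)[OF that]] pq(1,2)[OF that]])
    thus "(\<Sum>i<m. et2 (p i \<ominus>\<^bsub>tensors\<^esub> q i) (y i) \<beta>) = (\<Sum>(x, x', y)\<leftarrow>zs. \<beta> (et x, y) - \<beta> (et x', y))"
      using p by (simp add: sum_list_map_nth l case_prod_unfold)
  qed
  finally show ?sum .
  show ?dom
    unfolding segre_dominated_def dominates_def using p bounded_forms_forms
    by (simp add: sum_list_map_nth l case_prod_unfold segre_form_def et_apply)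
  show ?cost
    unfolding gamma_cost_def using p by (simp add: sum_list_map_nth l case_prod_unfold proj_dist_def)
qed

lemma gamma_norm_eq:
  "gamma_norm K n X Y u = Inf {gamma_cost zs ws | zs ws. length zs = length ws \<and> gamma_rep u zs ws}"
proof -
  let ?P = "\<lambda>m p q a b y. (\<forall>i<m. p i \<in> segre K n X \<and> q i \<in> segre K n X \<and> a i \<in> segre K n X \<and> b i \<in> segre K n X \<and> y i \<in> carrier Y) \<and>
     u = (\<Oplus>\<^bsub>tensors2\<^esub>i\<in>{..<m}. et2 (p i \<ominus>\<^bsub>tensors\<^esub> q i) (y i)) \<and> segre_dominated K n X m p q m a b"
  let ?c = "\<lambda>(m::nat) a b y. sqrt (\<Sum>i<m. (projective_norm K n X (a i \<ominus>\<^bsub>tensors\<^esub> b i))\<^sup>2) * sqrt (\<Sum>i<m. (vnorm Y (y i))\<^sup>2)"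
  have "{?c m a b y | m p q a b y. ?P m p q a b y} = {gamma_cost zs ws | zs ws. length zs = length ws \<and> gamma_rep u zs ws}"
    (is "?L = ?R")
  proof (intro equalityI subsetI)
    fix r assume "r \<in> ?L"
    then obtain m p q a b y where P: "?P m p q a b y" and r: "r = ?c m a b y" by blast
    have "\<forall>i. \<exists>x x' z z'. i < m \<longrightarrow> x \<in> tup \<and> x' \<in> tup \<and> z \<in> tup \<and> z' \<in> tup \<and>
        p i = et x \<and> q i = et x' \<and> a i = et z \<and> b i = et z'"
      using P unfolding segre_def by blast
    then obtain x x' z z' where x: "\<And>i. i < m \<Longrightarrow> x i \<in> tup \<and> x' i \<in> tup \<and> z i \<in> tup \<and> z' i \<in> tup \<and>
        p i = et (x i) \<and> q i = et (x' i) \<and> a i = et (z i) \<and> b i = et (z' i)" by metis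
    let ?zs = "map (\<lambda>i. (x i, x' i, y i)) [0..<m]" and ?ws = "map (\<lambda>i. (z i, z' i)) [0..<m]"
    have s: "set ?zs \<subseteq> triples" "set ?ws \<subseteq> pairs" using x P by auto
    have et: "p i = et (fst (?zs ! i))" "q i = et (fst (snd (?zs ! i)))" "y i = snd (snd (?zs ! i))"
      "a i = et (fst (?ws ! i))" "b i = et (snd (?ws ! i))" if "i < m" for i
      using x[OF that] that by simp_all
    have len: "length ?zs = m" "length ?ws = m" by simp_all
    note g = gamma_indexed[OF s len et]
    have "gamma_rep u ?zs ?ws" unfolding gamma_rep_def using s g P by simp
    moreover have "length ?zs = length ?ws" by simp
    moreover have "r = gamma_cost ?zs ?ws" unfolding r by (rule g(3))
    ultimately show "r \<in> ?R" by blast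
  next
    fix r assume "r \<in> ?R"
    then obtain zs ws where l: "length zs = length ws" and g: "gamma_rep u zs ws" and r: "r = gamma_cost zs ws" by blast
    have s: "set zs \<subseteq> triples" "set ws \<subseteq> pairs" using g by (auto simp: gamma_rep_def)
    let ?p = "\<lambda>i. et (fst (zs ! i))" and ?q = "\<lambda>i. et (fst (snd (zs ! i)))" and ?y = "\<lambda>i. snd (snd (zs ! i))"
      and ?a = "\<lambda>i. et (fst (ws ! i))" and ?b = "\<lambda>i. et (snd (ws ! i))"
    note G = gamma_indexed[OF s l refl, of ?p ?q ?y ?a ?b, OF refl refl refl refl refl]
    have mem: "?p i \<in> segre K n X \<and> ?q i \<in> segre K n X \<and> ?a i \<in> segre K n X \<and> ?b i \<in> segre K n X \<and> ?y i \<in> carrier Y"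
      if "i < length ws" for i
    proof -
      have "zs ! i \<in> triples" "ws ! i \<in> pairs"
        using s nth_mem[of i zs] nth_mem[of i ws] that l by auto
      thus ?thesis by (auto simp: segre_def mem_Times_iff)
    qed
    have "?P (length ws) ?p ?q ?a ?b ?y" using mem g G(1,2) by (simp add: gamma_rep_def)
    thus "r \<in> ?L"
      unfolding r G(3)[symmetric] mem_Collect_eq
      by (intro exI[of _ "length ws"] exI[of _ ?p] exI[of _ ?q] exI[of _ ?a] exI[of _ ?b] exI[of _ ?y] conjI[OF refl])
  qed
  thus ?thesis unfolding gamma_norm_def by simp
qed

text \<open>The two lists may differ in length: each is lengthened by as many zero entries as the
  other has elements, which changes neither the tensor nor the domination nor the cost.\<close>

lemma gamma_norm_le:
  assumes "gamma_rep u zs ws"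
  shows "gamma_norm K n X Y u \<le> gamma_cost zs ws"
proof -
  let ?zs = "zs @ replicate (length ws) (zero_tuple, zero_tuple, \<zero>\<^bsub>Y\<^esub>)"
    and ?ws = "ws @ replicate (length zs) (zero_tuple, zero_tuple)"
  have "set ?zs \<subseteq> triples" "set ?ws \<subseteq> pairs"
    using assms zero_tuple_in Y_zero by (auto simp: gamma_rep_def)
  moreover have "diff_tensor ?zs = diff_tensor zs"
    unfolding diff_tensor_def by (rule restrict_ext) (simp add: sum_list_replicate_zero)
  moreover have "dominates ?zs ?ws \<longleftrightarrow> dominates zs ws"
    unfolding dominates_def by (simp add: sum_list_replicate_zero)
  ultimately have "gamma_rep u ?zs ?ws" using assms by (simp add: gamma_rep_def)
  moreover have "gamma_cost ?zs ?ws = gamma_cost zs ws"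
    unfolding gamma_cost_def by (simp add: sum_list_replicate_zero Y_zero proj_dist_zero)
  moreover have "length ?zs = length ?ws" by simp
  ultimately have "gamma_cost zs ws \<in> {gamma_cost zs ws | zs ws. length zs = length ws \<and> gamma_rep u zs ws}"
    by (metis (mono_tags, lifting) mem_Collect_eq)
  thus ?thesis
    unfolding gamma_norm_eq by (rule cInf_lower) (use gamma_cost_nonneg in \<open>auto intro!: bdd_belowI[of _ 0]\<close>)
qed

lemma gamma_norm_greatest:
  assumes u: "u \<in> carrier tensors2" and le: "\<And>zs ws. gamma_rep u zs ws \<Longrightarrow> B \<le> gamma_cost zs ws"
  shows "B \<le> gamma_norm K n X Y u"
  unfolding gamma_norm_eq
proof (rule cInf_greatest)
  obtain zs where zs: "set zs \<subseteq> triples" "u = diff_tensor zs" using diff_tensor_exists[OF u] by blast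
  \<comment> \<open>A representation is dominated by its own pairs, so the set of costs is not
    empty.\<close>
  let ?ws = "map (\<lambda>(x, x', y). (x, x')) zs"
  have "dominates zs ?ws" by (simp add: dominates_def comp_def case_prod_unfold)
  hence "gamma_rep u zs ?ws" using zs by (auto simp: gamma_rep_def)
  moreover have "length zs = length ?ws" by simp
  ultimately show "{gamma_cost zs ws | zs ws. length zs = length ws \<and> gamma_rep u zs ws} \<noteq> {}" by blast
qed (use le in blast)

lemma gamma_norm_nonneg: "u \<in> carrier tensors2 \<Longrightarrow> 0 \<le> gamma_norm K n X Y u"
  by (rule gamma_norm_greatest) (auto intro: gamma_cost_nonneg)

end

section \<open>From factorizations to functionals\<close>

lemma sum_list_cauchy_schwarz:
  fixes f g :: "'b \<Rightarrow> real"
  shows "(\<Sum>x\<leftarrow>xs. \<bar>f x\<bar> * \<bar>g x\<bar>) \<le> sqrt (\<Sum>x\<leftarrow>xs. (f x)\<^sup>2) * sqrt (\<Sum>x\<leftarrow>xs. (g x)\<^sup>2)"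
  using L2_set_mult_ineq[of "\<lambda>i. f (xs ! i)" "\<lambda>i. g (xs ! i)" "{..<length xs}"]
  by (simp add: sum_list_map_nth L2_set_def)

lemma norm_sum_list_le: "norm (\<Sum>x\<leftarrow>xs. f x) \<le> (\<Sum>x\<leftarrow>xs. norm (f x))"
  for f :: "'b \<Rightarrow> 'c::real_normed_vector"
  by (simp add: sum_list_map_nth norm_sum)

context gamma_setting
begin

abbreviation D :: "('y \<Rightarrow> complex) nspace" where
  "D \<equiv> dual_space K Y"

lemma module_Y: "module (scalar_space K) Y"
  using Y by (simp add: normed_space_def)

lemmas D_minus = abelian_group_dual_space(2)[OF K module_Y]

lemma D_linear: "f \<in> carrier D \<Longrightarrow> linear_on K Y (scalar_space K) f"
  by (simp add: dual_space_simps)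

lemma sum_in_K: "finite A \<Longrightarrow> (\<And>j. j \<in> A \<Longrightarrow> f j \<in> K) \<Longrightarrow> sum f A \<in> K"
  by (induction A rule: finite_induct) (use K in auto)

lemma mult_in_K: "c \<in> K \<Longrightarrow> d \<in> K \<Longrightarrow> c * d \<in> K"
  using K by auto

lemma tensor_cases:
  assumes "w \<in> carrier tensors"
  obtains m :: nat and c x where "\<And>j. j < m \<Longrightarrow> c j \<in> K" "\<And>j. j < m \<Longrightarrow> x j \<in> tup"
    "w = (\<lambda>\<phi>\<in>forms. \<Sum>j<m. c j * \<phi> (x j))"
  using assms unfolding tensor_product_def by (rule evaluation_span_cases) (rule that)

section \<open>Linearization of an operator with values in the dual\<close>

definition slice :: "((nat \<Rightarrow> 'a) \<Rightarrow> 'y \<Rightarrow> complex) \<Rightarrow> 'y \<Rightarrow> (nat \<Rightarrow> 'a) \<Rightarrow> complex" where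
  "slice T y = (\<lambda>x\<in>tup. T x y)"

text \<open>The universal property in the concrete tensor product: a tensor is a functional on
  forms, so linearizing means evaluating it at the form \<open>slice T y\<close>.
  \<open>operator_functional\<close> repeats this one level up.\<close>

definition operator_bform :: "((nat \<Rightarrow> 'a) \<Rightarrow> 'y \<Rightarrow> complex) \<Rightarrow> 'a tensor \<times> 'y \<Rightarrow> complex" where
  "operator_bform T = (\<lambda>(w, y)\<in>carrier tensors \<times> carrier Y. w (slice T y))"

definition operator_functional :: "((nat \<Rightarrow> 'a) \<Rightarrow> 'y \<Rightarrow> complex) \<Rightarrow> ('a, 'y) tensor2 \<Rightarrow> complex" where
  "operator_functional T = (\<lambda>u\<in>carrier tensors2. u (operator_bform T))"

lemma slice_in_forms:
  assumes T: "multilinear K n X D T" and y: "y \<in> carrier Y"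
  shows "slice T y \<in> forms"
  unfolding mem_Collect_eq multilinear_def
proof (intro conjI ballI)
  have "T x y \<in> K" if "x \<in> tup" for x
    using linear_onD(1)[OF D_linear[OF multilinearD(1)[OF T that]] y] by simp
  thus "slice T y \<in> tup \<rightarrow>\<^sub>E carrier (scalar_space K)" by (simp add: slice_def)
next
  fix x i a b assume h: "x \<in> tup" "i \<in> {1..n}" "a \<in> carrier (X i)" "b \<in> carrier (X i)"
  show "slice T y (x(i := a \<oplus>\<^bsub>X i\<^esub> b)) = slice T y (x(i := a)) \<oplus>\<^bsub>scalar_space K\<^esub> slice T y (x(i := b))"
    unfolding slice_def restrict_apply'[OF tuples_upd[OF h(1,2) X_add[OF h(2-4)]]]
      restrict_apply'[OF tuples_upd[OF h(1-3)]] restrict_apply'[OF tuples_upd[OF h(1,2,4)]]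
      multilinearD(2)[OF T h] using y by (simp add: dual_space_simps)
next
  fix x i c a assume h: "x \<in> tup" "i \<in> {1..n}" "c \<in> K" "a \<in> carrier (X i)"
  show "slice T y (x(i := c \<odot>\<^bsub>X i\<^esub> a)) = c \<odot>\<^bsub>scalar_space K\<^esub> slice T y (x(i := a))"
    unfolding slice_def restrict_apply'[OF tuples_upd[OF h(1,2) X_smult[OF h(2-4)]]]
      restrict_apply'[OF tuples_upd[OF h(1,2,4)]] multilinearD(3)[OF T h] using y by (simp add: dual_space_simps)
qed

text \<open>Linearity in the tensor is pointwise. Linearity in \<open>y\<close> is hidden inside
  \<open>slice T y\<close> and appears only after expanding the tensor into elementary ones, where
  it is the linearity of the functionals \<open>T (x j)\<close>.\<close>

lemma operator_bform_in:
  assumes T: "multilinear K n X D T"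
  shows "operator_bform T \<in> bforms"
  unfolding mem_Collect_eq bilinear_form_def
proof (intro conjI ballI)
  interpret E: module "scalar_space K" tensors by (rule module_tensors)
  interpret Y: module "scalar_space K" Y by (rule module_Y)
  show "operator_bform T \<in> extensional (carrier tensors \<times> carrier Y)" by (simp add: operator_bform_def)
  have val: "operator_bform T (w, y) = w (slice T y)" if "w \<in> carrier tensors" "y \<in> carrier Y" for w y
    using that by (simp add: operator_bform_def)
  have in_K: "w (slice T y) \<in> K" if w: "w \<in> carrier tensors" and y: "y \<in> carrier Y" for w y
  proof -
    from w obtain m :: nat and c x where c: "\<And>j. j < m \<Longrightarrow> c j \<in> K" "\<And>j. j < m \<Longrightarrow> x j \<in> tup"
      "w = (\<lambda>\<phi>\<in>forms. \<Sum>j<m. c j * \<phi> (x j))" by (rule tensor_cases) (rule that)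
    have s: "slice T y \<in> forms" by (rule slice_in_forms[OF T y])
    hence "slice T y (x j) \<in> K" if "j < m" for j using multilinearD(1)[of "scalar_space K" "slice T y" "x j"] c(2)[OF that] by simp
    thus ?thesis unfolding c(3) restrict_apply'[OF s] using c(1) by (intro sum_in_K mult_in_K) auto
  qed
  fix y assume y: "y \<in> carrier Y"
  have s: "slice T y \<in> forms" by (rule slice_in_forms[OF T y])
  show "linear_on K tensors (scalar_space K) (\<lambda>w. operator_bform T (w, y))"
    unfolding linear_on_def
  proof (intro conjI ballI)
    show "(\<lambda>w. operator_bform T (w, y)) \<in> carrier tensors \<rightarrow> carrier (scalar_space K)"
      using in_K y by (simp add: val)
  next
    fix u v assume "u \<in> carrier tensors" "v \<in> carrier tensors"
    thus "operator_bform T (u \<oplus>\<^bsub>tensors\<^esub> v, y) = operator_bform T (u, y) \<oplus>\<^bsub>scalar_space K\<^esub> operator_bform T (v, y)"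
      using s y by (simp add: val) (simp add: tensor_product_def evaluation_span_simps)
  next
    fix c u assume "c \<in> K" "u \<in> carrier tensors"
    thus "operator_bform T (c \<odot>\<^bsub>tensors\<^esub> u, y) = c \<odot>\<^bsub>scalar_space K\<^esub> operator_bform T (u, y)"
      using s y E.smult_closed[of c u] by (simp add: val) (simp add: tensor_product_def evaluation_span_simps)
  qed
next
  interpret Y: module "scalar_space K" Y by (rule module_Y)
  fix w assume w: "w \<in> carrier tensors"
  have val: "operator_bform T (w, y) = w (slice T y)" if "y \<in> carrier Y" for y
    using that w by (simp add: operator_bform_def)
  from w obtain m :: nat and c x where c: "\<And>j. j < m \<Longrightarrow> c j \<in> K" "\<And>j. j < m \<Longrightarrow> x j \<in> tup"
    "w = (\<lambda>\<phi>\<in>forms. \<Sum>j<m. c j * \<phi> (x j))" by (rule tensor_cases) (rule that)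
  have w_eq: "w (slice T y) = (\<Sum>j<m. c j * T (x j) y)" if "y \<in> carrier Y" for y
    unfolding c(3) restrict_apply'[OF slice_in_forms[OF T that]] using c(2) by (simp add: slice_def)
  have lin: "linear_on K Y (scalar_space K) (T (x j))" if "j < m" for j
    by (rule D_linear[OF multilinearD(1)[OF T c(2)[OF that]]])
  show "linear_on K Y (scalar_space K) (\<lambda>y. operator_bform T (w, y))"
    unfolding linear_on_def
  proof (intro conjI ballI)
    have "(\<Sum>j<m. c j * T (x j) y) \<in> K" if "y \<in> carrier Y" for y
      using linear_onD(1)[OF lin that] c(1) by (intro sum_in_K mult_in_K) auto
    thus "(\<lambda>y. operator_bform T (w, y)) \<in> carrier Y \<rightarrow> carrier (scalar_space K)"
      by (simp add: val w_eq)
  next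
    fix y z assume y: "y \<in> carrier Y" "z \<in> carrier Y"
    have "(\<Sum>j<m. c j * T (x j) (y \<oplus>\<^bsub>Y\<^esub> z)) = (\<Sum>j<m. c j * T (x j) y + c j * T (x j) z)"
      by (rule sum.cong) (use linear_onD(2)[OF lin y] in \<open>auto simp: distrib_left\<close>)
    thus "operator_bform T (w, y \<oplus>\<^bsub>Y\<^esub> z) = operator_bform T (w, y) \<oplus>\<^bsub>scalar_space K\<^esub> operator_bform T (w, z)"
      using y by (simp add: val w_eq sum.distrib)
  next
    fix d y assume d: "d \<in> K" and y: "y \<in> carrier Y"
    have "(\<Sum>j<m. c j * T (x j) (d \<odot>\<^bsub>Y\<^esub> y)) = (\<Sum>j<m. d * (c j * T (x j) y))"
      by (rule sum.cong) (use linear_onD(3)[OF lin d y] in auto)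
    thus "operator_bform T (w, d \<odot>\<^bsub>Y\<^esub> y) = d \<odot>\<^bsub>scalar_space K\<^esub> operator_bform T (w, y)"
      using y normed_space_sc[OF Y d y] by (simp add: val w_eq sum_distrib_left)
  qed
qed

lemma operator_functional_et2:
  assumes T: "multilinear K n X D T" and x: "x \<in> tup" and y: "y \<in> carrier Y"
  shows "operator_functional T (et2 (et x) y) = T x y"
proof -
  have "operator_functional T (et2 (et x) y) = operator_bform T (et x, y)"
    using et2_in[OF et_in[OF x] y] et2_apply[OF operator_bform_in[OF T]] by (simp add: operator_functional_def)
  also have "\<dots> = slice T y x"
    using et_in[OF x] y et_apply[OF slice_in_forms[OF T y]] by (simp add: operator_bform_def)
  finally show ?thesis using x by (simp add: slice_def)
qed

lemma operator_functional_linear: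
  assumes T: "multilinear K n X D T"
  shows "linear_on K tensors2 (scalar_space K) (operator_functional T)"
proof -
  interpret E: module "scalar_space K" tensors2 by (rule module_tensors2)
  note b = operator_bform_in[OF T]
  have "u (operator_bform T) \<in> K" if u: "u \<in> carrier tensors2" for u
  proof -
    from u obtain m :: nat and c v where c: "\<And>k. k < m \<Longrightarrow> c k \<in> K"
      "\<And>k. k < m \<Longrightarrow> v k \<in> carrier tensors \<times> carrier Y" "u = (\<lambda>\<beta>\<in>bforms. \<Sum>k<m. c k * \<beta> (v k))"
      unfolding tensor_product2_def by (rule evaluation_span_cases) (rule that)
    have "operator_bform T (v k) \<in> K" if k: "k < m" for k
    proof -
      obtain w y where v: "v k = (w, y)" "w \<in> carrier tensors" "y \<in> carrier Y" using c(2)[OF k] by auto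
      show ?thesis using linear_onD(1)[OF bforms_linear(1)[OF b v(3)] v(2)] by (simp add: v(1))
    qed
    thus ?thesis unfolding c(3) restrict_apply'[OF b] using c(1) by (intro sum_in_K mult_in_K) auto
  qed
  thus ?thesis
    using b E.a_closed E.smult_closed
    by (simp add: linear_on_def operator_functional_def) (simp add: tensors2_simps)
qed

text \<open>Testing the multilinear map \<open>A\<close> against \<open>A a - A b\<close> itself avoids linearizing it.\<close>

lemma hilbert_norm_diff_le:
  assumes H: "inner_product K H ip" and norm: "\<And>h. h \<in> carrier H \<Longrightarrow> vnorm H h = sqrt (Re (ip h h))"
    and A: "bounded_multilinear K n X H A" and ab: "a \<in> tup" "b \<in> tup"
  shows "vnorm H (A a \<ominus>\<^bsub>H\<^esub> A b) \<le> multilinear_norm n X H A * proj_dist a b"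
    and "h \<in> carrier H \<Longrightarrow> (\<lambda>x\<in>tup. ip (A x) h) \<in> bounded_forms"
proof -
  interpret H: inner_product K H ip by (rule H)
  interpret N: normed_space K H by (rule H.normed_space_of_inner_product[OF K norm])
  have mA: "multilinear K n X H A" using A by (simp add: bounded_multilinear_def)
  note AH = multilinearD(1)[OF mA]
  have cs: "cmod (ip g h) \<le> vnorm H g * vnorm H h" if "g \<in> carrier H" "h \<in> carrier H" for g h
    using H.cmod_ip_le[OF K that] norm that by simp
  have forms: "(\<lambda>x\<in>tup. ip (A x) h) \<in> forms" if h: "h \<in> carrier H" for h
    unfolding mem_Collect_eq multilinear_def
  proof (intro conjI ballI)
    show "(\<lambda>x\<in>tup. ip (A x) h) \<in> tup \<rightarrow>\<^sub>E carrier (scalar_space K)" using AH h H.ip_closed by simp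
  next
    fix x i c d assume g: "x \<in> tup" "i \<in> {1..n}" "c \<in> carrier (X i)" "d \<in> carrier (X i)"
    have t: "x(i := c \<oplus>\<^bsub>X i\<^esub> d) \<in> tup" "x(i := c) \<in> tup" "x(i := d) \<in> tup"
      using tuples_upd[OF g(1,2)] X_add[OF g(2-4)] g by auto
    show "(\<lambda>x\<in>tup. ip (A x) h) (x(i := c \<oplus>\<^bsub>X i\<^esub> d)) =
        (\<lambda>x\<in>tup. ip (A x) h) (x(i := c)) \<oplus>\<^bsub>scalar_space K\<^esub> (\<lambda>x\<in>tup. ip (A x) h) (x(i := d))"
      unfolding restrict_apply'[OF t(1)] restrict_apply'[OF t(2)] restrict_apply'[OF t(3)] multilinearD(2)[OF mA g]
      using H.ip_add[OF AH[OF t(2)] AH[OF t(3)] h] by simp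
  next
    fix x i c d assume g: "x \<in> tup" "i \<in> {1..n}" "c \<in> K" "d \<in> carrier (X i)"
    have t: "x(i := c \<odot>\<^bsub>X i\<^esub> d) \<in> tup" "x(i := d) \<in> tup"
      using tuples_upd[OF g(1,2)] X_smult[OF g(2-4)] g by auto
    show "(\<lambda>x\<in>tup. ip (A x) h) (x(i := c \<odot>\<^bsub>X i\<^esub> d)) = c \<odot>\<^bsub>scalar_space K\<^esub> (\<lambda>x\<in>tup. ip (A x) h) (x(i := d))"
      unfolding restrict_apply'[OF t(1)] restrict_apply'[OF t(2)] multilinearD(3)[OF mA g]
      using H.ip_smult[OF g(3) AH[OF t(2)] h] by simp
  qed
  show "(\<lambda>x\<in>tup. ip (A x) h) \<in> bounded_forms" if h: "h \<in> carrier H"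
  proof -
    have "cmod (ip (A x) h) \<le> multilinear_norm n X H A * vnorm H h * pnorm x" if x: "x \<in> tup" for x
      using order_trans[OF cs[OF AH[OF x] h] mult_right_mono[OF multilinear_norm_bound(1)[OF N.normed_space_axioms A x] N.norm_nonneg[OF h]]]
      by (simp only: mult_ac)
    thus ?thesis using forms[OF h] by (auto simp: bounded_multilinear_def simp del: One_nat_def)
  qed
  let ?h = "A a \<ominus>\<^bsub>H\<^esub> A b" and ?N = "multilinear_norm n X H A"
  have h: "?h \<in> carrier H" using AH ab by simp
  have N0: "0 \<le> ?N" by (rule multilinear_norm_bound(2)[OF N.normed_space_axioms A ab(1)])
  \<comment> \<open>The representation is tested on the single form given by \<open>?h\<close>;
    after Cauchy-Schwarz one factor \<open>vnorm H ?h\<close> cancels.\<close>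
  have main: "vnorm H ?h \<le> ?N * (\<Sum>j<m. pnorm (x j))" if rep: "difference_rep a b m x" for m x
  proof -
    have xt: "x j \<in> tup" if "j < m" for j using rep that by (simp add: difference_rep_def)
    let ?S = "\<Sum>j<m. pnorm (x j)"
    have "ip ?h ?h = ip (A a) ?h - ip (A b) ?h" by (rule H.ip_minus_left) (use AH ab h in auto)
    also have "\<dots> = (\<Sum>j<m. ip (A (x j)) ?h)"
    proof -
      have "(\<lambda>x\<in>tup. ip (A x) ?h) a - (\<lambda>x\<in>tup. ip (A x) ?h) b = (\<Sum>j<m. (\<lambda>x\<in>tup. ip (A x) ?h) (x j))"
        using rep forms[OF h] unfolding difference_rep_def by blast
      thus ?thesis using ab xt by simp
    qed
    finally have eq: "ip ?h ?h = (\<Sum>j<m. ip (A (x j)) ?h)" .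
    have "(vnorm H ?h)\<^sup>2 = Re (ip ?h ?h)" using norm[OF h] H.ip_nonneg[OF h] by simp
    also have "\<dots> \<le> cmod (ip ?h ?h)" by (rule complex_Re_le_cmod)
    also have "\<dots> \<le> (\<Sum>j<m. cmod (ip (A (x j)) ?h))" unfolding eq by (rule norm_sum)
    also have "\<dots> \<le> (\<Sum>j<m. (?N * pnorm (x j)) * vnorm H ?h)"
    proof (rule sum_mono)
      fix j assume "j \<in> {..<m}"
      hence "x j \<in> tup" using xt by simp
      thus "cmod (ip (A (x j)) ?h) \<le> (?N * pnorm (x j)) * vnorm H ?h"
        by (intro order_trans[OF cs[OF AH h]] mult_right_mono multilinear_norm_bound(1)[OF N.normed_space_axioms A] N.norm_nonneg[OF h])
    qed
    also have "\<dots> = (?N * ?S) * vnorm H ?h" by (simp only: sum_distrib_left sum_distrib_right)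
    finally have "vnorm H ?h * vnorm H ?h \<le> (?N * ?S) * vnorm H ?h" by (simp only: power2_eq_square)
    moreover have "0 \<le> ?N * ?S" by (rule mult_nonneg_nonneg[OF N0 difference_rep_sum_nonneg[OF rep]])
    ultimately show ?thesis using N.norm_nonneg[OF h] by (cases "vnorm H ?h = 0") auto
  qed
  show "vnorm H ?h \<le> ?N * proj_dist a b"
  proof (cases "?N = 0")
    case True
    have "proj_dist a b \<ge> 0" by (rule proj_dist_nonneg[OF ab])
    \<comment> \<open>If the norm of \<open>A\<close> is 0, one representation suffices. If there
      were none, every number would be a lower bound in \<open>proj_dist_greatest\<close>, even
      \<open>proj_dist a b + 1\<close>.\<close>
    moreover have "\<exists>m x. difference_rep a b m x"
    proof (rule ccontr)
      assume "\<nexists>m x. difference_rep a b m x"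
      hence "proj_dist a b + 1 \<le> proj_dist a b" by (intro proj_dist_greatest[OF ab]) auto
      thus False by simp
    qed
    ultimately show ?thesis using main True by force
  next
    case False
    hence pos: "0 < ?N" using N0 by simp
    have "vnorm H ?h / ?N \<le> proj_dist a b"
      by (rule proj_dist_greatest[OF ab]) (use main pos in \<open>simp add: divide_le_eq mult.commute del: One_nat_def\<close>)
    thus ?thesis using pos by (simp add: divide_le_eq mult.commute)
  qed
qed

text \<open>The infimum is attained: at positive distance every Lipschitz constant is at least the
  quotient, hence so is the infimum, and at distance 0 any one constant already forces the left side
  to be at most 0.\<close>

lemma Lip_bound:
  assumes "lipschitz_const H V M B L" and nonneg: "\<And>g h. g \<in> M \<Longrightarrow> h \<in> M \<Longrightarrow> 0 \<le> vnorm H (g \<ominus>\<^bsub>H\<^esub> h)"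
  shows "lipschitz_const H V M B (Lip H V M B)"
  unfolding lipschitz_const_def
proof (intro conjI ballI)
  let ?S = "{L. lipschitz_const H V M B L}"
  have ne: "?S \<noteq> {}" using assms by auto
  show "0 \<le> Lip H V M B" unfolding Lip_def by (rule cInf_greatest[OF ne]) (auto simp: lipschitz_const_def)
  fix g h assume gh: "g \<in> M" "h \<in> M"
  show "vnorm V (B g \<ominus>\<^bsub>V\<^esub> B h) \<le> Lip H V M B * vnorm H (g \<ominus>\<^bsub>H\<^esub> h)"
  proof (cases "vnorm H (g \<ominus>\<^bsub>H\<^esub> h) = 0")
    case True
    thus ?thesis using assms(1) gh by (fastforce simp: lipschitz_const_def)
  next
    case False
    hence pos: "0 < vnorm H (g \<ominus>\<^bsub>H\<^esub> h)" using nonneg[OF gh] by simp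
    have "vnorm V (B g \<ominus>\<^bsub>V\<^esub> B h) / vnorm H (g \<ominus>\<^bsub>H\<^esub> h) \<le> Lip H V M B"
      unfolding Lip_def
      by (rule cInf_greatest[OF ne]) (use pos gh in \<open>auto simp: lipschitz_const_def divide_le_eq\<close>)
    thus ?thesis using pos by (simp add: divide_le_eq)
  qed
qed

text \<open>\<open>f\<close> may be any linear functional agreeing with \<open>T\<close> on
  elementary tensors, because the bound is used twice: for a given functional it bounds the dual
  norm by \<open>gamma_functional\<close>, and for \<open>operator_functional T\<close> it gives the
  boundedness behind surjectivity.\<close>

theorem factorization_bound:
  assumes fact: "hilbert_factorization K n X D T H M A B" and T: "multilinear K n X D T"
    and f: "linear_on K tensors2 (scalar_space K) f"
    and fT: "\<And>x y. x \<in> tup \<Longrightarrow> y \<in> carrier Y \<Longrightarrow> f (et2 (et x) y) = T x y"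
    and u: "u \<in> carrier tensors2"
  shows "cmod (f u) \<le> multilinear_norm n X H A * Lip H D M B * gamma_norm K n X Y u"
proof -
  have hs: "hilbert_space K H" and MH: "M \<subseteq> carrier H" and bA: "bounded_multilinear K n X H A"
    and AM: "A ` tup \<subseteq> M" and lip: "\<exists>L. lipschitz_const H D M B L" and TB: "\<And>x. x \<in> tup \<Longrightarrow> T x = B (A x)"
    using fact by (auto simp: hilbert_factorization_def)
  interpret H: banach_space K H using hs by (simp add: hilbert_space_def)
  obtain ip where ip: "inner_product K H ip" and norm: "\<And>h. h \<in> carrier H \<Longrightarrow> vnorm H h = sqrt (Re (ip h h))"
    using hs by (auto simp: hilbert_space_def)
  interpret ip: inner_product K H ip by (rule ip)
  have AH: "A x \<in> carrier H" if "x \<in> tup" for x using AM MH that by auto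
  let ?N = "multilinear_norm n X H A" and ?L = "Lip H D M B"
  have N0: "0 \<le> ?N" by (rule multilinear_norm_bound(2)[OF H.normed_space_axioms bA zero_tuple_in])
  have lipL: "lipschitz_const H D M B ?L"
    using lip MH by (elim exE) (rule Lip_bound, auto intro: H.norm_nonneg)
  hence L0: "0 \<le> ?L" by (simp add: lipschitz_const_def)
  have main: "cmod (f u) \<le> ?N * ?L * gamma_cost zs ws" if rep: "gamma_rep u zs ws" for zs ws
  proof -
    have zs: "set zs \<subseteq> triples" and ws: "set ws \<subseteq> pairs" and u: "u = diff_tensor zs" and dom: "dominates zs ws"
      using rep by (auto simp: gamma_rep_def)
    let ?d = "\<lambda>x x'. vnorm H (A x \<ominus>\<^bsub>H\<^esub> A x')"
    have d0: "0 \<le> ?d x x'" if "x \<in> tup" "x' \<in> tup" for x x' using AH that by (intro H.norm_nonneg) simp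
    have step: "cmod (T x y - T x' y) \<le> ?L * (\<bar>?d x x'\<bar> * \<bar>vnorm Y y\<bar>)" if "(x, x', y) \<in> triples" for x x' y
    proof -
      have x: "x \<in> tup" "x' \<in> tup" "y \<in> carrier Y" using that by auto
      have TD: "T x \<in> carrier D" "T x' \<in> carrier D" using multilinearD(1)[OF T] x by auto
      have DD: "T x \<ominus>\<^bsub>D\<^esub> T x' \<in> carrier D"
        using abelian_group.minus_closed[OF abelian_group_dual_space(1)[OF K module_Y] TD] .
      have y0: "0 \<le> vnorm Y y" using normed_space.norm_nonneg[OF Y x(3)] .
      have "T x y - T x' y = (T x \<ominus>\<^bsub>D\<^esub> T x') y" using D_minus[OF TD] x by simp
      hence "cmod (T x y - T x' y) \<le> vnorm D (T x \<ominus>\<^bsub>D\<^esub> T x') * vnorm Y y"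
        using dual_space_norm_bound[OF Y K DD x(3)] by simp
      also have "vnorm D (T x \<ominus>\<^bsub>D\<^esub> T x') \<le> ?L * ?d x x'"
        using lipL AM x by (simp add: lipschitz_const_def TB image_subset_iff)
      hence "vnorm D (T x \<ominus>\<^bsub>D\<^esub> T x') * vnorm Y y \<le> (?L * ?d x x') * vnorm Y y" using y0 by (rule mult_right_mono)
      finally show ?thesis using d0[OF x(1,2)] y0 by (simp add: mult.assoc)
    qed
    \<comment> \<open>Domination is known for the single forms \<open>ip (A x) h\<close> with
      arbitrary \<open>h\<close>; \<open>sum_norm_mono\<close> passes to norms, producing the
      orthonormal vectors one at a time by deflation.\<close>
    have domH: "(\<Sum>(x, x', y)\<leftarrow>zs. (?d x x')\<^sup>2) \<le> (\<Sum>(a, b)\<leftarrow>ws. (?d a b)\<^sup>2)"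
    proof -
      let ?vs = "map (\<lambda>(x, x', y). A x \<ominus>\<^bsub>H\<^esub> A x') zs" and ?us = "map (\<lambda>(a, b). A a \<ominus>\<^bsub>H\<^esub> A b) ws"
      have sq: "Re (ip (A x \<ominus>\<^bsub>H\<^esub> A x') (A x \<ominus>\<^bsub>H\<^esub> A x')) = (?d x x')\<^sup>2" if "x \<in> tup" "x' \<in> tup" for x x'
        using AH that norm[of "A x \<ominus>\<^bsub>H\<^esub> A x'"] ip.ip_nonneg[of "A x \<ominus>\<^bsub>H\<^esub> A x'"] by simp
      have "(\<Sum>v\<leftarrow>?vs. Re (ip v v)) \<le> (\<Sum>w\<leftarrow>?us. Re (ip w w))"
      proof (rule ip.sum_norm_mono[OF K])
        show "set ?vs \<subseteq> carrier H" using zs AH by auto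
        show "set ?us \<subseteq> carrier H" using ws AH by auto
        fix h assume h: "h \<in> carrier H"
        let ?\<phi> = "\<lambda>x\<in>tup. ip (A x) h"
        have "?\<phi> \<in> bounded_forms" by (rule hilbert_norm_diff_le(2)[OF ip norm bA zero_tuple_in zero_tuple_in h])
        hence "(\<Sum>(x, x', y)\<leftarrow>zs. (cmod (?\<phi> x - ?\<phi> x'))\<^sup>2) \<le> (\<Sum>(a, b)\<leftarrow>ws. (cmod (?\<phi> a - ?\<phi> b))\<^sup>2)"
          using dom unfolding dominates_def by blast
        moreover have "(\<Sum>(x, x', y)\<leftarrow>zs. (cmod (?\<phi> x - ?\<phi> x'))\<^sup>2) = (\<Sum>v\<leftarrow>?vs. (cmod (ip v h))\<^sup>2)"
          unfolding map_map comp_def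
          by (rule arg_cong[of _ _ sum_list], rule map_cong[OF refl]) (use zs AH h in \<open>auto simp: ip.ip_minus_left\<close>)
        moreover have "(\<Sum>(a, b)\<leftarrow>ws. (cmod (?\<phi> a - ?\<phi> b))\<^sup>2) = (\<Sum>v\<leftarrow>?us. (cmod (ip v h))\<^sup>2)"
          unfolding map_map comp_def
          by (rule arg_cong[of _ _ sum_list], rule map_cong[OF refl]) (use ws AH h in \<open>auto simp: ip.ip_minus_left\<close>)
        ultimately show "(\<Sum>v\<leftarrow>?vs. (cmod (ip v h))\<^sup>2) \<le> (\<Sum>w\<leftarrow>?us. (cmod (ip w h))\<^sup>2)" by simp
      qed
      moreover have "(\<Sum>v\<leftarrow>?vs. Re (ip v v)) = (\<Sum>(x, x', y)\<leftarrow>zs. (?d x x')\<^sup>2)"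
        unfolding map_map comp_def
        by (rule arg_cong[of _ _ sum_list], rule map_cong[OF refl]) (use zs sq in auto)
      moreover have "(\<Sum>v\<leftarrow>?us. Re (ip v v)) = (\<Sum>(a, b)\<leftarrow>ws. (?d a b)\<^sup>2)"
        unfolding map_map comp_def
        by (rule arg_cong[of _ _ sum_list], rule map_cong[OF refl]) (use ws sq in auto)
      ultimately show ?thesis by simp
    qed
    also have "(\<Sum>(a, b)\<leftarrow>ws. (?d a b)\<^sup>2) \<le> (\<Sum>(a, b)\<leftarrow>ws. ?N\<^sup>2 * (proj_dist a b)\<^sup>2)"
    proof (rule sum_list_mono)
      fix w assume "w \<in> set ws"
      then obtain a b where w: "w = (a, b)" "a \<in> tup" "b \<in> tup" using ws by auto
      have "(?d a b)\<^sup>2 \<le> (?N * proj_dist a b)\<^sup>2"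
        by (rule power_mono[OF hilbert_norm_diff_le(1)[OF ip norm bA w(2,3)] d0[OF w(2,3)]])
      thus "(case w of (a, b) \<Rightarrow> (?d a b)\<^sup>2) \<le> (case w of (a, b) \<Rightarrow> ?N\<^sup>2 * (proj_dist a b)\<^sup>2)"
        by (simp add: w power_mult_distrib)
    qed
    also have "\<dots> = ?N\<^sup>2 * dist_sum ws"
      by (simp add: case_prod_unfold sum_list_const_mult)
    finally have "sqrt (\<Sum>(x, x', y)\<leftarrow>zs. (?d x x')\<^sup>2) \<le> sqrt (?N\<^sup>2 * dist_sum ws)"
      by (rule real_sqrt_le_mono)
    hence dN: "sqrt (\<Sum>(x, x', y)\<leftarrow>zs. (?d x x')\<^sup>2) \<le> ?N * sqrt (dist_sum ws)"
      using N0 by (simp add: real_sqrt_mult)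
    have "f u = (\<Sum>(x, x', y)\<leftarrow>zs. T x y - T x' y)"
      unfolding u linear_diff_tensor[OF f zs]
      by (rule arg_cong[of _ _ sum_list], rule map_cong[OF refl]) (use zs fT in auto)
    hence "cmod (f u) \<le> (\<Sum>z\<leftarrow>zs. cmod (case z of (x, x', y) \<Rightarrow> T x y - T x' y))" by (simp only: norm_sum_list_le)
    also have "\<dots> \<le> (\<Sum>z\<leftarrow>zs. case z of (x, x', y) \<Rightarrow> ?L * (\<bar>?d x x'\<bar> * \<bar>vnorm Y y\<bar>))"
      by (rule sum_list_mono) (use step zs in fastforce)
    also have "\<dots> = ?L * (\<Sum>z\<leftarrow>zs. \<bar>case z of (x, x', y) \<Rightarrow> ?d x x'\<bar> * \<bar>case z of (x, x', y) \<Rightarrow> vnorm Y y\<bar>)"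
      by (simp add: case_prod_unfold sum_list_const_mult)
    also have "\<dots> \<le> ?L * (sqrt (\<Sum>z\<leftarrow>zs. (case z of (x, x', y) \<Rightarrow> ?d x x')\<^sup>2) * sqrt (\<Sum>z\<leftarrow>zs. (case z of (x, x', y) \<Rightarrow> vnorm Y y)\<^sup>2))"
      by (rule mult_left_mono[OF sum_list_cauchy_schwarz L0])
    also have "\<dots> = ?L * (sqrt (\<Sum>(x, x', y)\<leftarrow>zs. (?d x x')\<^sup>2) * sqrt (\<Sum>(x, x', y)\<leftarrow>zs. (vnorm Y y)\<^sup>2))"
      by (simp add: case_prod_unfold)
    also have "\<dots> \<le> ?L * ((?N * sqrt (dist_sum ws)) * sqrt (\<Sum>(x, x', y)\<leftarrow>zs. (vnorm Y y)\<^sup>2))"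
      by (intro mult_left_mono[OF _ L0] mult_right_mono[OF dN] real_sqrt_ge_zero sum_list_nonneg) auto
    finally show ?thesis by (simp add: gamma_cost_def mult_ac)
  qed
  show ?thesis
  proof (cases "?N * ?L = 0")
    \<comment> \<open>Division by the constant is impossible here, but a single representation,
      dominated by its own pairs, already forces \<open>f u = 0\<close>.\<close>
    case True
    obtain zs where zs: "set zs \<subseteq> triples" "u = diff_tensor zs" using diff_tensor_exists[OF u] by blast
    have "gamma_rep u zs (map (\<lambda>(x, x', y). (x, x')) zs)"
      using zs by (auto simp: gamma_rep_def dominates_def comp_def case_prod_unfold)
    from main[OF this] show ?thesis unfolding True by simp
  next
    case False
    hence pos: "0 < ?N * ?L" using mult_nonneg_nonneg[OF N0 L0] by linarith
    have "cmod (f u) / (?N * ?L) \<le> gamma_norm K n X Y u"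
      by (rule gamma_norm_greatest[OF u]) (use main pos in \<open>simp add: divide_le_eq mult.commute\<close>)
    thus ?thesis using pos by (simp add: divide_le_eq mult.commute)
  qed
qed

end

section \<open>From functionals to factorizations\<close>

context gamma_setting
begin

section \<open>The operator of a bounded functional\<close>

abbreviation G :: "('a, 'y) tensor2 nspace" where
  "G \<equiv> gamma_tensor_space K n X Y"

lemma G_simps:
  "carrier G = carrier tensors2" "u \<oplus>\<^bsub>G\<^esub> v = u \<oplus>\<^bsub>tensors2\<^esub> v" "c \<odot>\<^bsub>G\<^esub> u = c \<odot>\<^bsub>tensors2\<^esub> u"
  "\<zero>\<^bsub>G\<^esub> = \<zero>\<^bsub>tensors2\<^esub>" "vnorm G = gamma_norm K n X Y"
  by (simp_all add: gamma_tensor_space_def add_norm_def)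

lemma linear_on_G: "linear_on K G F f \<longleftrightarrow> linear_on K tensors2 F f"
  by (simp add: linear_on_def G_simps)

abbreviation op_of :: "(('a, 'y) tensor2 \<Rightarrow> complex) \<Rightarrow> (nat \<Rightarrow> 'a) \<Rightarrow> 'y \<Rightarrow> complex" where
  "op_of \<equiv> duality_map K n X Y"

lemma op_of_apply: "x \<in> tup \<Longrightarrow> y \<in> carrier Y \<Longrightarrow> op_of f x y = f (et2 (et x) y)"
  by (simp add: duality_map_def)

lemma bform_zero_tuple: "\<beta> \<in> bforms \<Longrightarrow> y \<in> carrier Y \<Longrightarrow> \<beta> (et zero_tuple, y) = 0"
  using linear_on_zero[OF module_tensors bforms_linear(1)] by (simp add: et_zero_tuple)

text \<open>\<open>x \<otimes> y\<close> is \<open>(x - 0) \<otimes> y\<close>, a representation of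
  length 1 dominated by itself. The estimate makes each \<open>op_of f x\<close> a bounded
  functional on \<open>Y\<close>.\<close>

lemma gamma_norm_et2:
  assumes x: "x \<in> tup" and y: "y \<in> carrier Y"
  shows "gamma_norm K n X Y (et2 (et x) y) \<le> pnorm x * vnorm Y y"
proof -
  have "et2 (et x) y = diff_tensor [(x, zero_tuple, y)]"
    by (rule extensionalityI[OF et2_ext]) (use y in \<open>auto simp: diff_tensor_def et2_apply bform_zero_tuple\<close>)
  hence "gamma_rep (et2 (et x) y) [(x, zero_tuple, y)] [(x, zero_tuple)]"
    using x y zero_tuple_in by (simp add: gamma_rep_def dominates_def)
  from gamma_norm_le[OF this] have "gamma_norm K n X Y (et2 (et x) y) \<le> proj_dist x zero_tuple * vnorm Y y"
    using proj_dist_nonneg[OF x zero_tuple_in] normed_space.norm_nonneg[OF Y y] by (simp add: gamma_cost_def)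
  also have "\<dots> \<le> pnorm x * vnorm Y y"
    by (rule mult_right_mono[OF proj_dist_zero_right[OF x] normed_space.norm_nonneg[OF Y y]])
  finally show ?thesis .
qed

lemma functional_linear: "f \<in> carrier (dual_space K G) \<Longrightarrow> linear_on K tensors2 (scalar_space K) f"
  by (simp add: dual_space_simps linear_on_G)

lemma op_of_multilinear:
  assumes f: "f \<in> carrier (dual_space K G)"
  shows "multilinear K n X D (op_of f)"
  unfolding multilinear_def
proof (intro conjI ballI)
  note lin = functional_linear[OF f]
  obtain C where C: "\<forall>u\<in>carrier G. cmod (f u) \<le> C * vnorm G u" using f by (auto simp: dual_space_simps)
  have "op_of f x \<in> carrier D" if x: "x \<in> tup" for x
    unfolding dual_space_simps
  proof (intro conjI)
    show "op_of f x \<in> extensional (carrier Y)" using x by (simp add: duality_map_def)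
    have e: "et2 (et x) y \<in> carrier tensors2" if "y \<in> carrier Y" for y by (rule et2_in[OF et_in[OF x] that])
    show "linear_on K Y (scalar_space K) (op_of f x)"
      unfolding linear_on_def
    proof (intro conjI ballI)
      show "op_of f x \<in> carrier Y \<rightarrow> carrier (scalar_space K)"
        using linear_onD(1)[OF lin e] x by (simp add: op_of_apply)
    next
      fix y z assume y: "y \<in> carrier Y" "z \<in> carrier Y"
      interpret Y: module "scalar_space K" Y by (rule module_Y)
      show "op_of f x (y \<oplus>\<^bsub>Y\<^esub> z) = op_of f x y \<oplus>\<^bsub>scalar_space K\<^esub> op_of f x z"
        using linear_onD(2)[OF lin e[OF y(1)] e[OF y(2)]] x y by (simp add: op_of_apply et2_add_right[OF et_in])
    next
      fix c y assume y: "c \<in> K" "y \<in> carrier Y"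
      show "op_of f x (c \<odot>\<^bsub>Y\<^esub> y) = c \<odot>\<^bsub>scalar_space K\<^esub> op_of f x y"
        using linear_onD(3)[OF lin y(1) e[OF y(2)]] x y normed_space_sc[OF Y y]
        by (simp add: op_of_apply et2_smult_right[OF _ et_in])
    qed
    have "cmod (op_of f x y) \<le> (\<bar>C\<bar> * pnorm x) * vnorm Y y" if y: "y \<in> carrier Y" for y
    proof -
      have "cmod (op_of f x y) \<le> C * gamma_norm K n X Y (et2 (et x) y)"
        using C e[OF y] x y by (simp add: op_of_apply G_simps)
      also have "\<dots> \<le> \<bar>C\<bar> * gamma_norm K n X Y (et2 (et x) y)"
        using gamma_norm_nonneg[OF e[OF y]] by (intro mult_right_mono) auto
      also have "\<dots> \<le> \<bar>C\<bar> * (pnorm x * vnorm Y y)"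
        by (rule mult_left_mono[OF gamma_norm_et2[OF x y]]) simp
      finally show ?thesis by (simp only: mult.assoc)
    qed
    thus "\<exists>C. \<forall>y\<in>carrier Y. cmod (op_of f x y) \<le> C * vnorm Y y" by blast
  qed
  thus "op_of f \<in> tup \<rightarrow>\<^sub>E carrier D" by (auto simp: duality_map_def)
  fix x i assume h: "x \<in> tup" "i \<in> {1..n}"
  show "op_of f (x(i := a \<oplus>\<^bsub>X i\<^esub> b)) = op_of f (x(i := a)) \<oplus>\<^bsub>D\<^esub> op_of f (x(i := b))"
    if ab: "a \<in> carrier (X i)" "b \<in> carrier (X i)" for a b
  proof (rule extensionalityI[of _ "carrier Y"])
    have t: "x(i := a \<oplus>\<^bsub>X i\<^esub> b) \<in> tup" "x(i := a) \<in> tup" "x(i := b) \<in> tup"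
      using tuples_upd[OF h] X_add[OF h(2) ab] ab by auto
    show "op_of f (x(i := a \<oplus>\<^bsub>X i\<^esub> b)) \<in> extensional (carrier Y)" using t by (simp add: duality_map_def)
    show "op_of f (x(i := a)) \<oplus>\<^bsub>D\<^esub> op_of f (x(i := b)) \<in> extensional (carrier Y)" by (simp add: dual_space_simps)
    fix y assume y: "y \<in> carrier Y"
    show "op_of f (x(i := a \<oplus>\<^bsub>X i\<^esub> b)) y = (op_of f (x(i := a)) \<oplus>\<^bsub>D\<^esub> op_of f (x(i := b))) y"
      using linear_onD(2)[OF lin et2_in[OF et_in[OF t(2)] y] et2_in[OF et_in[OF t(3)] y]] y
      by (simp only: op_of_apply[OF t(1) y] et_add[OF h ab] et2_add_left[OF et_in[OF t(2)] et_in[OF t(3)] y])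
        (simp add: dual_space_simps op_of_apply t)
  qed
  show "op_of f (x(i := c \<odot>\<^bsub>X i\<^esub> a)) = c \<odot>\<^bsub>D\<^esub> op_of f (x(i := a))" if ca: "c \<in> K" "a \<in> carrier (X i)" for c a
  proof (rule extensionalityI[of _ "carrier Y"])
    have t: "x(i := c \<odot>\<^bsub>X i\<^esub> a) \<in> tup" "x(i := a) \<in> tup"
      using tuples_upd[OF h] X_smult[OF h(2) ca] ca by auto
    show "op_of f (x(i := c \<odot>\<^bsub>X i\<^esub> a)) \<in> extensional (carrier Y)" using t by (simp add: duality_map_def)
    show "c \<odot>\<^bsub>D\<^esub> op_of f (x(i := a)) \<in> extensional (carrier Y)" by (simp add: dual_space_simps)
    fix y assume y: "y \<in> carrier Y"
    show "op_of f (x(i := c \<odot>\<^bsub>X i\<^esub> a)) y = (c \<odot>\<^bsub>D\<^esub> op_of f (x(i := a))) y"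
      using linear_onD(3)[OF lin ca(1) et2_in[OF et_in[OF t(2)] y]] y
      by (simp only: op_of_apply[OF t(1) y] et_smult[OF h ca] et2_smult_left[OF ca(1) et_in[OF t(2)] y])
        (simp add: dual_space_simps op_of_apply t)
  qed
qed

lemma G_norm_nonneg: "u \<in> carrier G \<Longrightarrow> 0 \<le> vnorm G u"
  by (simp add: G_simps gamma_norm_nonneg)

lemma G_zero: "\<zero>\<^bsub>G\<^esub> \<in> carrier G" "vnorm G \<zero>\<^bsub>G\<^esub> \<le> 1"
proof -
  show "\<zero>\<^bsub>G\<^esub> \<in> carrier G" using diff_tensor_in[of "[]"] by (simp add: G_simps diff_tensor_Nil)
  have "gamma_rep \<zero>\<^bsub>tensors2\<^esub> [] []" by (simp add: gamma_rep_def diff_tensor_Nil dominates_def)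
  from gamma_norm_le[OF this] show "vnorm G \<zero>\<^bsub>G\<^esub> \<le> 1" by (simp add: G_simps gamma_cost_def)
qed

lemma functional_norm_nonneg: "f \<in> carrier (dual_space K G) \<Longrightarrow> 0 \<le> vnorm (dual_space K G) f"
  using order_trans[OF norm_ge_zero dual_space_norm_upper[OF G_norm_nonneg _ G_zero]] .

lemma functional_diff_tensor:
  assumes f: "f \<in> carrier (dual_space K G)" and zs: "set zs \<subseteq> triples"
  shows "f (diff_tensor zs) = (\<Sum>(x, x', y)\<leftarrow>zs. op_of f x y - op_of f x' y)"
  unfolding linear_diff_tensor[OF functional_linear[OF f] zs]
  by (rule arg_cong[of _ _ sum_list], rule map_cong[OF refl]) (use zs in \<open>auto simp: op_of_apply\<close>)

text \<open>The dual norm controls \<open>f\<close> on the unit ball of gamma. Dividing all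
  \<open>y\<close> by some \<open>t\<close> above the cost brings the cost of the representation to
  at most 1; taking \<open>t\<close> strictly larger keeps the division legitimate when the cost is
  0, and \<open>t\<close> may be arbitrarily close to the cost.\<close>

lemma functional_bound:
  assumes f: "f \<in> carrier (dual_space K G)" and zs: "set zs \<subseteq> triples" and ws: "set ws \<subseteq> pairs"
    and dom: "dominates zs ws"
  shows "cmod (\<Sum>(x, x', y)\<leftarrow>zs. op_of f x y - op_of f x' y) \<le> vnorm (dual_space K G) f * gamma_cost zs ws"
    (is "cmod ?S \<le> ?C * ?t")
proof -
  have le: "cmod ?S \<le> ?C * t" if t: "?t < t" for t
  proof -
    have t0: "0 < t" using gamma_cost_nonneg[of zs ws] t by simp
    define c :: complex where "c = of_real (1 / t)"
    have c: "c \<in> K" using K by (auto simp: c_def)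
    let ?zs = "map (\<lambda>(x, x', y). (x, x', c \<odot>\<^bsub>Y\<^esub> y)) zs"
    have zs': "set ?zs \<subseteq> triples" using zs normed_space_sc[OF Y c] by auto
    have "dominates ?zs ws" using dom by (simp add: dominates_def comp_def case_prod_unfold)
    hence rep: "gamma_rep (diff_tensor ?zs) ?zs ws" using zs' ws by (simp add: gamma_rep_def)
    have "(\<Sum>(x, x', y)\<leftarrow>?zs. (vnorm Y y)\<^sup>2) = (\<Sum>(x, x', y)\<leftarrow>zs. (1 / t)\<^sup>2 * (vnorm Y y)\<^sup>2)"
      unfolding map_map comp_def
      by (rule arg_cong[of _ _ sum_list], rule map_cong[OF refl])
        (use zs normed_space.norm_smult[OF Y c] in \<open>auto simp: c_def norm_divide power_mult_distrib power_divide\<close>)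
    also have "\<dots> = (1 / t)\<^sup>2 * (\<Sum>(x, x', y)\<leftarrow>zs. (vnorm Y y)\<^sup>2)"
      by (simp only: case_prod_unfold sum_list_const_mult)
    finally have "gamma_cost ?zs ws = ?t / t" using t0 by (simp add: gamma_cost_def real_sqrt_mult real_sqrt_divide)
    moreover have "?t / t \<le> 1" using t t0 by simp
    ultimately have "gamma_norm K n X Y (diff_tensor ?zs) \<le> 1" using gamma_norm_le[OF rep] by linarith
    hence "cmod (f (diff_tensor ?zs)) \<le> ?C"
      by (intro dual_space_norm_upper[OF G_norm_nonneg f]) (simp_all add: G_simps diff_tensor_in[OF zs'])
    moreover have "f (diff_tensor ?zs) = c * ?S"
    proof -
      have "op_of f x (c \<odot>\<^bsub>Y\<^esub> y) = c * op_of f x y" if "x \<in> tup" "y \<in> carrier Y" for x y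
        using linear_onD(3)[OF D_linear[OF multilinearD(1)[OF op_of_multilinear[OF f] that(1)]] c that(2)] by simp
      hence "f (diff_tensor ?zs) = (\<Sum>(x, x', y)\<leftarrow>zs. c * (op_of f x y - op_of f x' y))"
        unfolding functional_diff_tensor[OF f zs'] map_map comp_def
        by (intro arg_cong[of _ _ sum_list] map_cong[OF refl]) (use zs in \<open>auto simp: right_diff_distrib\<close>)
      thus ?thesis by (simp only: case_prod_unfold sum_list_const_mult)
    qed
    ultimately show ?thesis using t0 by (simp add: c_def norm_mult norm_divide divide_le_eq)
  qed
  show ?thesis
  proof (rule ccontr)
    assume "\<not> ?thesis"
    hence less: "?C * ?t < cmod ?S" by simp
    \<comment> \<open>If the norm of \<open>f\<close> is 0, a single \<open>t\<close> gives the
      contradiction; otherwise \<open>t\<close> is chosen strictly between the cost and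
      \<open>cmod ?S / ?C\<close>.\<close>
    show False
    proof (cases "?C = 0")
      case True
      thus False using le[of "?t + 1"] less by simp
    next
      case False
      hence C: "0 < ?C" using functional_norm_nonneg[OF f] by simp
      hence "?t < cmod ?S / ?C" using less by (simp add: less_divide_eq mult.commute)
      then obtain t where t: "?t < t" "t < cmod ?S / ?C" using dense by blast
      hence "?C * t < cmod ?S" using C by (simp add: less_divide_eq mult.commute)
      thus False using le[OF t(1)] by simp
    qed
  qed
qed

lemma functional_square_bound:
  assumes f: "f \<in> carrier (dual_space K G)" and zs: "set zs \<subseteq> triples" and ws: "set ws \<subseteq> pairs"
    and dom: "dominates zs ws" and ball: "\<And>x x' y. (x, x', y) \<in> set zs \<Longrightarrow> vnorm Y y \<le> 1"
  shows "(\<Sum>(x, x', y)\<leftarrow>zs. (cmod (op_of f x y - op_of f x' y))\<^sup>2) \<le>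
    (vnorm (dual_space K G) f)\<^sup>2 * dist_sum ws" (is "?S \<le> ?C\<^sup>2 * ?P")
proof -
  define r where "r x x' y = op_of f x y - op_of f x' y" for x x' y
  note lin = D_linear[OF multilinearD(1)[OF op_of_multilinear[OF f]]]
  have rK: "cnj (r x x' y) \<in> K" if "(x, x', y) \<in> triples" for x x' y
    using K linear_onD(1)[OF lin, of x y] linear_onD(1)[OF lin, of x' y] that by (auto simp: r_def Reals_cnj_iff)
  let ?zs = "map (\<lambda>(x, x', y). (x, x', cnj (r x x' y) \<odot>\<^bsub>Y\<^esub> y)) zs"
  have zs': "set ?zs \<subseteq> triples" using zs normed_space_sc[OF Y rK] by auto
  have dom': "dominates ?zs ws" using dom by (simp add: dominates_def comp_def case_prod_unfold)
  have S0: "0 \<le> ?S" and P0: "0 \<le> ?P" by (auto intro!: sum_list_nonneg)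
  have "(\<Sum>(x, x', y)\<leftarrow>?zs. op_of f x y - op_of f x' y) = (\<Sum>(x, x', y)\<leftarrow>zs. of_real ((cmod (r x x' y))\<^sup>2))"
    unfolding map_map comp_def
  proof (intro arg_cong[of _ _ sum_list] map_cong[OF refl])
    fix z assume "z \<in> set zs"
    then obtain x x' y where z: "z = (x, x', y)" "(x, x', y) \<in> triples" using zs by (cases z) auto
    have "op_of f v (cnj (r x x' y) \<odot>\<^bsub>Y\<^esub> y) = cnj (r x x' y) * op_of f v y" if "v \<in> tup" for v
      using linear_onD(3)[OF lin[OF that] rK[OF z(2)]] z(2) by simp
    hence "op_of f x (cnj (r x x' y) \<odot>\<^bsub>Y\<^esub> y) - op_of f x' (cnj (r x x' y) \<odot>\<^bsub>Y\<^esub> y) = r x x' y * cnj (r x x' y)"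
      using z(2) by (simp add: r_def algebra_simps)
    thus "(case case z of (x, x', y) \<Rightarrow> (x, x', cnj (r x x' y) \<odot>\<^bsub>Y\<^esub> y) of (x, x', y) \<Rightarrow> op_of f x y - op_of f x' y) =
        (case z of (x, x', y) \<Rightarrow> of_real ((cmod (r x x' y))\<^sup>2))"
      by (simp add: z(1) complex_norm_square del: of_real_power)
  qed
  also have "\<dots> = of_real ?S"
    by (induction zs) (auto simp: r_def)
  finally have "?S \<le> ?C * gamma_cost ?zs ws"
    using functional_bound[OF f zs' ws dom'] S0 by simp
  \<comment> \<open>Since \<open>vnorm Y y \<le> 1\<close>, the weighted vectors have square sum at
    most \<open>?S\<close>, the very quantity to be estimated. This leaves
    \<open>?S \<le> ?C * (sqrt ?P * sqrt ?S)\<close>, where one factor \<open>sqrt ?S\<close>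
    cancels.\<close>
  also have "gamma_cost ?zs ws \<le> sqrt ?P * sqrt ?S"
  proof -
    have "(\<Sum>(x, x', y)\<leftarrow>?zs. (vnorm Y y)\<^sup>2) \<le> ?S"
      unfolding map_map comp_def
    proof (rule sum_list_mono)
      fix z assume zin: "z \<in> set zs"
      obtain x x' y where z1: "z = (x, x', y)" by (cases z)
      have z2: "(x, x', y) \<in> triples" and z3: "vnorm Y y \<le> 1" using zin zs ball z1 by auto
      note z = z1 z2 z3
      have "vnorm Y (cnj (r x x' y) \<odot>\<^bsub>Y\<^esub> y) = cmod (r x x' y) * vnorm Y y"
        using normed_space.norm_smult[OF Y rK[OF z(2)]] z(2) by simp
      moreover have "cmod (r x x' y) * vnorm Y y \<le> cmod (r x x' y)"
        using z(3) mult_left_mono[of "vnorm Y y" 1 "cmod (r x x' y)"] by simp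
      moreover have "0 \<le> cmod (r x x' y) * vnorm Y y"
        using normed_space.norm_nonneg[OF Y] z(2) by simp
      ultimately have "(vnorm Y (cnj (r x x' y) \<odot>\<^bsub>Y\<^esub> y))\<^sup>2 \<le> (cmod (r x x' y))\<^sup>2"
        by (simp only: power_mono)
      thus "(case case z of (x, x', y) \<Rightarrow> (x, x', cnj (r x x' y) \<odot>\<^bsub>Y\<^esub> y) of (x, x', y) \<Rightarrow> (vnorm Y y)\<^sup>2) \<le>
          (case z of (x, x', y) \<Rightarrow> (cmod (op_of f x y - op_of f x' y))\<^sup>2)"
        by (simp add: z(1) r_def)
    qed
    thus ?thesis unfolding gamma_cost_def using P0 by (intro mult_left_mono real_sqrt_le_mono) auto
  qed
  hence "?C * gamma_cost ?zs ws \<le> ?C * (sqrt ?P * sqrt ?S)"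
    by (rule mult_left_mono[OF _ functional_norm_nonneg[OF f]])
  finally have le: "?S \<le> ?C * (sqrt ?P * sqrt ?S)" .
  have "sqrt ?S \<le> ?C * sqrt ?P"
  proof (cases "?S = 0")
    case True
    show ?thesis unfolding True using functional_norm_nonneg[OF f] P0 by simp
  next
    case False
    hence "0 < ?S" using S0 by linarith
    hence pos: "0 < sqrt ?S" by (rule real_sqrt_gt_zero)
    have "sqrt ?S * sqrt ?S \<le> (?C * sqrt ?P) * sqrt ?S"
      using le S0 by (simp only: real_sqrt_mult_self abs_of_nonneg mult.assoc)
    thus ?thesis using pos by (rule mult_right_le_imp_le)
  qed
  hence "(sqrt ?S)\<^sup>2 \<le> (?C * sqrt ?P)\<^sup>2" by (rule power_mono) (simp only: real_sqrt_ge_zero S0)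
  thus ?thesis using S0 P0 by (simp only: real_sqrt_pow2 power_mult_distrib)
qed

text \<open>A point seen as a function of forms. With the value 0 off the bounded forms, a pointwise
  inequality on the whole type between sums of the functions \<open>form_dist\<close> is the same as
  domination.\<close>

definition form_eval :: "(nat \<Rightarrow> 'a) \<Rightarrow> ((nat \<Rightarrow> 'a) \<Rightarrow> complex) \<Rightarrow> complex" where
  "form_eval x = (\<lambda>\<phi>. if \<phi> \<in> bounded_forms then \<phi> x else 0)"

definition form_dist :: "(nat \<Rightarrow> 'a) \<Rightarrow> (nat \<Rightarrow> 'a) \<Rightarrow> ((nat \<Rightarrow> 'a) \<Rightarrow> complex) \<Rightarrow> real" where
  "form_dist a b = (\<lambda>\<phi>. (cmod (form_eval a \<phi> - form_eval b \<phi>))\<^sup>2)"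

lemma form_eval_add:
  assumes "x \<in> tup" "i \<in> {1..n}" "a \<in> carrier (X i)" "b \<in> carrier (X i)"
  shows "form_eval (x(i := a \<oplus>\<^bsub>X i\<^esub> b)) = form_eval (x(i := a)) + form_eval (x(i := b))"
  using multilinearD(2)[of "scalar_space K" _ x i a b] assms
  by (auto simp: form_eval_def fun_eq_iff bounded_multilinear_def)

lemma form_eval_smult:
  assumes "x \<in> tup" "i \<in> {1..n}" "c \<in> K" "a \<in> carrier (X i)"
  shows "form_eval (x(i := c \<odot>\<^bsub>X i\<^esub> a)) = (\<lambda>\<phi>. c * form_eval (x(i := a)) \<phi>)"
  using multilinearD(3)[of "scalar_space K" _ x i c a] assms
  by (auto simp: form_eval_def fun_eq_iff bounded_multilinear_def)

lemma form_eval_in_K: "x \<in> tup \<Longrightarrow> form_eval x \<phi> \<in> K"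
  using multilinearD(1)[of "scalar_space K" \<phi> x] K by (auto simp: form_eval_def bounded_multilinear_def)

lemma form_dist_scale1:
  assumes "c \<in> K" "a \<in> tup" "b \<in> tup"
  shows "form_dist (scale1 c a) (scale1 c b) \<phi> = (cmod c)\<^sup>2 * form_dist a b \<phi>"
proof -
  have "form_eval (scale1 c x) \<phi> = c * form_eval x \<phi>" if "x \<in> tup" for x
    using form_scale1[OF bounded_forms_forms assms(1) that] by (auto simp: form_eval_def)
  thus ?thesis
    using assms by (simp add: form_dist_def right_diff_distrib[symmetric] norm_mult power_mult_distrib)
qed

lemma form_dist_zero_right: "form_dist a zero_tuple \<phi> = (cmod (form_eval a \<phi>))\<^sup>2"
proof (cases "\<phi> \<in> bounded_forms")
  case True
  show ?thesis using form_zero_tuple[OF bounded_forms_forms[OF True]] by (simp add: form_dist_def form_eval_def)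
qed (simp add: form_dist_def form_eval_def)

text \<open>The hypothesis \<open>bound\<close> is the consistency condition of
  \<open>positive_functional_between\<close> for the cones generated by \<open>SU\<close> and
  \<open>SV\<close>. Each \<open>y\<close> in the unit ball contributes its own lower bound in
  \<open>SV\<close>, so that the supremum over \<open>y\<close> recovers the dual norm of
  \<open>T a - T b\<close>.\<close>

theorem square_bound_factorization:
  assumes T: "multilinear K n X D T" and C: "0 \<le> C"
    and bound: "\<And>zs ws. set zs \<subseteq> triples \<Longrightarrow> set ws \<subseteq> pairs \<Longrightarrow> dominates zs ws \<Longrightarrow>
      (\<And>x x' y. (x, x', y) \<in> set zs \<Longrightarrow> vnorm Y y \<le> 1) \<Longrightarrow>
      (\<Sum>(x, x', y)\<leftarrow>zs. (cmod (T x y - T x' y))\<^sup>2) \<le> C\<^sup>2 * dist_sum ws"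
  obtains H :: "((((nat \<Rightarrow> 'a) \<Rightarrow> complex) \<Rightarrow> complex) \<Rightarrow> complex) nspace" and M A B
  where "hilbert_factorization K n X D T H M A B" "multilinear_norm n X H A \<le> C" "Lip H D M B \<le> 1"
proof -
  define SU where "SU = {(form_dist a b, s) | a b s. a \<in> tup \<and> b \<in> tup \<and> C\<^sup>2 * (proj_dist a b)\<^sup>2 \<le> s}"
  define SV where "SV = {(form_dist x x', (cmod (T x y - T x' y))\<^sup>2) | x x' y.
    x \<in> tup \<and> x' \<in> tup \<and> y \<in> carrier Y \<and> vnorm Y y \<le> 1}"
  have SU: "(form_dist a b, s) \<in> SU" if "a \<in> tup" "b \<in> tup" "C\<^sup>2 * (proj_dist a b)\<^sup>2 \<le> s" for a b s
    unfolding SU_def using that by blast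
  have SV: "(form_dist x x', (cmod (T x y - T x' y))\<^sup>2) \<in> SV"
    if "x \<in> tup" "x' \<in> tup" "y \<in> carrier Y" "vnorm Y y \<le> 1" for x x' y
    unfolding SV_def using that by blast
  \<comment> \<open>\<open>form_dist\<close> is quadratic, so a factor \<open>c\<close> on it arises
    from the factor \<open>sqrt c\<close> in the first slot of both tuples.\<close>
  have sq: "of_real (sqrt c) \<in> K" "(cmod (of_real (sqrt c)))\<^sup>2 = c" if "0 < c" for c
    using K that by auto
  let ?sc = "\<lambda>c. scale1 (of_real (sqrt c))"
  have sc_in: "?sc c x \<in> tup" if "0 < c" "x \<in> tup" for c x by (rule scale1_in[OF sq(1)[OF that(1)] that(2)])
  have sc_dist: "form_dist (?sc c a) (?sc c b) = c *\<^sub>R form_dist a b" if "0 < c" "a \<in> tup" "b \<in> tup" for c a b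
    using form_dist_scale1[OF sq(1)[OF that(1)] that(2,3)] sq(2)[OF that(1)] by (simp add: fun_eq_iff scaleR_fun_def)
  have U: "pair_cone (cone_hull SU)"
  proof (rule pair_cone_cone_hull)
    fix g s and c :: real assume gs: "(g, s) \<in> SU" and c: "0 < c"
    then obtain a b where ab: "g = form_dist a b" "a \<in> tup" "b \<in> tup" "C\<^sup>2 * (proj_dist a b)\<^sup>2 \<le> s"
      by (auto simp: SU_def)
    have "proj_dist (?sc c a) (?sc c b) \<le> sqrt c * proj_dist a b"
      by (rule proj_dist_scale1[OF ab(2,3)]) (use c in simp)
    hence "(proj_dist (?sc c a) (?sc c b))\<^sup>2 \<le> (sqrt c * proj_dist a b)\<^sup>2"
      by (rule power_mono) (intro proj_dist_nonneg sc_in c ab)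
    hence "C\<^sup>2 * (proj_dist (?sc c a) (?sc c b))\<^sup>2 \<le> C\<^sup>2 * (sqrt c * proj_dist a b)\<^sup>2"
      by (rule mult_left_mono[OF _ zero_le_power2])
    also have "\<dots> = c * (C\<^sup>2 * (proj_dist a b)\<^sup>2)" using c by (simp add: power_mult_distrib)
    also have "\<dots> \<le> c * s" by (rule mult_left_mono[OF ab(4) less_imp_le[OF c]])
    finally show "(c *\<^sub>R g, c * s) \<in> SU"
      using SU[OF sc_in[OF c ab(2)] sc_in[OF c ab(3)]] by (simp add: ab(1) sc_dist[OF c ab(2,3)])
  qed
  have V: "pair_cone (cone_hull SV)"
  proof (rule pair_cone_cone_hull)
    fix h t and c :: real assume ht: "(h, t) \<in> SV" and c: "0 < c"
    then obtain x x' y where x: "h = form_dist x x'" "t = (cmod (T x y - T x' y))\<^sup>2" "x \<in> tup" "x' \<in> tup"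
      "y \<in> carrier Y" "vnorm Y y \<le> 1" by (auto simp: SV_def)
    have "T (?sc c v) y = of_real (sqrt c) * T v y" if "v \<in> tup" for v
      unfolding multilinear_scale1[OF T sq(1)[OF c] that] using x(5) by (simp add: dual_space_simps)
    hence "T (?sc c x) y - T (?sc c x') y = of_real (sqrt c) * (T x y - T x' y)"
      using x by (simp add: right_diff_distrib)
    hence "(cmod (T (?sc c x) y - T (?sc c x') y))\<^sup>2 = c * t"
      using sq(2)[OF c] by (simp only: norm_mult power_mult_distrib x(2))
    thus "(c *\<^sub>R h, c * t) \<in> SV"
      using SV[OF sc_in[OF c x(3)] sc_in[OF c x(4)] x(5,6)] by (simp add: x(1) sc_dist[OF c x(3,4)])
  qed
  have SU_list: "\<exists>ws. set ws \<subseteq> pairs \<and> (\<forall>\<phi>. (\<Sum>(g, s)\<leftarrow>us. g \<phi>) = (\<Sum>(a, b)\<leftarrow>ws. form_dist a b \<phi>)) \<and>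
      C\<^sup>2 * dist_sum ws \<le> (\<Sum>(g, s)\<leftarrow>us. s)" if "set us \<subseteq> SU" for us
    using that
  proof (induction us)
    case (Cons u us)
    then obtain ws where ws: "set ws \<subseteq> pairs" "\<forall>\<phi>. (\<Sum>(g, s)\<leftarrow>us. g \<phi>) = (\<Sum>(a, b)\<leftarrow>ws. form_dist a b \<phi>)"
      "C\<^sup>2 * dist_sum ws \<le> (\<Sum>(g, s)\<leftarrow>us. s)" by auto
    obtain a b s where u: "u = (form_dist a b, s)" "a \<in> tup" "b \<in> tup" "C\<^sup>2 * (proj_dist a b)\<^sup>2 \<le> s"
      using Cons.prems by (auto simp: SU_def)
    show ?case by (rule exI[of _ "(a, b) # ws"]) (use ws u in \<open>auto simp: distrib_left\<close>)
  qed (auto intro!: exI[of _ "[]"])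
  have SV_list: "\<exists>zs. set zs \<subseteq> tup \<times> tup \<times> {y \<in> carrier Y. vnorm Y y \<le> 1} \<and>
      (\<forall>\<phi>. (\<Sum>(h, t)\<leftarrow>us. h \<phi>) = (\<Sum>(x, x', y)\<leftarrow>zs. form_dist x x' \<phi>)) \<and>
      (\<Sum>(h, t)\<leftarrow>us. t) = (\<Sum>(x, x', y)\<leftarrow>zs. (cmod (T x y - T x' y))\<^sup>2)" if "set us \<subseteq> SV" for us
    using that
  proof (induction us)
    case (Cons u us)
    then obtain zs where zs: "set zs \<subseteq> tup \<times> tup \<times> {y \<in> carrier Y. vnorm Y y \<le> 1}"
      "\<forall>\<phi>. (\<Sum>(h, t)\<leftarrow>us. h \<phi>) = (\<Sum>(x, x', y)\<leftarrow>zs. form_dist x x' \<phi>)"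
      "(\<Sum>(h, t)\<leftarrow>us. t) = (\<Sum>(x, x', y)\<leftarrow>zs. (cmod (T x y - T x' y))\<^sup>2)" by auto
    obtain x x' y where u: "u = (form_dist x x', (cmod (T x y - T x' y))\<^sup>2)" "x \<in> tup" "x' \<in> tup"
      "y \<in> carrier Y" "vnorm Y y \<le> 1" using Cons.prems by (auto simp: SV_def)
    show ?case by (rule exI[of _ "(x, x', y) # zs"]) (use zs u in auto)
  qed (auto intro!: exI[of _ "[]"])
  have consistent: "t \<le> s" if gs: "(g, s) \<in> cone_hull SU" and ht: "(h, t) \<in> cone_hull SV"
    and le: "\<And>\<phi>. h \<phi> \<le> g \<phi>" for g s h t
  proof -
    obtain us where us: "set us \<subseteq> SU" "g = (\<lambda>\<phi>. \<Sum>(g, s)\<leftarrow>us. g \<phi>)" "s = (\<Sum>(g, s)\<leftarrow>us. s)"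
      using gs by (auto simp: cone_hull_def)
    obtain ws where ws: "set ws \<subseteq> pairs" "\<And>\<phi>. g \<phi> = (\<Sum>(a, b)\<leftarrow>ws. form_dist a b \<phi>)" "C\<^sup>2 * dist_sum ws \<le> s"
      unfolding us(2,3) using SU_list[OF us(1)] by blast
    obtain vs where vs: "set vs \<subseteq> SV" "h = (\<lambda>\<phi>. \<Sum>(h, t)\<leftarrow>vs. h \<phi>)" "t = (\<Sum>(h, t)\<leftarrow>vs. t)"
      using ht by (auto simp: cone_hull_def)
    obtain zs where zs: "set zs \<subseteq> tup \<times> tup \<times> {y \<in> carrier Y. vnorm Y y \<le> 1}"
      "\<And>\<phi>. h \<phi> = (\<Sum>(x, x', y)\<leftarrow>zs. form_dist x x' \<phi>)"
      "t = (\<Sum>(x, x', y)\<leftarrow>zs. (cmod (T x y - T x' y))\<^sup>2)"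
      unfolding vs(2,3) using SV_list[OF vs(1)] by blast
    \<comment> \<open>At a bounded form \<open>le\<close> is the inequality required; the lists come
      from unfolding the two cone hulls.\<close>
    have "dominates zs ws"
      unfolding dominates_def
    proof
      fix \<phi> assume "\<phi> \<in> bounded_forms"
      thus "(\<Sum>(x, x', y)\<leftarrow>zs. (cmod (\<phi> x - \<phi> x'))\<^sup>2) \<le> (\<Sum>(a, b)\<leftarrow>ws. (cmod (\<phi> a - \<phi> b))\<^sup>2)"
        using le[of \<phi>] unfolding ws(2) zs(2) form_dist_def form_eval_def by (simp only: if_True)
    qed
    hence "t \<le> C\<^sup>2 * dist_sum ws"
      unfolding zs(3) by (intro bound ws(1)) (use zs(1) in auto)
    thus ?thesis using ws(3) by simp
  qed
  define L where "L = dominated_functions (cone_hull SU)"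
  obtain \<Lambda> where "positive_functional L \<Lambda>" and upper: "\<And>g s. (g, s) \<in> cone_hull SU \<Longrightarrow> g \<in> L \<Longrightarrow> \<Lambda> g \<le> s"
    and lower: "\<And>h t. (h, t) \<in> cone_hull SV \<Longrightarrow> h \<in> L \<Longrightarrow> t \<le> \<Lambda> h"
  proof (rule positive_functional_between[OF U V, folded L_def])
    show "t \<le> s" if "(g, s) \<in> cone_hull SU" "(h, t) \<in> cone_hull SV" "\<And>\<phi>. h \<phi> \<le> g \<phi>" for g s h t
      using that by (rule consistent)
  qed (rule that)
  then interpret P: L2_setting L \<Lambda> K by (intro L2_setting.intro L2_setting_axioms.intro K)
  interpret S: semi_inner_product K P.square_integrable P.L2_ip by (rule P.semi_inner_product_L2)
  have distU: "(form_dist a b, C\<^sup>2 * (proj_dist a b)\<^sup>2) \<in> cone_hull SU" if "a \<in> tup" "b \<in> tup" for a b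
    by (rule cone_hullI[OF SU[OF that order_refl]])
  have distL: "form_dist a b \<in> L" if "a \<in> tup" "b \<in> tup" for a b
    unfolding L_def by (rule dominated_functionsI[OF distU[OF that]]) (simp add: form_dist_def)
  \<comment> \<open>The square of \<open>cmod (form_eval x \<phi>)\<close> is
    \<open>form_dist x zero_tuple \<phi>\<close>, the function of an upper constraint and hence in
    \<open>L\<close>.\<close>
  have evL: "form_eval x \<in> P.square_integrable" if "x \<in> tup" for x
    using distL[OF that zero_tuple_in] form_eval_in_K[OF that]
    by (simp add: P.square_integrable_def form_dist_zero_right[abs_def])
  obtain H :: "((((nat \<Rightarrow> 'a) \<Rightarrow> complex) \<Rightarrow> complex) \<Rightarrow> complex) nspace" and J
    where H: "hilbert_space K H" and JH: "\<And>f. f \<in> P.square_integrable \<Longrightarrow> J f \<in> carrier H"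
    and Jadd: "\<And>f g. f \<in> P.square_integrable \<Longrightarrow> g \<in> P.square_integrable \<Longrightarrow> J (f + g) = J f \<oplus>\<^bsub>H\<^esub> J g"
    and Jsm: "\<And>c f. c \<in> K \<Longrightarrow> f \<in> P.square_integrable \<Longrightarrow> J (\<lambda>x. c * f x) = c \<odot>\<^bsub>H\<^esub> J f"
    and Jdiff: "\<And>f g. f \<in> P.square_integrable \<Longrightarrow> g \<in> P.square_integrable \<Longrightarrow> J (f - g) = J f \<ominus>\<^bsub>H\<^esub> J g"
    and Jnorm: "\<And>f. f \<in> P.square_integrable \<Longrightarrow> vnorm H (J f) = sqrt (Re (P.L2_ip f f))"
    by (rule S.completion_exists) (rule that)
  define A where "A = (\<lambda>x\<in>tup. J (form_eval x))"
  \<comment> \<open>\<open>B\<close> matters on the image of \<open>A\<close> and is given by a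
    chosen preimage. \<open>Tdiff\<close> at distance 0 will show that \<open>T\<close> does not
    depend on the choice.\<close>
  define B where "B h = T (inv_into tup A h)" for h
  have A: "A x = J (form_eval x)" if "x \<in> tup" for x using that by (simp add: A_def)
  have AH: "A x \<in> carrier H" if "x \<in> tup" for x using A[OF that] JH[OF evL[OF that]] by simp
  have Adiff: "vnorm H (A a \<ominus>\<^bsub>H\<^esub> A b) = sqrt (\<Lambda> (form_dist a b))" if "a \<in> tup" "b \<in> tup" for a b
    using that Jdiff[OF evL evL, of a b] Jnorm[OF S.diff_closed[OF evL evL], of a b]
    by (simp add: A P.L2_ip_self form_dist_def)
  have mA: "multilinear K n X H A"
    unfolding multilinear_def
  proof (intro conjI ballI)
    show "A \<in> tup \<rightarrow>\<^sub>E carrier H" using AH by (auto simp: A_def)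
  next
    fix x i a b assume h: "x \<in> tup" "i \<in> {1..n}" "a \<in> carrier (X i)" "b \<in> carrier (X i)"
    show "A (x(i := a \<oplus>\<^bsub>X i\<^esub> b)) = A (x(i := a)) \<oplus>\<^bsub>H\<^esub> A (x(i := b))"
      unfolding A[OF tuples_upd[OF h(1,2) X_add[OF h(2-4)]]] A[OF tuples_upd[OF h(1-3)]] A[OF tuples_upd[OF h(1,2,4)]]
        form_eval_add[OF h] by (rule Jadd[OF evL[OF tuples_upd[OF h(1-3)]] evL[OF tuples_upd[OF h(1,2,4)]]])
  next
    fix x i c a assume h: "x \<in> tup" "i \<in> {1..n}" "c \<in> K" "a \<in> carrier (X i)"
    show "A (x(i := c \<odot>\<^bsub>X i\<^esub> a)) = c \<odot>\<^bsub>H\<^esub> A (x(i := a))"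
      unfolding A[OF tuples_upd[OF h(1,2) X_smult[OF h(2-4)]]] A[OF tuples_upd[OF h(1,2,4)]] form_eval_smult[OF h]
      by (rule Jsm[OF h(3) evL[OF tuples_upd[OF h(1,2,4)]]])
  qed
  have Abound: "vnorm H (A x) \<le> C * pnorm x" if x: "x \<in> tup" for x
  proof -
    have "vnorm H (A x) = sqrt (\<Lambda> (form_dist x zero_tuple))"
      by (simp add: A[OF x] Jnorm[OF evL[OF x]] P.L2_ip_self form_dist_zero_right[abs_def])
    also have "\<dots> \<le> sqrt (C\<^sup>2 * (proj_dist x zero_tuple)\<^sup>2)"
      by (rule real_sqrt_le_mono[OF upper[OF distU[OF x zero_tuple_in] distL[OF x zero_tuple_in]]])
    also have "\<dots> = C * proj_dist x zero_tuple"
      using C proj_dist_nonneg[OF x zero_tuple_in] by (simp add: real_sqrt_mult)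
    also have "\<dots> \<le> C * pnorm x"
      by (rule mult_left_mono[OF proj_dist_zero_right[OF x] C])
    finally show ?thesis .
  qed
  hence bA: "bounded_multilinear K n X H A" using mA by (auto simp: bounded_multilinear_def)
  have normA: "multilinear_norm n X H A \<le> C"
    unfolding multilinear_norm_def
  proof (rule cSUP_least)
    show "{x \<in> tup. \<forall>i\<in>{1..n}. vnorm (X i) (x i) \<le> 1} \<noteq> {}"
      using zero_tuple_in X_zero by (auto simp: zero_tuple_def intro!: exI[of _ zero_tuple])
    fix x assume x: "x \<in> {x \<in> tup. \<forall>i\<in>{1..n}. vnorm (X i) (x i) \<le> 1}"
    have "pnorm x \<le> 1" by (rule prod_le_1) (use x X_nonneg tuples_nth in auto)
    hence "C * pnorm x \<le> C * 1" by (rule mult_left_mono[OF _ C])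
    thus "vnorm H (A x) \<le> C" using Abound x by fastforce
  qed
  have TD: "T x \<in> carrier D" if "x \<in> tup" for x by (rule multilinearD(1)[OF T that])
  have Tdiff: "vnorm D (T a \<ominus>\<^bsub>D\<^esub> T b) \<le> vnorm H (A a \<ominus>\<^bsub>H\<^esub> A b)" if ab: "a \<in> tup" "b \<in> tup" for a b
    unfolding dual_space_simps(5)
  proof (rule cSUP_least)
    show "{y \<in> carrier Y. vnorm Y y \<le> 1} \<noteq> {}" using Y_zero by force
    fix y assume "y \<in> {y \<in> carrier Y. vnorm Y y \<le> 1}"
    hence y: "y \<in> carrier Y" "vnorm Y y \<le> 1" by auto
    have "(cmod (T a y - T b y))\<^sup>2 \<le> \<Lambda> (form_dist a b)" by (rule lower[OF cone_hullI[OF SV[OF ab y]] distL[OF ab]])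
    thus "cmod ((T a \<ominus>\<^bsub>D\<^esub> T b) y) \<le> vnorm H (A a \<ominus>\<^bsub>H\<^esub> A b)"
      using D_minus[OF TD[OF ab(1)] TD[OF ab(2)]] y by (simp add: Adiff[OF ab] real_le_rsqrt)
  qed
  have inv: "inv_into tup A h \<in> tup" "A (inv_into tup A h) = h" if "h \<in> A ` tup" for h
    using that by (rule inv_into_into, rule f_inv_into_f)
  have BA: "T x = B (A x)" if x: "x \<in> tup" for x
  proof (rule extensionalityI[of _ "carrier Y"])
    let ?x = "inv_into tup A (A x)"
    have x': "?x \<in> tup" "A ?x = A x" using inv[OF imageI[OF x]] by auto
    show "T x \<in> extensional (carrier Y)" "B (A x) \<in> extensional (carrier Y)"
      using TD[OF x] TD[OF x'(1)] by (auto simp: B_def dual_space_simps)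
    interpret H: banach_space K H using H by (simp add: hilbert_space_def)
    have "vnorm H (A x \<ominus>\<^bsub>H\<^esub> A ?x) = 0"
      using AH[OF x] H.norm_eq_zero[of "\<zero>\<^bsub>H\<^esub>"] unfolding x'(2) by (simp add: a_minus_def H.r_neg)
    hence le: "vnorm D (T x \<ominus>\<^bsub>D\<^esub> T ?x) \<le> 0" using Tdiff[OF x x'(1)] by simp
    have DD: "T x \<ominus>\<^bsub>D\<^esub> T ?x \<in> carrier D"
      by (rule abelian_group.minus_closed[OF abelian_group_dual_space(1)[OF K module_Y] TD[OF x] TD[OF x'(1)]])
    fix y assume y: "y \<in> carrier Y"
    have "cmod ((T x \<ominus>\<^bsub>D\<^esub> T ?x) y) \<le> vnorm D (T x \<ominus>\<^bsub>D\<^esub> T ?x) * vnorm Y y"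
      by (rule dual_space_norm_bound[OF Y K DD y])
    also have "\<dots> \<le> 0" using le normed_space.norm_nonneg[OF Y y] by (simp add: mult_nonpos_nonneg)
    finally show "T x y = B (A x) y"
      using D_minus[OF TD[OF x] TD[OF x'(1)]] y by (simp add: B_def)
  qed
  have lip: "lipschitz_const H D (A ` tup) B 1"
    unfolding lipschitz_const_def
  proof (intro conjI ballI)
    fix g h assume gh: "g \<in> A ` tup" "h \<in> A ` tup"
    show "vnorm D (B g \<ominus>\<^bsub>D\<^esub> B h) \<le> 1 * vnorm H (g \<ominus>\<^bsub>H\<^esub> h)"
      using Tdiff[OF inv(1)[OF gh(1)] inv(1)[OF gh(2)]] by (simp add: B_def inv(2)[OF gh(1)] inv(2)[OF gh(2)])
  qed simp
  show ?thesis
  proof (rule that)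
    show "hilbert_factorization K n X D T H (A ` tup) A B"
      unfolding hilbert_factorization_def using H bA lip AH BA TD[OF inv(1)] by (auto simp: B_def)
    show "multilinear_norm n X H A \<le> C" by (rule normA)
    show "Lip H D (A ` tup) B \<le> 1"
      unfolding Lip_def by (rule cInf_lower) (use lip in \<open>auto intro!: bdd_belowI[of _ 0] simp: lipschitz_const_def\<close>)
  qed
qed

end

section \<open>The duality theorem\<close>

theorem theorem4p4:
  fixes K :: "complex set" and n :: nat and X :: "nat \<Rightarrow> 'a nspace" and Y :: "'y nspace"
  assumes "K = \<real> \<or> K = UNIV"
    and "n \<ge> 1"
    and "\<And>i. i \<in> {1..n} \<Longrightarrow> banach_space K (X i)"
    and "banach_space K Y"
  shows "isometric_isomorphism K
           (dual_space K (gamma_tensor_space K n X Y))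
           (gamma_operators K n X (dual_space K Y))
           (duality_map K n X Y)"
proof -
  interpret gamma_setting K n X Y
    by (intro gamma_setting.intro multilinear_setting.intro gamma_setting_axioms.intro
        banach_space.axioms(1) assms)
  let ?E = "dual_space K G" and ?F = "gamma_operators K n X D"
  have F: "carrier ?F = {T. gamma_factorizable K n X D T}"
    "S \<oplus>\<^bsub>?F\<^esub> T = (\<lambda>x\<in>tup. S x \<oplus>\<^bsub>D\<^esub> T x)" "c \<odot>\<^bsub>?F\<^esub> T = (\<lambda>x\<in>tup. c \<odot>\<^bsub>D\<^esub> T x)"
    "vnorm ?F = gamma_functional K n X D" for S T c
    by (simp_all add: gamma_operators_def)
  \<comment> \<open>Makes 0 a lower bound of the products whose infimum is
    \<open>gamma_functional\<close>.\<close>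
  have fact_nonneg: "0 \<le> multilinear_norm n X H A" "0 \<le> Lip H D M B"
    if fact: "hilbert_factorization K n X D T H M A B" for T M A B and H :: "'a hilbert_universe nspace"
  proof -
    have hs: "hilbert_space K H" and MH: "M \<subseteq> carrier H" and bA: "bounded_multilinear K n X H A"
      and lip: "\<exists>L. lipschitz_const H D M B L" using fact by (auto simp: hilbert_factorization_def)
    interpret H: banach_space K H using hs by (simp add: hilbert_space_def)
    have "lipschitz_const H D M B (Lip H D M B)"
      using lip MH by (elim exE) (rule Lip_bound, auto intro: H.norm_nonneg)
    thus "0 \<le> Lip H D M B" by (simp add: lipschitz_const_def)
    show "0 \<le> multilinear_norm n X H A" by (rule multilinear_norm_bound(2)[OF H.normed_space_axioms bA zero_tuple_in])
  qed
  have upper: "gamma_factorizable K n X D (op_of f) \<and> gamma_functional K n X D (op_of f) \<le> vnorm ?E f"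
    if f: "f \<in> carrier ?E" for f
  proof -
    let ?C = "vnorm ?E f"
    note T = op_of_multilinear[OF f] and C = functional_norm_nonneg[OF f]
    obtain H :: "((((nat \<Rightarrow> 'a) \<Rightarrow> complex) \<Rightarrow> complex) \<Rightarrow> complex) nspace" and M A B
      where fact: "hilbert_factorization K n X D (op_of f) H M A B" "multilinear_norm n X H A \<le> ?C" "Lip H D M B \<le> 1"
      by (rule square_bound_factorization[OF T C functional_square_bound[OF f]])
    \<comment> \<open>The Hilbert space built from \<open>f\<close> does not have the type over
      which \<open>gamma_functional\<close> ranges. The transport keeps the norm of \<open>A\<close>
      and does not increase the Lipschitz constant.\<close>
    obtain H' :: "'a hilbert_universe nspace" and M' A' B'
      where fact': "hilbert_factorization K n X D (op_of f) H' M' A' B'"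
        "multilinear_norm n X H' A' = multilinear_norm n X H A" "Lip H' D M' B' \<le> Lip H D M B"
      using hilbert_factorization_universe[OF K assms(3) fact(1)] by blast
    have "gamma_functional K n X D (op_of f) \<le> multilinear_norm n X H' A' * Lip H' D M' B'"
      unfolding gamma_functional_def
      by (rule cInf_lower) (use fact'(1) fact_nonneg in \<open>auto intro!: bdd_belowI[of _ 0]\<close>)
    also have "\<dots> \<le> ?C * 1"
      using fact(2,3) fact'(2,3) C fact_nonneg(2)[OF fact'(1)] by (intro mult_mono) auto
    finally show ?thesis using T fact'(1) unfolding gamma_factorizable_def by auto
  qed
  have bound: "cmod (f u) \<le> multilinear_norm n X H A * Lip H D M B * gamma_norm K n X Y u"
    if "hilbert_factorization K n X D T H M A B" "multilinear K n X D T"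
      "linear_on K tensors2 (scalar_space K) f" "\<And>x y. x \<in> tup \<Longrightarrow> y \<in> carrier Y \<Longrightarrow> f (et2 (et x) y) = T x y"
      "u \<in> carrier tensors2" for f u T M A B and H :: "'a hilbert_universe nspace"
    using that by (rule factorization_bound)
  have lower: "vnorm ?E f \<le> gamma_functional K n X D (op_of f)" if f: "f \<in> carrier ?E" for f
    unfolding gamma_functional_def
  proof (rule cInf_greatest)
    show "{multilinear_norm n X H A * Lip H D M B | (H :: 'a hilbert_universe nspace) M A B.
        hilbert_factorization K n X D (op_of f) H M A B} \<noteq> {}"
      using upper[OF f] unfolding gamma_factorizable_def by blast
    fix r assume "r \<in> {multilinear_norm n X H A * Lip H D M B | (H :: 'a hilbert_universe nspace) M A B.
        hilbert_factorization K n X D (op_of f) H M A B}"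
    then obtain H :: "'a hilbert_universe nspace" and M A B where r: "r = multilinear_norm n X H A * Lip H D M B"
      and fact: "hilbert_factorization K n X D (op_of f) H M A B" by blast
    have r0: "0 \<le> r" unfolding r by (intro mult_nonneg_nonneg fact_nonneg[OF fact])
    show "vnorm ?E f \<le> r"
      unfolding dual_space_simps(5)
    proof (rule cSUP_least)
      show "{u \<in> carrier G. vnorm G u \<le> 1} \<noteq> {}"
        using G_zero by blast
      fix u assume "u \<in> {u \<in> carrier G. vnorm G u \<le> 1}"
      hence u: "u \<in> carrier tensors2" "gamma_norm K n X Y u \<le> 1" by (auto simp: G_simps)
      have "cmod (f u) \<le> r * gamma_norm K n X Y u"
        unfolding r by (rule bound[OF fact op_of_multilinear[OF f] functional_linear[OF f] op_of_apply[symmetric] u(1)])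
      also have "\<dots> \<le> r * 1" by (rule mult_left_mono[OF u(2) r0])
      finally show "cmod (f u) \<le> r" by simp
    qed
  qed
  \<comment> \<open>Every tensor is a \<open>diff_tensor\<close>, and there the value of a
    functional is a sum of values of its operator.\<close>
  have inj: "inj_on op_of (carrier ?E)"
  proof (rule inj_onI)
    fix f g assume f: "f \<in> carrier ?E" and g: "g \<in> carrier ?E" and eq: "op_of f = op_of g"
    show "f = g"
    proof (rule extensionalityI[of _ "carrier G"])
      fix u assume "u \<in> carrier G"
      then obtain zs where "set zs \<subseteq> triples" "u = diff_tensor zs"
        using diff_tensor_exists by (auto simp: G_simps)
      thus "f u = g u" by (simp add: functional_diff_tensor[OF f] functional_diff_tensor[OF g] eq)
    qed (use f g in \<open>simp_all add: dual_space_simps\<close>)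
  qed
  have surj: "T \<in> op_of ` carrier ?E" if T0: "gamma_factorizable K n X D T" for T
  proof
    obtain H :: "'a hilbert_universe nspace" and M A B where T: "multilinear K n X D T"
      and fact: "hilbert_factorization K n X D T H M A B" using T0 unfolding gamma_factorizable_def by blast
    let ?f = "operator_functional T"
    note lin = operator_functional_linear[OF T] and val = operator_functional_et2[OF T]
    \<comment> \<open>The constant of any one factorization bounds the linearization of
      \<open>T\<close> with respect to gamma, which places it in the dual.\<close>
    have "\<forall>u\<in>carrier G. cmod (?f u) \<le> (multilinear_norm n X H A * Lip H D M B) * vnorm G u"
      using bound[OF fact T lin val] by (simp add: G_simps)
    thus "?f \<in> carrier ?E"
      using lin by (auto simp: dual_space_simps linear_on_G G_simps operator_functional_def)
    show "T = op_of ?f"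
    proof (rule extensionalityI[of _ tup])
      show "T \<in> extensional tup" using T by (auto simp: multilinear_def PiE_def)
      show "op_of ?f \<in> extensional tup" by (simp add: duality_map_def)
      fix x assume x: "x \<in> tup"
      show "T x = op_of ?f x"
      proof (rule extensionalityI[of _ "carrier Y"])
        show "T x \<in> extensional (carrier Y)" using multilinearD(1)[OF T x] by (simp add: dual_space_simps)
        show "op_of ?f x \<in> extensional (carrier Y)" using x by (simp add: duality_map_def)
        show "T x y = op_of ?f x y" if "y \<in> carrier Y" for y
          using val[OF x that] x that by (simp add: op_of_apply)
      qed
    qed
  qed
  show ?thesis
    unfolding isometric_isomorphism_def
  proof (intro conjI ballI)
    show "linear_on K ?E ?F op_of"
      unfolding linear_on_def
    proof (intro conjI ballI)
      show "op_of \<in> carrier ?E \<rightarrow> carrier ?F" using upper by (auto simp: F)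
    next
      fix f g
      show "op_of (f \<oplus>\<^bsub>?E\<^esub> g) = op_of f \<oplus>\<^bsub>?F\<^esub> op_of g"
        unfolding duality_map_def F dual_space_simps
        by (intro restrict_ext) (auto simp: G_simps et2_in et_in intro!: restrict_ext)
    next
      fix c f
      show "op_of (c \<odot>\<^bsub>?E\<^esub> f) = c \<odot>\<^bsub>?F\<^esub> op_of f"
        unfolding duality_map_def F dual_space_simps
        by (intro restrict_ext) (auto simp: G_simps et2_in et_in intro!: restrict_ext)
    qed
    show "bij_betw op_of (carrier ?E) (carrier ?F)"
      unfolding bij_betw_def using inj surj upper by (auto simp: F)
    show "vnorm ?F (op_of f) = vnorm ?E f" if "f \<in> carrier ?E" for f
      using upper[OF that] lower[OF that] by (simp add: F)
  qed
qed

end
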